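(* Let $\mathcal F$ be a hyperbolic singular holomorphic foliation by curves on a complex manifold $M$ with singular set $E\subset M$, let $g$ be a hermitian metric on $M$, and let $\eta:M\setminus E\to(0,\infty)$ be the modulus of uniformization of $\mathcal F$. Suppose that the space of uniformizations $\mathcal U$ is NCP. If a leaf $L$ of $\mathcal F$ is not a local separatrix at any singular point $q\in E$, then $\eta$ is continuous at each $p\in L$.
   Context: A singular holomorphic foliation by curves (shfc) $\mathcal F$ on a complex manifold $M$ with singular set $E$ is a foliation locally generated by holomorphic vector fields whose zero set is $E$, where $E\subset M$ is a complex analytic set of codimension at least $2$; it is a nonsingular holomorphic foliation by Riemann surfaces on $M\setminus E$. Leaves are the leaves on $M\setminus E$. $\mathcal F$ is hyperbolic if every leaf is a hyperbolic Riemann surface (universally covered by the unit disc $\mathbb D$). Modulus of uniformization: let $\mathcal O(\mathbb D,\mathcal F)$ be the set of holomorphic maps $f:\mathbb D\to M\setminus E$ whose image lies in a single leaf. For $z\in M\setminus E$, $\eta(z)=\sup\{|f'(0)|_g : f\in\mathcal O(\mathbb D,\mathcal F),\ f(0)=z\}$, where $|\cdot|_g$ is the length with respect to $g$. Continuity of $\eta$ at $p$ is as a function on $M\setminus E$ (not merely along the leaf). $\mathcal U=\{\alpha\in\mathcal O(\mathbb D,\mathcal F): \alpha \text{ is a uniformization (universal covering map) of a leaf of }\mathcal F\}$. $\mathcal U$ is NCP (normal on compact parts) if for every $\mathcal H\subset\mathcal U$ with $\{\alpha(0):\alpha\in\mathcal H\}$ relatively compact in $M$, the family $\mathcal H$ is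 normal, i.e. every sequence in $\mathcal H$ has a subsequence converging uniformly on compact subsets of $\mathbb D$ to a holomorphic map $\mathbb D\to M$. A leaf $L$ is a local separatrix at $q\in E$ if there are a neighbourhood $W$ of $q$ in $M$ and an irreducible one-dimensional complex analytic subset $C\subset W$ with $q\in C$ and $C\setminus\{q\}\subset L$. *)

theory Defs
  imports "HOL-Complex_Analysis.Complex_Analysis"
begin

section \<open>Functions of several complex variables\<close>

text \<open>Both notions below are only used on open sets.\<close>

definition sc_holomorphic_on :: "(complex^'n \<Rightarrow> complex) \<Rightarrow> (complex^'n) set \<Rightarrow> bool" where
  "sc_holomorphic_on f S \<longleftrightarrow>
     (\<forall>z\<in>S. \<exists>D. (f has_derivative D) (at z) \<and> (\<forall>c v. D (c *s v) = c * D v))"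

definition sc_holomorphic_map_on ::
    "(complex^'n \<Rightarrow> complex^'m) \<Rightarrow> (complex^'n) set \<Rightarrow> bool" where
  "sc_holomorphic_map_on f S \<longleftrightarrow> (\<forall>i. sc_holomorphic_on (\<lambda>z. f z $ i) S)"

primrec Ck_on ::
    "nat \<Rightarrow> ('b::euclidean_space \<Rightarrow> 'c::real_normed_vector) \<Rightarrow> 'b set \<Rightarrow> bool" where
  "Ck_on 0 = (\<lambda>f S. continuous_on S f)"
| "Ck_on (Suc k) = (\<lambda>f S. (\<forall>x\<in>S. f differentiable (at x)) \<and>
     (\<forall>b\<in>Basis. Ck_on k (\<lambda>x. frechet_derivative f (at x) b) S))"

definition Cinf_on :: "('b::euclidean_space \<Rightarrow> 'c::real_normed_vector) \<Rightarrow> 'b set \<Rightarrow> bool" where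
  "Cinf_on f S \<longleftrightarrow> (\<forall>k. Ck_on k f S)"


section \<open>Complex manifolds\<close>

text \<open>
  The underlying space of the manifold is a whole type \<open>'a\<close>; its complex dimension is
  \<open>CARD('n)\<close>. Hausdorffness and second countability are imposed through the type classes
  \<open>t2_space\<close> and \<open>second_countable_topology\<close> of \<open>'a\<close>. A chart is a pair of an open domain and a
  coordinate map, whose values outside the domain are irrelevant.
\<close>

type_synonym ('a, 'n) chart = "'a set \<times> ('a \<Rightarrow> complex^'n)"

definition is_chart :: "('a::topological_space, 'n::finite) chart \<Rightarrow> bool" where
  "is_chart c \<longleftrightarrow> open (fst c) \<and> open (snd c ` fst c) \<and>
     (\<exists>h. homeomorphism (fst c) (snd c ` fst c) (snd c) h)"

definition chart_inv :: "('a, 'n::finite) chart \<Rightarrow> complex^'n \<Rightarrow> 'a" where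
  "chart_inv c = inv_into (fst c) (snd c)"

definition transition ::
    "('a, 'n::finite) chart \<Rightarrow> ('a, 'n) chart \<Rightarrow> complex^'n \<Rightarrow> complex^'n" where
  "transition c d = (\<lambda>z. snd d (chart_inv c z))"

definition jacobian ::
    "('a, 'n::finite) chart \<Rightarrow> ('a, 'n) chart \<Rightarrow> 'a \<Rightarrow> complex^'n \<Rightarrow> complex^'n" where
  "jacobian c d p = frechet_derivative (transition c d) (at (snd c p))"

definition compatible_charts :: "('a, 'n::finite) chart \<Rightarrow> ('a, 'n) chart \<Rightarrow> bool" where
  "compatible_charts c d \<longleftrightarrow>
     sc_holomorphic_map_on (transition c d) (snd c ` (fst c \<inter> fst d)) \<and>
     sc_holomorphic_map_on (transition d c) (snd d ` (fst c \<inter> fst d))"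

text \<open>A complex manifold is given by its maximal holomorphic atlas.\<close>

definition complex_manifold :: "('a::topological_space, 'n::finite) chart set \<Rightarrow> bool" where
  "complex_manifold A \<longleftrightarrow>
     (\<Union>c\<in>A. fst c) = UNIV \<and>
     (\<forall>c\<in>A. is_chart c) \<and>
     (\<forall>c\<in>A. \<forall>d\<in>A. compatible_charts c d) \<and>
     (\<forall>c. is_chart c \<and> (\<forall>d\<in>A. compatible_charts c d) \<longrightarrow> c \<in> A)"

definition holomorphic_function_on ::
    "('a, 'n::finite) chart set \<Rightarrow> 'a set \<Rightarrow> ('a \<Rightarrow> complex) \<Rightarrow> bool" where
  "holomorphic_function_on A U f \<longleftrightarrow>
     (\<forall>c\<in>A. sc_holomorphic_on (\<lambda>z. f (chart_inv c z)) (snd c ` (fst c \<inter> U)))"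

abbreviation unit_disc :: "complex set" where
  "unit_disc \<equiv> ball 0 1"

text \<open>Holomorphic maps from the unit disc to the manifold; values outside the disc are irrelevant.\<close>

definition holomorphic_disc ::
    "('a::topological_space, 'n::finite) chart set \<Rightarrow> (complex \<Rightarrow> 'a) \<Rightarrow> bool" where
  "holomorphic_disc A f \<longleftrightarrow> continuous_on unit_disc f \<and>
     (\<forall>c\<in>A. \<forall>i. (\<lambda>t. snd c (f t) $ i) holomorphic_on {t \<in> unit_disc. f t \<in> fst c})"

definition velocity :: "('a, 'n::finite) chart \<Rightarrow> (complex \<Rightarrow> 'a) \<Rightarrow> complex \<Rightarrow> complex^'n" where
  "velocity c f t = (\<chi> i. deriv (\<lambda>s. snd c (f s) $ i) t)"


section \<open>Vector fields and hermitian metrics\<close>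

text \<open>
  A tangent vector (field) is the family of its components in all charts, subject to the usual
  transformation rule; likewise a hermitian metric is the family of its coefficient matrices.
\<close>

type_synonym ('a, 'n) vfield = "('a, 'n) chart \<Rightarrow> 'a \<Rightarrow> complex^'n"

definition holomorphic_vfield_on ::
    "('a, 'n::finite) chart set \<Rightarrow> 'a set \<Rightarrow> ('a, 'n) vfield \<Rightarrow> bool" where
  "holomorphic_vfield_on A U X \<longleftrightarrow>
     (\<forall>c\<in>A. sc_holomorphic_map_on (\<lambda>z. X c (chart_inv c z)) (snd c ` (fst c \<inter> U))) \<and>
     (\<forall>c\<in>A. \<forall>d\<in>A. \<forall>p \<in> U \<inter> fst c \<inter> fst d. X d p = jacobian c d p (X c p))"

definition vfield_zeros ::
    "('a, 'n::finite) chart set \<Rightarrow> 'a set \<Rightarrow> ('a, 'n) vfield \<Rightarrow> 'a set" where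
  "vfield_zeros A U X = {p \<in> U. \<forall>c\<in>A. p \<in> fst c \<longrightarrow> X c p = 0}"

type_synonym ('a, 'n) metric_coeffs = "('a, 'n) chart \<Rightarrow> 'a \<Rightarrow> complex^'n^'n"

definition sesq_form :: "complex^'n^'n \<Rightarrow> complex^'n \<Rightarrow> complex^'n \<Rightarrow> complex" where
  "sesq_form h v w = (\<Sum>i\<in>UNIV. \<Sum>j\<in>UNIV. h $ i $ j * v $ i * cnj (w $ j))"

definition hermitian_metric ::
    "('a, 'n::finite) chart set \<Rightarrow> ('a, 'n) metric_coeffs \<Rightarrow> bool" where
  "hermitian_metric A g \<longleftrightarrow>
     (\<forall>c\<in>A. \<forall>p\<in>fst c.
        (\<forall>i j. g c p $ j $ i = cnj (g c p $ i $ j)) \<and>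
        (\<forall>v. v \<noteq> 0 \<longrightarrow> 0 < Re (sesq_form (g c p) v v))) \<and>
     (\<forall>c\<in>A. \<forall>i j. Cinf_on (\<lambda>z. g c (chart_inv c z) $ i $ j) (snd c ` fst c)) \<and>
     (\<forall>c\<in>A. \<forall>d\<in>A. \<forall>p \<in> fst c \<inter> fst d. \<forall>v w.
        sesq_form (g d p) (jacobian c d p v) (jacobian c d p w) = sesq_form (g c p) v w)"

text \<open>The length at \<open>p\<close> of the tangent vector whose components in the chart \<open>c\<close> are \<open>v\<close>.\<close>

definition metric_length ::
    "('a, 'n::finite) metric_coeffs \<Rightarrow> ('a, 'n) chart \<Rightarrow> 'a \<Rightarrow> complex^'n \<Rightarrow> real" where
  "metric_length g c p v = sqrt (Re (sesq_form (g c p) v v))"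


section \<open>Complex analytic sets\<close>

definition analytic_subset ::
    "('a::topological_space, 'n::finite) chart set \<Rightarrow> 'a set \<Rightarrow> 'a set \<Rightarrow> bool" where
  "analytic_subset A W C \<longleftrightarrow> C \<subseteq> W \<and>
     (\<forall>p\<in>W. \<exists>V G. open V \<and> p \<in> V \<and> V \<subseteq> W \<and> finite G \<and>
        (\<forall>f\<in>G. holomorphic_function_on A V f) \<and>
        C \<inter> V = {x \<in> V. \<forall>f\<in>G. f x = 0})"

text \<open>\<open>C\<close> is near \<open>p\<close> a complex submanifold of dimension \<open>k\<close>.\<close>

definition regular_point ::
    "('a, 'n::finite) chart set \<Rightarrow> 'a set \<Rightarrow> nat \<Rightarrow> 'a \<Rightarrow> bool" where
  "regular_point A C k p \<longleftrightarrow> p \<in> C \<and>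
     (\<exists>c\<in>A. \<exists>I. p \<in> fst c \<and> card I + k = CARD('n) \<and>
        C \<inter> fst c = {x \<in> fst c. \<forall>i\<in>I. snd c x $ i = 0})"

text \<open>
  The dimension of an analytic set is the maximal dimension at its regular points
  (which are dense in it); the empty set has every codimension.
\<close>

definition analytic_dim :: "('a, 'n::finite) chart set \<Rightarrow> 'a set \<Rightarrow> nat \<Rightarrow> bool" where
  "analytic_dim A C k \<longleftrightarrow>
     (\<exists>p. regular_point A C k p) \<and> (\<forall>p k'. regular_point A C k' p \<longrightarrow> k' \<le> k)"

definition analytic_codim_ge :: "('a, 'n::finite) chart set \<Rightarrow> 'a set \<Rightarrow> nat \<Rightarrow> bool" where
  "analytic_codim_ge A C m \<longleftrightarrow> (\<forall>p k. regular_point A C k p \<longrightarrow> k + m \<le> CARD('n))"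

definition irreducible_analytic_subset ::
    "('a::topological_space, 'n::finite) chart set \<Rightarrow> 'a set \<Rightarrow> 'a set \<Rightarrow> bool" where
  "irreducible_analytic_subset A W C \<longleftrightarrow> analytic_subset A W C \<and> C \<noteq> {} \<and>
     (\<forall>C1 C2. analytic_subset A W C1 \<and> analytic_subset A W C2 \<and> C = C1 \<union> C2
        \<longrightarrow> C = C1 \<or> C = C2)"


section \<open>Singular holomorphic foliations by curves\<close>

text \<open>
  A foliation is presented by a set of local generators \<open>(U, X)\<close>, with \<open>X\<close> a holomorphic vector
  field on \<open>U\<close>. Generators with overlapping domains span the same line at every point
  off the singular set \<open>E\<close>, i.e. they define the same nonsingular foliation there.
\<close>

type_synonym ('a, 'n) foliation = "('a set \<times> ('a, 'n) vfield) set"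

definition shfc :: "('a::topological_space, 'n::finite) chart set \<Rightarrow> 'a set \<Rightarrow>
    ('a, 'n) foliation \<Rightarrow> bool" where
  "shfc A E F \<longleftrightarrow>
     analytic_subset A UNIV E \<and> analytic_codim_ge A E 2 \<and>
     (\<Union>(U, X)\<in>F. U) = UNIV \<and>
     (\<forall>(U, X)\<in>F. open U \<and> holomorphic_vfield_on A U X \<and> vfield_zeros A U X = E \<inter> U) \<and>
     (\<forall>(U, X)\<in>F. \<forall>(V, Y)\<in>F. \<forall>c\<in>A. \<forall>p \<in> fst c \<inter> U \<inter> V - E. \<exists>h. X c p = h *s Y c p)"

text \<open>
  A flow box in direction \<open>i\<close> is a chart off \<open>E\<close> onto the unit polydisc in which the foliation
  is tangent to the \<open>i\<close>-th coordinate axis; its plaques are the slices on which all other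
  coordinates are constant.
\<close>

definition flow_box :: "('a, 'n::finite) chart set \<Rightarrow> 'a set \<Rightarrow> ('a, 'n) foliation \<Rightarrow>
    ('a, 'n) chart \<Rightarrow> 'n \<Rightarrow> bool" where
  "flow_box A E F c i \<longleftrightarrow> c \<in> A \<and> fst c \<inter> E = {} \<and>
     snd c ` fst c = {z. \<forall>j. cmod (z $ j) < 1} \<and>
     (\<forall>(U, X)\<in>F. \<forall>p \<in> U \<inter> fst c. \<forall>j. j \<noteq> i \<longrightarrow> X c p $ j = 0)"

definition plaques ::
    "('a, 'n::finite) chart set \<Rightarrow> 'a set \<Rightarrow> ('a, 'n) foliation \<Rightarrow> 'a set set" where
  "plaques A E F = {{x \<in> fst c. \<forall>j. j \<noteq> i \<longrightarrow> snd c x $ j = snd c p $ j} | c i p.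
     flow_box A E F c i \<and> p \<in> fst c}"

text \<open>
  The topology on \<open>M - E\<close> whose components are the leaves; on a leaf it is the topology of the
  Riemann surface, in general strictly finer than the subspace topology of \<open>M\<close>.
\<close>

definition leaf_topology ::
    "('a, 'n::finite) chart set \<Rightarrow> 'a set \<Rightarrow> ('a, 'n) foliation \<Rightarrow> 'a topology" where
  "leaf_topology A E F = topology_generated_by (plaques A E F)"

definition leaves ::
    "('a, 'n::finite) chart set \<Rightarrow> 'a set \<Rightarrow> ('a, 'n) foliation \<Rightarrow> 'a set set" where
  "leaves A E F = connected_components_of (leaf_topology A E F)"

definition local_separatrix ::
    "('a::topological_space, 'n::finite) chart set \<Rightarrow> 'a set \<Rightarrow> 'a \<Rightarrow> bool" where
  "local_separatrix A L q \<longleftrightarrow>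
     (\<exists>W C. open W \<and> q \<in> W \<and> irreducible_analytic_subset A W C \<and> analytic_dim A C 1 \<and>
        q \<in> C \<and> C - {q} \<subseteq> L)"


section \<open>Uniformizations\<close>

text \<open>The library's \<^const>\<open>covering_space\<close>, for explicit topologies.\<close>

definition is_covering_map :: "'b topology \<Rightarrow> 'c topology \<Rightarrow> ('b \<Rightarrow> 'c) \<Rightarrow> bool" where
  "is_covering_map X Y p \<longleftrightarrow> continuous_map X Y p \<and> p ` topspace X = topspace Y \<and>
     (\<forall>y\<in>topspace Y. \<exists>T. y \<in> T \<and> openin Y T \<and>
        (\<exists>\<V>. \<Union>\<V> = {x \<in> topspace X. p x \<in> T} \<and> (\<forall>u\<in>\<V>. openin X u) \<and> pairwise disjnt \<V> \<and>
           (\<forall>u\<in>\<V>. homeomorphic_map (subtopology X u) (subtopology Y T) p)))"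

definition leaf_discs :: "('a::topological_space, 'n::finite) chart set \<Rightarrow> 'a set \<Rightarrow>
    ('a, 'n) foliation \<Rightarrow> (complex \<Rightarrow> 'a) set" where
  "leaf_discs A E F = {f. holomorphic_disc A f \<and> (\<exists>L\<in>leaves A E F. f ` unit_disc \<subseteq> L)}"

text \<open>
  As the disc is simply connected, a covering of \<open>L\<close> by the disc is universal. A map into \<open>L\<close> that
  is continuous for the leaf topology is holomorphic into the Riemann surface \<open>L\<close> iff it is
  holomorphic into \<open>M\<close>.
\<close>

definition uniformization_of :: "('a::topological_space, 'n::finite) chart set \<Rightarrow> 'a set \<Rightarrow>
    ('a, 'n) foliation \<Rightarrow> 'a set \<Rightarrow> (complex \<Rightarrow> 'a) \<Rightarrow> bool" where
  "uniformization_of A E F L \<alpha> \<longleftrightarrow> holomorphic_disc A \<alpha> \<and>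
     is_covering_map (top_of_set unit_disc) (subtopology (leaf_topology A E F) L) \<alpha>"

definition hyperbolic_foliation :: "('a::topological_space, 'n::finite) chart set \<Rightarrow> 'a set \<Rightarrow>
    ('a, 'n) foliation \<Rightarrow> bool" where
  "hyperbolic_foliation A E F \<longleftrightarrow> (\<forall>L\<in>leaves A E F. \<exists>\<alpha>. uniformization_of A E F L \<alpha>)"

definition uniformizations :: "('a::topological_space, 'n::finite) chart set \<Rightarrow> 'a set \<Rightarrow>
    ('a, 'n) foliation \<Rightarrow> (complex \<Rightarrow> 'a) set" where
  "uniformizations A E F =
     {\<alpha> \<in> leaf_discs A E F. \<exists>L\<in>leaves A E F. uniformization_of A E F L \<alpha>}"

text \<open>
  Uniformity refers to some metric inducing the topology of the manifold; for continuous limits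
  on compact sets the choice of the metric does not matter.
\<close>

definition converges_locally_uniformly ::
    "(nat \<Rightarrow> complex \<Rightarrow> 'a::topological_space) \<Rightarrow> (complex \<Rightarrow> 'a) \<Rightarrow> bool" where
  "converges_locally_uniformly s l \<longleftrightarrow>
     (\<exists>d. Metric_space UNIV d \<and> Metric_space.mtopology UNIV d = euclidean \<and>
        (\<forall>K. compact K \<and> K \<subseteq> unit_disc \<longrightarrow>
           (\<forall>e>0. \<forall>\<^sub>F n in sequentially. \<forall>t\<in>K. d (s n t) (l t) < e)))"

definition normal_family ::
    "('a::topological_space, 'n::finite) chart set \<Rightarrow> (complex \<Rightarrow> 'a) set \<Rightarrow> bool" where
  "normal_family A H \<longleftrightarrow>
     (\<forall>s::nat \<Rightarrow> complex \<Rightarrow> 'a. (\<forall>n. s n \<in> H) \<longrightarrow>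
        (\<exists>r l. strict_mono r \<and> holomorphic_disc A l \<and> converges_locally_uniformly (s \<circ> r) l))"

definition NCP ::
    "('a::topological_space, 'n::finite) chart set \<Rightarrow> (complex \<Rightarrow> 'a) set \<Rightarrow> bool" where
  "NCP A \<U> \<longleftrightarrow>
     (\<forall>H\<subseteq>\<U>. compact (closure ((\<lambda>\<alpha>. \<alpha> 0) ` H)) \<longrightarrow> normal_family A H)"

text \<open>
  The length of \<open>f'(0)\<close> does not depend on the chart in which it is computed. The supremum is
  taken in the reals: for hyperbolic foliations the set is bounded.
\<close>

definition modulus_of_uniformization :: "('a::topological_space, 'n::finite) chart set \<Rightarrow> 'a set \<Rightarrow>
    ('a, 'n) foliation \<Rightarrow> ('a, 'n) metric_coeffs \<Rightarrow> 'a \<Rightarrow> real" where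
  "modulus_of_uniformization A E F g z =
     Sup {metric_length g c z (velocity c f 0) | f c.
            f \<in> leaf_discs A E F \<and> f 0 = z \<and> c \<in> A \<and> z \<in> fst c}"

end

theory Submission
  imports Defs
begin

no_notation fps_nth (infixl "$" 75)

text \<open>
  Lifting to the universal covering and the Schwarz lemma give \<open>\<eta> p = \<bar>\<alpha>' 0\<bar>\<close> for every uniformization
  \<open>\<alpha>\<close> with \<open>\<alpha> 0 = p\<close>. Let \<open>p\<^sub>n\<close> converge to \<open>p\<close> and let \<open>\<alpha>\<^sub>n\<close> be uniformizations with
  \<open>\<alpha>\<^sub>n 0 = p\<^sub>n\<close>; by NCP a subsequence converges to a holomorphic disc \<open>\<beta>\<close> with \<open>\<beta> 0 = p\<close>. In flow boxes
  \<open>\<beta>\<close> stays in plaques, so off the discrete set \<open>\<beta>\<^sup>-\<^sup>1(E)\<close> it runs in \<open>L\<close>. Near a point of this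
  set the image of \<open>\<beta>\<close> would be a local separatrix, so there is none and \<open>\<beta>\<close> maps the disc to \<open>L\<close>. By
  Montel's theorem applied to lifts of plaque discs through \<open>\<alpha>\<^sub>n\<close>, plaque discs of a size
  depending only on their centre lift through \<open>\<beta>\<close>. Hence the uniformization at \<open>p\<close> lifts through \<open>\<beta>\<close> as well as
  \<open>\<beta>\<close> through it, the Schwarz lemma gives \<open>\<bar>\<beta>' 0\<bar> = \<eta> p\<close>, and \<open>\<eta> p\<^sub>n = \<bar>\<alpha>\<^sub>n' 0\<bar>\<close> converges to \<open>\<eta> p\<close> along the
  subsequence.
\<close>

text \<open>The delicate point is that neither injectivity nor completeness of the uniformizations
  obviously passes to \<open>\<beta>\<close>, and a local homeomorphism alone does not lift discs.
  Lifting plaque discs through \<open>\<beta>\<close> settles both: one lift and the chain rule give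
  a nonzero derivative, and since the admissible size is read off from the point of the leaf, not
  from its preimage, all points over a small plaque have sections on a common neighbourhood. A
  Montel limit of the lifts stays in the open disc by the open mapping theorem, as its value at 0 is
  interior.

  Leaves carry a topology finer than that of the manifold, while \<open>leaf_discs\<close> and the
  limit are only continuous into the manifold. Tangency of the velocity in flow boxes bridges the
  gap: it is preserved by composition, makes a curve continuous into the leaf topology and can be
  tested in any box.

  A local separatrix must be exhibited by holomorphic equations. A parameter in which one coordinate
  of \<open>\<beta>\<close> is a power \<open>s ^ k\<close>, up to a constant, makes products over
  the \<open>k\<close>-th roots of unity into such equations.\<close>

section \<open>Holomorphic functions of several complex variables\<close>

text \<open>\<open>sc_holomorphic_on\<close> at a single point, so that sums, products, quotients
  and compositions get rules without side conditions on sets.\<close>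

definition chol :: "(complex^'n \<Rightarrow> complex) \<Rightarrow> complex^'n \<Rightarrow> bool" where
  "chol f z \<longleftrightarrow> (\<exists>D. (f has_derivative D) (at z) \<and> (\<forall>c v. D (c *s v) = c * D v))"

lemma sc_holomorphic_on_chol: "sc_holomorphic_on f S \<longleftrightarrow> (\<forall>z\<in>S. chol f z)"
  by (simp add: sc_holomorphic_on_def chol_def)

lemma sc_holomorphic_map_on_chol:
  "sc_holomorphic_map_on f S \<longleftrightarrow> (\<forall>z\<in>S. \<forall>i. chol (\<lambda>w. f w $ i) z)"
  by (auto simp: sc_holomorphic_map_on_def sc_holomorphic_on_chol)

lemma norm_vector_smult: "norm (c *s (v :: complex^'n)) = cmod c * norm v"
  by (simp add: norm_vec_def L2_set_right_distrib norm_mult)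

lemma chol_const [intro, simp]: "chol (\<lambda>w. c) z"
  unfolding chol_def by (rule exI[of _ "\<lambda>_. 0"]) auto

lemma chol_nth [intro, simp]: "chol (\<lambda>w. w $ i) z"
  unfolding chol_def
  by (rule exI[of _ "\<lambda>v. v $ i"]) (auto intro!: bounded_linear_imp_has_derivative bounded_linear_vec_nth)

lemma cholI: "(f has_derivative D) (at z) \<Longrightarrow> (\<And>c v. D (c *s v) = c * D v) \<Longrightarrow> chol f z"
  unfolding chol_def by blast

lemma cholE:
  assumes "chol f z"
  obtains D where "(f has_derivative D) (at z)" "\<And>c v. D (c *s v) = c * D v"
  using assms unfolding chol_def by blast

lemma chol_add [intro]: assumes "chol f z" "chol g z" shows "chol (\<lambda>w. f w + g w) z"
proof -
  obtain D D' where *: "(f has_derivative D) (at z)" "\<And>c v. D (c *s v) = c * D v"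
     "(g has_derivative D') (at z)" "\<And>c v. D' (c *s v) = c * D' v"
    using assms by (auto elim!: cholE)
  show ?thesis by (rule cholI[OF has_derivative_add[OF *(1,3)]]) (simp add: * algebra_simps)
qed

lemma chol_minus [intro]: assumes "chol f z" shows "chol (\<lambda>w. - f w) z"
proof -
  obtain D where *: "(f has_derivative D) (at z)" "\<And>c v. D (c *s v) = c * D v"
    using assms by (auto elim!: cholE)
  show ?thesis by (rule cholI[OF has_derivative_minus[OF *(1)]]) (simp add: * algebra_simps)
qed

lemma chol_diff [intro]: "chol f z \<Longrightarrow> chol g z \<Longrightarrow> chol (\<lambda>w. f w - g w) z"
  using chol_add[OF _ chol_minus, of f z g] by simp

lemma chol_mult [intro]: assumes "chol f z" "chol g z" shows "chol (\<lambda>w. f w * g w) z"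
proof -
  obtain D D' where *: "(f has_derivative D) (at z)" "\<And>c v. D (c *s v) = c * D v"
     "(g has_derivative D') (at z)" "\<And>c v. D' (c *s v) = c * D' v"
    using assms by (auto elim!: cholE)
  show ?thesis by (rule cholI[OF has_derivative_mult[OF *(1,3)]]) (simp add: * algebra_simps)
qed

lemma chol_sum [intro]: "(\<And>i. i \<in> I \<Longrightarrow> chol (f i) z) \<Longrightarrow> chol (\<lambda>w. \<Sum>i\<in>I. f i w) z"
  by (induction I rule: infinite_finite_induct) auto

lemma chol_power [intro]: "chol f z \<Longrightarrow> chol (\<lambda>w. f w ^ n) z"
  by (induction n) auto

lemma chol_compose_field:
  assumes "chol f z" "(h has_field_derivative d) (at (f z))"
  shows "chol (\<lambda>w. h (f w)) z"
proof -
  obtain D where D: "(f has_derivative D) (at z)" "\<And>c v. D (c *s v) = c * D v"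
    using assms by (auto elim!: cholE)
  show ?thesis
    by (rule cholI[OF has_derivative_compose[OF D(1) assms(2)[unfolded has_field_derivative_def]]])
      (simp add: D algebra_simps)
qed

lemma chol_divide [intro]:
  assumes "chol f z" "chol g z" "g z \<noteq> 0" shows "chol (\<lambda>w. f w / g w) z"
proof -
  have "chol (\<lambda>w. inverse (g w)) z"
    by (rule chol_compose_field[OF assms(2)]) (auto intro!: derivative_eq_intros simp: assms)
  then show ?thesis using assms(1) by (simp add: divide_inverse chol_mult)
qed

lemma has_derivative_vec:
  fixes f :: "'a::real_normed_vector \<Rightarrow> ('b::euclidean_space)^'n"
  assumes "\<And>i. ((\<lambda>w. f w $ i) has_derivative (D i)) F"
  shows "(f has_derivative (\<lambda>v. \<chi> i. D i v)) F"
proof -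
  have bl: "bounded_linear (D i)" for i using assms has_derivative_bounded_linear by blast
  have "((\<lambda>w. \<Sum>i\<in>UNIV. axis i (f w $ i)) has_derivative (\<lambda>v. \<Sum>i\<in>UNIV. axis i (D i v))) F"
  proof (rule has_derivative_sum)
    fix i :: 'n
    have "bounded_linear (\<lambda>x::'b. axis i x :: 'b^'n)"
      by (intro linear_conv_bounded_linear[THEN iffD1] linearI) (auto simp: axis_def vec_eq_iff)
    then show "((\<lambda>w. axis i (f w $ i)) has_derivative (\<lambda>v. axis i (D i v))) F"
      using assms bounded_linear.has_derivative by blast
  qed
  moreover have "(\<Sum>i\<in>UNIV. axis i (x $ i)) = x" for x :: "'b^'n"
    by (simp add: vec_eq_iff axis_def if_distrib[where f="\<lambda>a. a $ _"] sum.delta cong: if_cong)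
  moreover have "(\<Sum>i\<in>UNIV. axis i (D i v)) = (\<chi> i. D i v)" for v
    by (simp add: vec_eq_iff axis_def if_distrib[where f="\<lambda>a. a $ _"] sum.delta cong: if_cong)
  ultimately show ?thesis by simp
qed

lemma has_derivative_nth:
  assumes "(f has_derivative D) F" shows "((\<lambda>w. f w $ i) has_derivative (\<lambda>v. D v $ i)) F"
  using bounded_linear.has_derivative[OF bounded_linear_vec_nth assms] by blast

lemma chol_map_derivative:
  assumes "\<And>i. chol (\<lambda>w. f w $ i) z"
  obtains D where "(f has_derivative D) (at z)" "\<And>c v. D (c *s v) = c *s D v"
proof -
  obtain D where D: "\<And>i. ((\<lambda>w. f w $ i) has_derivative D i) (at z)" "\<And>i c v. D i (c *s v) = c * D i v"
    using assms unfolding chol_def by metis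
  show thesis
    by (rule that[OF has_derivative_vec[OF D(1)]]) (auto simp: vec_eq_iff D)
qed

lemma chol_compose:
  assumes "chol g (f z)" "\<And>i. chol (\<lambda>w. f w $ i) z"
  shows "chol (\<lambda>w. g (f w)) z"
proof -
  obtain D where D: "(f has_derivative D) (at z)" "\<And>c v. D (c *s v) = c *s D v"
    using chol_map_derivative assms(2) by blast
  obtain D' where D': "(g has_derivative D') (at (f z))" "\<And>c v. D' (c *s v) = c * D' v"
    using assms(1) chol_def by metis
  have "((\<lambda>w. g (f w)) has_derivative (\<lambda>v. D' (D v))) (at z)"
    using has_derivative_compose[OF D(1) D'(1)] .
  then show ?thesis unfolding chol_def using D D' by auto
qed

lemma chol_cong:
  assumes "chol f z" "open S" "z \<in> S" "\<And>w. w \<in> S \<Longrightarrow> f w = g w" shows "chol g z"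
  using assms unfolding chol_def by (metis has_derivative_transform_within_open)

lemma chol_imp_continuous: "chol f z \<Longrightarrow> continuous (at z) f"
  unfolding chol_def by (auto intro: has_derivative_continuous)

abbreviation FD :: "(complex^'n \<Rightarrow> 'b::real_normed_vector) \<Rightarrow> complex^'n \<Rightarrow> complex^'n \<Rightarrow> 'b" where
  "FD f z \<equiv> frechet_derivative f (at z)"

lemma chol_FD:
  assumes "chol f z"
  shows "(f has_derivative FD f z) (at z)" "FD f z (c *s v) = c * FD f z v"
    "FD f z (u + v) = FD f z u + FD f z v"
proof -
  obtain D where D: "(f has_derivative D) (at z)" "\<And>c v. D (c *s v) = c * D v"
    using assms chol_def by metis
  have e: "D = FD f z" using frechet_derivative_at[OF D(1)] .
  show "(f has_derivative FD f z) (at z)" "FD f z (c *s v) = c * FD f z v" using D unfolding e by auto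
  show "FD f z (u + v) = FD f z u + FD f z v"
    unfolding e[symmetric] by (rule linear_add[OF has_derivative_linear[OF D(1)]])
qed

text \<open>Complex linearity turns the real chain rule into one for complex derivatives; velocities
  are transported between charts with it.\<close>

lemma chol_curve:
  assumes "chol g (\<gamma> t)" "\<And>i. ((\<lambda>s. \<gamma> s $ i) has_field_derivative v $ i) (at t)"
  shows "((\<lambda>s. g (\<gamma> s)) has_field_derivative FD g (\<gamma> t) v) (at t)"
proof -
  have "(\<gamma> has_derivative (\<lambda>h. \<chi> i. v $ i * h)) (at t)"
    by (rule has_derivative_vec) (use assms(2) has_field_derivative_def in blast)
  moreover have "(\<lambda>h. \<chi> i. v $ i * h) = (\<lambda>h. h *s v)" by (auto simp: vec_eq_iff mult.commute)
  ultimately have "(\<gamma> has_derivative (\<lambda>h. h *s v)) (at t)" by simp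
  from has_derivative_compose[OF this chol_FD(1)[OF assms(1)]]
  have "((\<lambda>s. g (\<gamma> s)) has_derivative (\<lambda>h. FD g (\<gamma> t) (h *s v))) (at t)" .
  then show ?thesis
    by (simp add: has_field_derivative_def chol_FD[OF assms(1)] mult.commute[of _ "FD g (\<gamma> t) v"])
qed

lemma chol_line:
  assumes "chol g (z + t *s v)"
  shows "((\<lambda>s. g (z + s *s v)) has_field_derivative FD g (z + t *s v) v) (at t)"
  by (rule chol_curve[where \<gamma> = "\<lambda>s. z + s *s v"]) (use assms in \<open>auto intro!: derivative_eq_intros\<close>)

lemma FD_expand:
  assumes "chol f z" shows "FD f z v = (\<Sum>j\<in>UNIV. v $ j * FD f z (axis j 1))"
proof -
  have lin: "linear (FD f z)"
    using has_derivative_linear[OF chol_FD(1)[OF assms]] .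
  have "v = (\<Sum>j\<in>UNIV. v $ j *s axis j 1)" by (simp add: basis_expansion)
  then have "FD f z v = FD f z (\<Sum>j\<in>UNIV. v $ j *s axis j 1)" by simp
  also have "\<dots> = (\<Sum>j\<in>UNIV. FD f z (v $ j *s axis j 1))" using lin by (simp add: linear_sum)
  finally show ?thesis by (simp add: chol_FD(2)[OF assms])
qed

section \<open>Cauchy estimates and uniform limits\<close>

lemma FD_bound:
  assumes "\<And>w. w \<in> ball z r \<Longrightarrow> chol f w" "\<And>w. w \<in> ball z r \<Longrightarrow> cmod (f w) \<le> B" "r > 0"
  shows "cmod (FD f z v) \<le> 2 * B / r * norm v"
proof (cases "v = 0")
  case True
  have "chol f z" using assms by auto
  from chol_FD(2)[OF this, of 0 0] True show ?thesis by simp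
next
  case False
  \<comment> \<open>Half the largest radius for which the complex line through \<open>z\<close>
    stays in the ball, so that Cauchy's inequality can be applied on a closed disc; hence the factor
    2.\<close>
  define \<rho> where "\<rho> = r / (2 * norm v)"
  have \<rho>: "\<rho> > 0" using assms False by (simp add: \<rho>_def)
  have inb: "z + t *s v \<in> ball z r" if "cmod t \<le> \<rho>" for t
  proof -
    have "norm (t *s v) \<le> \<rho> * norm v" unfolding norm_vector_smult using that by (simp add: mult_right_mono)
    also have "\<dots> < r" using False assms by (simp add: \<rho>_def)
    finally show ?thesis by (simp add: dist_norm)
  qed
  have d: "((\<lambda>s. f (z + s *s v)) has_field_derivative FD f (z + t *s v) v) (at t)" if "cmod t \<le> \<rho>" for t
    by (rule chol_line) (use inb[OF that] assms in auto)
  have "cmod ((deriv ^^ 1) (\<lambda>s. f (z + s *s v)) 0) \<le> fact 1 * B / \<rho> ^ 1"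
  proof (rule Cauchy_inequality)
    show "(\<lambda>s. f (z + s *s v)) holomorphic_on ball 0 \<rho>"
      unfolding holomorphic_on_def field_differentiable_def
      using d has_field_derivative_at_within by (metis dist_0_norm less_imp_le mem_ball)
    show "continuous_on (cball 0 \<rho>) (\<lambda>s. f (z + s *s v))"
      unfolding continuous_on_eq_continuous_within
      using d DERIV_isCont continuous_at_imp_continuous_at_within by (metis dist_0_norm mem_cball)
    show "cmod (f (z + x *s v)) \<le> B" if "cmod (0 - x) = \<rho>" for x
      using assms(2) inb that by simp
  qed (use \<rho> in auto)
  moreover have "deriv (\<lambda>s. f (z + s *s v)) 0 = FD f z v"
    using d[of 0] \<rho> DERIV_imp_deriv by fastforce
  ultimately show ?thesis using False by (simp add: \<rho>_def field_simps)
qed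

text \<open>Weierstrass's theorem in several variables: by \<open>FD_bound\<close> the derivatives
  are uniformly Cauchy on a smaller ball, so differentiation commutes with the limit. Convergence of
  the derivatives is stated as well because \<open>first_integral\<close> differentiates a
  series.\<close>

lemma chol_uniform_limit:
  assumes "open S" "\<And>n w. w \<in> S \<Longrightarrow> chol (f n) w" "uniform_limit S f g sequentially" "z \<in> S"
  shows "chol g z \<and> (\<forall>v. (\<lambda>n. FD (f n) z v) \<longlonglongrightarrow> FD g z v)"
proof -
  obtain r0 where r0: "r0 > 0" "ball z r0 \<subseteq> S" using assms openE by blast
  \<comment> \<open>Leaves room inside \<open>S\<close> for a ball of radius \<open>r\<close> about
    each point of \<open>ball z r\<close>.\<close>
  define r where "r = r0 / 2"
  have r: "r > 0" using r0 by (simp add: r_def)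
  have sub: "ball w r \<subseteq> S" if "w \<in> ball z r" for w
  proof -
    have "ball w r \<subseteq> ball z r0"
    proof
      fix x assume "x \<in> ball w r"
      then show "x \<in> ball z r0" using that dist_triangle[of z x w] by (simp add: r_def)
    qed
    then show ?thesis using r0 by auto
  qed
  have zin: "w \<in> S" if "w \<in> ball z r" for w using sub[OF that] r by auto
  have est: "cmod (FD (f n) w v - FD (f m) w v) \<le> 2 * e / r * norm v"
    if "w \<in> ball z r" "\<And>x. x \<in> S \<Longrightarrow> cmod (f n x - f m x) \<le> e" for n m w v e
  proof -
    have *: "chol (f n) w" "chol (f m) w" using assms zin that by auto
    from frechet_derivative_at[OF has_derivative_diff[OF *[THEN chol_FD(1)]]]
    have "FD (\<lambda>x. f n x - f m x) w v = FD (f n) w v - FD (f m) w v" by metis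
    moreover have "cmod (FD (\<lambda>x. f n x - f m x) w v) \<le> 2 * e / r * norm v"
      by (rule FD_bound) (use sub[OF that(1)] assms that r in \<open>auto intro!: chol_diff\<close>)
    ultimately show ?thesis by simp
  qed
  have uc: "\<exists>N. \<forall>m\<ge>N. \<forall>n\<ge>N. \<forall>x\<in>S. cmod (f n x - f m x) \<le> e" if e: "e > 0" for e
  proof -
    obtain N where "\<forall>n\<ge>N. \<forall>x\<in>S. dist (f n x) (g x) < e/2"
      using uniform_limitD[OF assms(3), of "e/2"] e by (auto simp: eventually_sequentially)
    then have "dist (f n x) (f m x) \<le> e" if "n \<ge> N" "m \<ge> N" "x \<in> S" for n m x
      using that by (smt (verit) dist_commute dist_triangle field_sum_of_halves)
    then show ?thesis by (auto simp: dist_norm)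
  qed
  have ucd: "\<exists>N. \<forall>m\<ge>N. \<forall>n\<ge>N. \<forall>w\<in>ball z r. \<forall>v. cmod (FD (f n) w v - FD (f m) w v) \<le> e * norm v" if e: "e > 0" for e
  proof -
    obtain N where N: "\<forall>m\<ge>N. \<forall>n\<ge>N. \<forall>x\<in>S. cmod (f n x - f m x) \<le> e * r / 2"
      using uc[of "e*r/2"] e r by auto
    show ?thesis
    proof (intro exI[of _ N] allI impI ballI)
      fix m n w v assume "N \<le> m" "N \<le> n" "w \<in> ball z r"
      then have "cmod (FD (f n) w v - FD (f m) w v) \<le> 2 * (e * r / 2) / r * norm v"
        using N by (intro est) simp_all
      then show "cmod (FD (f n) w v - FD (f m) w v) \<le> e * norm v" using r by simp
    qed
  qed
  have conv: "convergent (\<lambda>n. FD (f n) w v)" if w: "w \<in> ball z r" for w v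
    unfolding Cauchy_convergent_iff[symmetric]
  proof (rule CauchyI)
    fix e :: real assume e: "e > 0"
    define e' where "e' = e / (norm v + 1)"
    have e': "e' > 0" "e' * norm v < e"
      using e by (auto simp: e'_def divide_simps add_nonneg_pos)
    obtain N where N: "\<forall>m\<ge>N. \<forall>n\<ge>N. \<forall>w\<in>ball z r. \<forall>v. cmod (FD (f n) w v - FD (f m) w v) \<le> e' * norm v"
      using ucd[OF e'(1)] by auto
    have "norm (FD (f m) w v - FD (f n) w v) < e" if "m \<ge> N" "n \<ge> N" for m n
      by (rule le_less_trans[OF N[rule_format, OF that(2) that(1) w] e'(2)])
    then show "\<exists>M. \<forall>m\<ge>M. \<forall>n\<ge>M. norm (FD (f m) w v - FD (f n) w v) < e" by blast
  qed
  define G where "G w v = lim (\<lambda>n. FD (f n) w v)" for w v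
  have G: "(\<lambda>n. FD (f n) w v) \<longlonglongrightarrow> G w v" if "w \<in> ball z r" for w v
    using conv[OF that] by (simp add: G_def convergent_LIMSEQ_iff)
  have "\<exists>h. \<forall>x\<in>ball z r. (\<lambda>n. f n x) \<longlonglongrightarrow> h x \<and> (h has_derivative G x) (at x within ball z r)"
  proof (rule has_derivative_sequence)
    show "(f n has_derivative FD (f n) x) (at x within ball z r)" if "x \<in> ball z r" for n x
      by (rule has_derivative_at_withinI[OF chol_FD(1)[OF assms(2)[OF zin[OF that]]]])
    show "\<forall>\<^sub>F n in sequentially. \<forall>x\<in>ball z r. \<forall>h. norm (FD (f n) x h - G x h) \<le> e * norm h"
      if e: "e > 0" for e
    proof -
      obtain N where N: "\<forall>m\<ge>N. \<forall>n\<ge>N. \<forall>w\<in>ball z r. \<forall>v. cmod (FD (f n) w v - FD (f m) w v) \<le> e * norm v"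
        using ucd[OF e] by auto
      have "norm (FD (f n) x h - G x h) \<le> e * norm h" if "n \<ge> N" "x \<in> ball z r" for n x h
      proof (rule tendsto_upperbound[OF _ eventually_sequentiallyI])
        show "(\<lambda>m. norm (FD (f n) x h - FD (f m) x h)) \<longlonglongrightarrow> norm (FD (f n) x h - G x h)"
          by (intro tendsto_intros G that)
        show "\<And>m. m \<ge> N \<Longrightarrow> norm (FD (f n) x h - FD (f m) x h) \<le> e * norm h"
          by (rule N[rule_format, OF _ that(1) that(2)])
      qed auto
      then show ?thesis by (intro eventually_sequentiallyI[of N] ballI allI)
    qed
    show "(\<lambda>n. f n z) \<longlonglongrightarrow> g z"
      using tendsto_uniform_limitI[OF assms(3,4)] .
  qed (use r in auto)
  then obtain h where h: "\<And>x. x\<in>ball z r \<Longrightarrow> (\<lambda>n. f n x) \<longlonglongrightarrow> h x"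
      "\<And>x. x\<in>ball z r \<Longrightarrow> (h has_derivative G x) (at x within ball z r)" by blast
  have "h x = g x" if "x \<in> ball z r" for x
    by (rule LIMSEQ_unique[OF h(1)[OF that] tendsto_uniform_limitI[OF assms(3) zin[OF that]]])
  moreover have "(h has_derivative G z) (at z)" using h(2)[of z] r at_within_open[of z "ball z r"] by auto
  ultimately have gd: "(g has_derivative G z) (at z)"
    using r by (intro has_derivative_transform_within_open[of h "G z" z UNIV "ball z r" g]) auto
  have "G z (c *s v) = c * G z v" for c v
  proof (rule LIMSEQ_unique)
    show "(\<lambda>n. FD (f n) z (c *s v)) \<longlonglongrightarrow> G z (c *s v)" using G r by auto
    have "(\<lambda>n. c * FD (f n) z v) \<longlonglongrightarrow> c * G z v" using G r by (auto intro!: tendsto_intros)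
    then show "(\<lambda>n. FD (f n) z (c *s v)) \<longlonglongrightarrow> c * G z v" by (simp add: chol_FD(2)[OF assms(2)[OF assms(4)]])
  qed
  with gd have "chol g z" by (rule cholI)
  moreover have "FD g z = G z" using frechet_derivative_at[OF gd] by simp
  moreover have "\<forall>v. (\<lambda>n. FD (f n) z v) \<longlonglongrightarrow> G z v" using G r by auto
  ultimately show ?thesis by simp
qed

text \<open>Difference quotients in the direction \<open>v\<close> are holomorphic and converge
  locally uniformly, by Taylor's formula of order one along complex lines and a Cauchy bound for the
  second derivative.\<close>

lemma chol_FD_const:
  assumes "open S" "\<And>w. w \<in> S \<Longrightarrow> chol f w" "z \<in> S"
  shows "chol (\<lambda>w. FD f w v) z"
proof (cases "v = 0")
  case True
  have *: "FD f w v = 0" if "w \<in> S" for w using chol_FD(2)[OF assms(2)[OF that], of 0 v] True by simp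
  show ?thesis by (rule chol_cong[OF chol_const assms(1,3), of 0]) (simp add: *)
next
  case False
  obtain r0 where r0: "r0 > 0" "cball z r0 \<subseteq> S" using assms open_contains_cball by blast
  have "compact (f ` cball z r0)"
    using assms r0 by (intro compact_continuous_image continuous_at_imp_continuous_on) (auto intro!: chol_imp_continuous)
  then obtain B where B: "\<And>w. w \<in> cball z r0 \<Longrightarrow> cmod (f w) \<le> B"
    using compact_imp_bounded bounded_iff by (metis imageI)
  \<comment> \<open>The base point moves by less than \<open>r\<close> and the line by at most
    \<open>2 * r\<close>, together less than \<open>r0\<close>.\<close>
  define r where "r = r0 / 4"
  define \<rho> where "\<rho> = r / norm v"
  have r: "r > 0" and \<rho>: "\<rho> > 0" using r0 False by (auto simp: r_def \<rho>_def)
  have inb: "w + t *s v \<in> cball z r0" if "w \<in> ball z r" "cmod t \<le> 2 * \<rho>" for w t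
  proof -
    have "norm (t *s v) \<le> (2*\<rho>) * norm v" unfolding norm_vector_smult using that by (simp add: mult_right_mono)
    also have "\<dots> = 2 * r" using False by (simp add: \<rho>_def)
    finally have "norm (t *s v) \<le> 2 * r" .
    then have "dist z (w + t *s v) \<le> r + 2 * r"
      using that(1) by (smt (verit) dist_norm mem_ball norm_triangle_ineq4 diff_diff_eq)
    then show ?thesis using r by (simp add: r_def)
  qed
  have d: "((\<lambda>s. f (w + s *s v)) has_field_derivative FD f (w + t *s v) v) (at t)"
    if "w \<in> ball z r" "cmod t \<le> 2*\<rho>" for w t
    by (rule chol_line) (use inb[OF that] r0 assms in auto)
  define q where "q n w = (f (w + (of_real (\<rho> / Suc n)) *s v) - f w) / of_real (\<rho> / Suc n)" for n w
  have taylor: "cmod (q n w - FD f w v) \<le> 2 * B / \<rho>^2 * (\<rho> / Suc n)" if w: "w \<in> ball z r" for n w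
  proof -
    define h where "h s = f (w + s *s v)" for s
    have hol: "h holomorphic_on ball 0 (2*\<rho>)"
      unfolding holomorphic_on_def field_differentiable_def h_def
      using d[OF w] has_field_derivative_at_within by (metis dist_0_norm less_imp_le mem_ball)
    have b2: "cmod ((deriv ^^ 2) h x) \<le> 2 * B / \<rho>^2" if "x \<in> ball 0 \<rho>" for x
    proof -
      have sub: "cball x \<rho> \<subseteq> ball 0 (2*\<rho>)"
      proof
        fix y assume "y \<in> cball x \<rho>"
        then show "y \<in> ball 0 (2*\<rho>)" using that dist_triangle[of 0 y x] by (simp add: dist_commute)
      qed
      have "cmod ((deriv ^^ 2) h x) \<le> fact 2 * B / \<rho>^2"
      proof (rule Cauchy_inequality)
        show "h holomorphic_on ball x \<rho>" "continuous_on (cball x \<rho>) h"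
          using hol sub holomorphic_on_subset holomorphic_on_imp_continuous_on continuous_on_subset
          by (meson ball_subset_cball order_trans)+
        show "cmod (h y) \<le> B" if "cmod (x - y) = \<rho>" for y
        proof -
          have "y \<in> ball 0 (2*\<rho>)" using sub that by (auto simp: dist_norm)
          then show ?thesis unfolding h_def using B inb[OF w] by auto
        qed
      qed (use \<rho> in auto)
      then show ?thesis by (simp add: fact_numeral)
    qed
    define u where "u = (of_real (\<rho> / Suc n) :: complex)"
    have nu: "cmod u = \<rho> / Suc n" using \<rho> by (simp add: u_def norm_divide del: of_nat_Suc)
    have "cmod ((deriv ^^ 0) h u - (\<Sum>i\<le>1. (deriv ^^ i) h 0 * (u - 0) ^ i / fact i))
       \<le> (2 * B / \<rho>^2) * cmod (u - 0) ^ Suc 1 / fact 1"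
    proof (rule complex_Taylor[where S = "cball 0 (\<rho>)"])
      have sub: "cball 0 \<rho> \<subseteq> ball (0::complex) (2*\<rho>)" using \<rho> by auto
      show "((deriv ^^ i) h has_field_derivative (deriv ^^ Suc i) h x) (at x within cball 0 \<rho>)"
        if "x \<in> cball 0 \<rho>" for i x
      proof -
        have "(deriv ^^ i) h holomorphic_on ball 0 (2*\<rho>)" using hol holomorphic_higher_deriv by blast
        then have "((deriv ^^ i) h has_field_derivative deriv ((deriv ^^ i) h) x) (at x)"
          using holomorphic_derivI sub that by blast
        then show ?thesis by (simp add: has_field_derivative_at_within)
      qed
      have "cmod ((deriv ^^ 2) h x) \<le> 2 * B / \<rho>^2" if "x \<in> cball 0 \<rho>" for x
      proof -
        have "continuous_on (closure (ball 0 \<rho>)) ((deriv ^^ 2) h)"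
          using holomorphic_higher_deriv[OF hol] sub \<rho>
          by (auto intro!: holomorphic_on_imp_continuous_on intro: holomorphic_on_subset)
        then show ?thesis
          using continuous_on_closure_norm_le[of "ball 0 \<rho>" "(deriv ^^ 2) h" "2 * B / \<rho>^2" x] b2 that \<rho>
          by auto
      qed
      then show "cmod ((deriv ^^ Suc 1) h x) \<le> 2 * B / \<rho>^2" if "x \<in> cball 0 \<rho>" for x
        using that by (simp add: numeral_2_eq_2)
      show "u \<in> cball 0 \<rho>" using \<rho> by (simp add: nu divide_simps)
    qed (use \<rho> in auto)
    moreover have "deriv h 0 = FD f w v"
      using DERIV_imp_deriv[OF d[OF w, of 0]] \<rho> by (simp add: h_def[abs_def])
    ultimately have "cmod (h u - h 0 - FD f w v * u) \<le> (2 * B / \<rho>^2) * cmod u ^ 2"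
      by (simp add: algebra_simps power2_eq_square)
    then have T: "cmod (h u - h 0 - FD f w v * u) \<le> (2 * B / \<rho>^2) * (\<rho> / Suc n)^2"
      unfolding nu .
    have tn: "u \<noteq> 0" using \<rho> by (simp add: u_def del: of_nat_Suc)
    have "q n w = (h u - h 0) / u" by (simp add: q_def h_def u_def)
    then have "q n w - FD f w v = (h u - h 0 - FD f w v * u) / u"
      using tn by (simp add: diff_divide_distrib)
    then have "cmod (q n w - FD f w v) = cmod (h u - h 0 - FD f w v * u) / (\<rho> / Suc n)"
      by (simp only: norm_divide nu)
    also have "\<dots> \<le> (2 * B / \<rho>^2) * (\<rho> / Suc n)^2 / (\<rho> / Suc n)"
      using T \<rho> by (intro divide_right_mono) (auto simp del: of_nat_Suc)
    also have "\<dots> = (2 * B / \<rho>^2) * (\<rho> / Suc n)"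
      using \<rho> by (simp add: power2_eq_square del: of_nat_Suc)
    finally show ?thesis .
  qed
  have ul: "uniform_limit (ball z r) q (\<lambda>w. FD f w v) sequentially"
  proof (rule uniform_limitI)
    fix e :: real assume "e > 0"
    have "(\<lambda>n. 2 * B / \<rho>^2 * (\<rho> / Suc n)) \<longlonglongrightarrow> 2 * B / \<rho>^2 * 0"
      by (intro tendsto_intros LIMSEQ_Suc lim_const_over_n)
    then have "\<forall>\<^sub>F n in sequentially. 2 * B / \<rho>^2 * (\<rho> / Suc n) < e"
      using order_tendstoD(2) \<open>e > 0\<close> by fastforce
    then show "\<forall>\<^sub>F n in sequentially. \<forall>x\<in>ball z r. dist (q n x) (FD f x v) < e"
    proof eventually_elim
      case (elim n)
      show ?case unfolding dist_norm using le_less_trans[OF taylor elim] by blast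
    qed
  qed
  have "chol (q n) w" if "w \<in> ball z r" for n w
  proof -
    have t: "cmod (of_real (\<rho> / Suc n)) \<le> 2 * \<rho>"
      unfolding norm_of_real using mult_right_mono[of 1 "2 * real (Suc n)" \<rho>] \<rho>
      by (simp add: divide_simps)
    have "w + (of_real (\<rho> / Suc n)) *s v \<in> S" using inb[OF that t] r0 by auto
    moreover have "w \<in> S" using inb[OF that, of 0] r0 \<rho> by auto
    ultimately show ?thesis unfolding q_def[abs_def] using \<rho> assms(2)
      by (intro chol_divide chol_diff chol_const chol_compose[of f "\<lambda>w. w + _ *s v"])
        (auto intro!: chol_add simp del: of_nat_Suc)
  qed
  then show ?thesis using chol_uniform_limit[OF _ _ ul, of z] r by auto
qed

text \<open>With this the derivation by a holomorphic field can be iterated, as the Lie series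
  requires.\<close>

lemma chol_FD_vfield:
  assumes "open S" "\<And>w. w \<in> S \<Longrightarrow> chol f w" "z \<in> S" "\<And>i. chol (\<lambda>w. X w $ i) z"
  shows "chol (\<lambda>w. FD f w (X w)) z"
proof (rule chol_cong[OF _ assms(1,3)])
  show "chol (\<lambda>w. \<Sum>j\<in>UNIV. X w $ j * FD f w (axis j 1)) z"
    using assms by (intro chol_sum chol_mult chol_FD_const)
qed (metis FD_expand assms(2))

section \<open>Rectification of holomorphic vector fields\<close>

text \<open>The real inverse function theorem gives \<open>g\<close>. Its derivative is the inverse
  of a complex linear map, hence complex linear, so \<open>g\<close> is holomorphic.\<close>

lemma holomorphic_inverse_function:
  fixes h :: "complex^'n \<Rightarrow> complex^'n"
  assumes S: "open S" "z0 \<in> S" and h: "\<And>z i. z \<in> S \<Longrightarrow> chol (\<lambda>w. h w $ i) z"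
    and inj: "\<And>v. (\<And>i. FD (\<lambda>w. h w $ i) z0 v = 0) \<Longrightarrow> v = 0"
  obtains U V g where "open U" "U \<subseteq> S" "z0 \<in> U" "open V" "homeomorphism U V h g"
    "\<And>y i. y \<in> V \<Longrightarrow> chol (\<lambda>w. g w $ i) y"
proof -
  define D where "D z v = (\<chi> i. FD (\<lambda>w. h w $ i) z v)" for z v
  have D: "(h has_derivative D z) (at z)" if "z \<in> S" for z
    unfolding D_def by (rule has_derivative_vec) (rule chol_FD(1)[OF h[OF that]])
  have Dc: "D z (c *s v) = c *s D z v" if "z \<in> S" for z c v
    by (simp add: D_def vec_eq_iff chol_FD(2)[OF h[OF that]])
  have bl: "bounded_linear (D z)" if "z \<in> S" for z
    using has_derivative_bounded_linear[OF D[OF that]] .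
  have ap: "blinfun_apply (Blinfun (D z)) = D z" if "z \<in> S" for z
    using bounded_linear_Blinfun_apply[OF bl[OF that]] .
  have lin: "linear (D z0)" using bl[OF S(2)] by (simp add: bounded_linear.linear)
  have i: "inj (D z0)"
    unfolding linear_injective_0[OF lin] using inj by (simp add: D_def vec_eq_iff)
  have il: "linear (inv (D z0))"
    using inj_linear_imp_inv_linear[OF lin i] .
  have ib: "bounded_linear (inv (D z0))" using il linear_conv_bounded_linear by blast
  obtain U V g g' where *: "open U" "U \<subseteq> S" "z0 \<in> U" "open V" "homeomorphism U V h g"
    "\<And>y. y \<in> V \<Longrightarrow> (g has_derivative (g' y)) (at y)"
    "\<And>y. y \<in> V \<Longrightarrow> g' y = inv (blinfun_apply (Blinfun (D (g y))))"
    "\<And>y. y \<in> V \<Longrightarrow> bij (blinfun_apply (Blinfun (D (g y))))"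
  proof (rule inverse_function_theorem[of S h "\<lambda>z. Blinfun (D z)" z0 "Blinfun (inv (D z0))"])
    \<comment> \<open>Continuity in the operator norm is tested on single vectors \<open>b\<close>,
      where it follows from \<open>chol_FD_const\<close>.\<close>
    show "continuous_on S (\<lambda>z. Blinfun (D z))"
    proof (rule continuous_on_blinfun_componentwise)
      fix b :: "complex^'n"
      have "continuous_on S (\<lambda>z. D z b)"
        unfolding D_def
        by (intro continuous_on_vec_lambda continuous_at_imp_continuous_on ballI chol_imp_continuous
            chol_FD_const[OF S(1) h])
      then show "continuous_on S (\<lambda>z. blinfun_apply (Blinfun (D z)) b)"
        by (rule continuous_on_eq) (simp add: ap)
    qed
    show "Blinfun (inv (D z0)) o\<^sub>L Blinfun (D z0) = id_blinfun"
      by (rule blinfun_eqI) (simp add: ap[OF S(2)] bounded_linear_Blinfun_apply[OF ib] inv_f_f[OF i])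
  qed (auto simp: S ap D)
  have gS: "g y \<in> S" if "y \<in> V" for y
    using *(2,5) that by (auto simp: homeomorphism_def)
  have "chol (\<lambda>w. g w $ i) y" if y: "y \<in> V" for y i
  proof (rule cholI[OF has_derivative_nth[OF *(6)[OF y]]])
    fix c v
    have b: "bij (D (g y))" and g': "g' y = inv (D (g y))" using *(7,8)[OF y] ap[OF gS[OF y]] by auto
    have "D (g y) (g' y (c *s v)) = c *s v" unfolding g' using b by (simp add: bij_is_surj surj_f_inv_f)
    also have "\<dots> = D (g y) (c *s g' y v)"
      unfolding g' using b by (simp add: bij_is_surj surj_f_inv_f Dc[OF gS[OF y]])
    finally have "g' y (c *s v) = c *s g' y v" using b by (simp add: bij_is_inj inj_eq)
    then show "g' y (c *s v) $ i = c * g' y v $ i" by simp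
  qed
  then show thesis using that * by blast
qed

section \<open>Lie series and first integrals\<close>

lemma chol_deriv_along:
  "chol g z \<Longrightarrow> ((\<lambda>s. g (z + s *s v)) has_field_derivative FD g z v) (at 0)"
  using chol_line[of g z 0 v] by simp

lemma FD_along:
  assumes "chol g z" "((\<lambda>s. g (z + s *s v)) has_field_derivative d) (at 0)"
  shows "FD g z v = d"
  using DERIV_unique[OF chol_deriv_along[OF assms(1)] assms(2)] .

lemma one_plus_inverse_power_le_exp: "((real (Suc m)) / real m) ^ m \<le> exp 1"
proof (cases "m = 0")
  case False
  have "((real (Suc m)) / real m) ^ m = (1 + 1 / real m) ^ m" using False by (simp add: field_simps)
  also have "\<dots> \<le> exp (1 / real m) ^ m"
    by (intro power_mono) (auto simp: exp_ge_add_one_self)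
  also have "\<dots> = exp 1" using False by (simp add: exp_of_nat_mult[symmetric])
  finally show ?thesis .
qed simp

text \<open>Cauchy's estimate on the ball of radius \<open>d / (m + 1)\<close> about \<open>z\<close>, where \<open>d\<close> is the distance of \<open>z\<close> to
  the sphere of radius \<open>\<rho>\<close>, costs a factor \<open>(1 + 1 / m) ^ m\<close>, hence at most \<open>e\<close>, in each step.\<close>

lemma lie_derivative_bounds:
  fixes f :: "complex^'n \<Rightarrow> complex^'n" and g0 :: "complex^'n \<Rightarrow> complex"
  assumes f: "\<And>z i. z \<in> ball z0 \<rho> \<Longrightarrow> chol (\<lambda>w. f w $ i) z" "\<And>z. z \<in> ball z0 \<rho> \<Longrightarrow> norm (f z) \<le> B"
    and g0: "\<And>z. z \<in> ball z0 \<rho> \<Longrightarrow> chol g0 z" "\<And>z. z \<in> ball z0 \<rho> \<Longrightarrow> cmod (g0 z) \<le> M"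
  defines "G \<equiv> \<lambda>m. ((\<lambda>g z. FD g z (f z)) ^^ m) g0"
  assumes z: "z \<in> ball z0 \<rho>"
  shows "chol (G m) z" "cmod (G m z) \<le> M * fact m * (2 * B * exp 1 / (\<rho> - dist z0 z)) ^ m"
proof -
  have GS: "G (Suc m) z = FD (G m) z (f z)" for m z by (simp add: G_def)
  have GSf: "G (Suc m) = (\<lambda>z. FD (G m) z (f z))" for m by (simp add: G_def)
  have ch: "\<forall>z\<in>ball z0 \<rho>. chol (G m) z" for m
  proof (induction m)
    case 0 then show ?case using g0 by (simp add: G_def)
  next
    case (Suc m)
    show ?case unfolding GSf using chol_FD_vfield[OF open_ball, of z0 \<rho> "G m"] Suc f by blast
  qed
  then show "chol (G m) z" using z by blast
  have B: "B \<ge> 0" using f(2)[OF z] norm_ge_zero order_trans by blast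
  have M: "M \<ge> 0" using g0(2)[OF z] norm_ge_zero order_trans by blast
  show "cmod (G m z) \<le> M * fact m * (2 * B * exp 1 / (\<rho> - dist z0 z)) ^ m"
    using z
  proof (induction m arbitrary: z)
    case 0 then show ?case using g0 by (simp add: G_def)
  next
    case (Suc m)
    define d where "d = \<rho> - dist z0 z"
    define r where "r = d / Suc m"
    define K where "K = M * fact m * (2 * B * exp 1)^m / d^m * exp 1"
    have d: "d > 0" using Suc.prems by (simp add: d_def)
    then have r: "r > 0" "r \<le> d" by (auto simp: r_def divide_simps)
    have dr: "d - r = d * m / Suc m" by (simp add: r_def field_simps)
    have tri: "dist z0 w < \<rho>" "\<rho> - dist z0 w \<ge> d - r" if "w \<in> ball z r" for w
      using that dist_triangle[of z0 w z] r by (auto simp: d_def)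
    have bd: "cmod (G m w) \<le> K" if w: "w \<in> ball z r" for w
    \<comment> \<open>For \<open>m = 0\<close> the ball has radius \<open>d\<close> and leaves no
      distance to the sphere; the bound \<open>M\<close> on \<open>g0\<close> is used
      directly.\<close>
    proof (cases "m = 0")
      case True
      have "cmod (G m w) \<le> M" using g0(2) tri(1)[OF w] True by (simp add: G_def)
      also have "\<dots> \<le> M * exp 1" using M by (simp add: mult_le_cancel_left1)
      finally show ?thesis by (simp add: K_def True)
    next
      case False
      have dr0: "d - r > 0" using d False unfolding dr by simp
      have "cmod (G m w) \<le> M * fact m * (2 * B * exp 1 / (\<rho> - dist z0 w)) ^ m"
        using Suc.IH tri(1)[OF w] by simp
      also have "\<dots> \<le> M * fact m * (2 * B * exp 1 / (d - r)) ^ m"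
        using tri(2)[OF w] dr0 B M
        by (intro mult_left_mono power_mono divide_left_mono) auto
      also have "(2 * B * exp 1 / (d - r)) ^ m = (2 * B * exp 1)^m / d^m * (real (Suc m) / real m) ^ m"
        unfolding dr using False d by (simp add: power_divide power_mult_distrib)
      also have "M * fact m * \<dots> \<le> M * fact m * ((2 * B * exp 1)^m / d^m * exp 1)"
        using one_plus_inverse_power_le_exp[of m] M B d by (intro mult_left_mono) auto
      finally show ?thesis by (simp add: K_def)
    qed
    have K0: "K \<ge> 0" using M B d by (simp add: K_def)
    have "cmod (G (Suc m) z) \<le> 2 * K / r * norm (f z)" unfolding GS
      by (rule FD_bound) (use ch tri bd r in auto)
    also have "\<dots> \<le> 2 * K / r * B"
      using f(2)[OF Suc.prems] r K0 by (intro mult_left_mono) auto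
    also have "\<dots> = M * fact (Suc m) * (2 * B * exp 1 / d) ^ Suc m"
      using d by (simp add: K_def r_def field_simps)
    finally show ?case by (simp add: d_def)
  qed
qed

text \<open>With \<open>\<tau> = z0 $ k - z $ k\<close> the first integral is the Lie series \<open>\<Sum>m. \<tau> ^ m / m! * f\<^sup>m g\<close>, where \<open>f\<close>
  acts as a derivation; as \<open>f \<tau> = - 1\<close>, the derivatives of the partial sums along \<open>f\<close> telescope.\<close>

lemma first_integral:
  fixes f :: "complex^'n \<Rightarrow> complex^'n" and g :: "complex^'n \<Rightarrow> complex"
  assumes S: "open S" "z0 \<in> S" and f: "\<And>z i. z \<in> S \<Longrightarrow> chol (\<lambda>w. f w $ i) z"
    and fk: "\<And>z. z \<in> S \<Longrightarrow> f z $ k = 1" and g: "\<And>z. z \<in> S \<Longrightarrow> chol g z"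
  obtains \<sigma> H where "\<sigma> > 0" "ball z0 \<sigma> \<subseteq> S" "\<And>z. z \<in> ball z0 \<sigma> \<Longrightarrow> chol H z"
    "\<And>z. z \<in> ball z0 \<sigma> \<Longrightarrow> FD H z (f z) = 0" "\<And>z. z $ k = z0 $ k \<Longrightarrow> H z = g z"
proof -
  obtain \<rho> where \<rho>: "\<rho> > 0" "cball z0 \<rho> \<subseteq> S" using S open_contains_cball by blast
  have cf: "continuous_on (cball z0 \<rho>) f"
  proof -
    have "continuous_on (cball z0 \<rho>) (\<lambda>w. \<chi> i. f w $ i)"
      using \<rho> by (intro continuous_on_vec_lambda continuous_at_imp_continuous_on ballI chol_imp_continuous f) auto
    then show ?thesis by simp
  qed
  obtain B where B: "B > 0" "\<And>w. w \<in> cball z0 \<rho> \<Longrightarrow> norm (f w) \<le> B"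
    using compact_imp_bounded[OF compact_continuous_image[OF cf compact_cball]]
    unfolding bounded_pos by (metis imageI)
  have cg: "continuous_on (cball z0 \<rho>) g"
    using \<rho> by (intro continuous_at_imp_continuous_on ballI chol_imp_continuous g) auto
  obtain M where M: "M > 0" "\<And>w. w \<in> cball z0 \<rho> \<Longrightarrow> cmod (g w) \<le> M"
    using compact_imp_bounded[OF compact_continuous_image[OF cg compact_cball]]
    unfolding bounded_pos by (metis imageI)
  define G where "G = (\<lambda>m. ((\<lambda>g z. FD g z (f z)) ^^ m) g)"
  have GS: "G (Suc m) z = FD (G m) z (f z)" for m z by (simp add: G_def)
  have G0: "G 0 = g" by (simp add: G_def)
  have Gb: "chol (G m) z" "cmod (G m z) \<le> M * fact m * (2 * B * exp 1 / (\<rho> - dist z0 z)) ^ m"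
    if "z \<in> ball z0 \<rho>" for m z
  proof -
    have sb: "w \<in> S" "w \<in> cball z0 \<rho>" if "w \<in> ball z0 \<rho>" for w using that \<rho> by auto
    show "chol (G m) z" "cmod (G m z) \<le> M * fact m * (2 * B * exp 1 / (\<rho> - dist z0 z)) ^ m"
      unfolding G_def
      using lie_derivative_bounds[of z0 \<rho> f B g M, OF f[OF sb(1)] B(2)[OF sb(2)] g[OF sb(1)] M(2)[OF sb(2)] that]
      by auto
  qed
  \<comment> \<open>\<open>c\<close> bounds \<open>2 * B * exp 1 / (\<rho> - dist z0 z)\<close> when
    \<open>z\<close> is within \<open>\<rho> / 2\<close> of \<open>z0\<close>; the second term of
    \<open>\<sigma>\<close> makes \<open>cmod (\<tau> z) * c\<close> at most 1/2, so that the series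
    is dominated by a geometric one.\<close>
  define c where "c = 4 * B * exp 1 / \<rho>"
  have c: "c > 0" using B \<rho> by (simp add: c_def)
  define \<sigma> where "\<sigma> = min (\<rho> / 2) (1 / (2 * c))"
  have \<sigma>: "\<sigma> > 0" using c \<rho> by (simp add: \<sigma>_def)
  have sub: "ball z0 \<sigma> \<subseteq> ball z0 \<rho>" using \<rho> by (intro subset_ball) (auto simp: \<sigma>_def)
  define \<tau> where "\<tau> z = z0 $ k - z $ k" for z :: "complex^'n"
  have \<tau>c: "chol \<tau> z" for z unfolding \<tau>_def[abs_def] by (intro chol_diff chol_const chol_nth)
  have tb: "cmod (\<tau> z) * c \<le> 1/2" if "z \<in> ball z0 \<sigma>" for z
  proof -
    have "cmod (\<tau> z) \<le> norm (z0 - z)" unfolding \<tau>_def using Finite_Cartesian_Product.norm_nth_le[of "z0 - z" k] by simp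
    also have "\<dots> \<le> 1 / (2 * c)" using that by (simp add: \<sigma>_def dist_norm)
    finally show ?thesis using c by (simp add: field_simps)
  qed
  have gb: "cmod (G m z) \<le> M * fact m * c ^ m" if z: "z \<in> ball z0 \<sigma>" for m z
  proof -
    have "cmod (G m z) \<le> M * fact m * (2 * B * exp 1 / (\<rho> - dist z0 z)) ^ m"
      using Gb sub z by blast
    also have "\<dots> \<le> M * fact m * (2 * B * exp 1 / (\<rho> / 2)) ^ m"
      using z M B \<rho> by (intro mult_left_mono power_mono divide_left_mono mult_pos_pos) (auto simp: \<sigma>_def)
    finally show ?thesis by (simp add: c_def mult.assoc)
  qed
  define T where "T m z = \<tau> z ^ m / fact m * G m z" for m z
  have Tb: "norm (T m z) \<le> M * (1/2) ^ m" if z: "z \<in> ball z0 \<sigma>" for m z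
  proof -
    have "norm (T m z) = cmod (\<tau> z) ^ m / fact m * cmod (G m z)"
      by (simp add: T_def norm_mult norm_divide norm_power)
    also have "\<dots> \<le> cmod (\<tau> z) ^ m / fact m * (M * fact m * c ^ m)"
      using gb[OF z] by (intro mult_left_mono) auto
    also have "\<dots> = M * (cmod (\<tau> z) * c) ^ m" by (simp add: power_mult_distrib)
    also have "\<dots> \<le> M * (1/2) ^ m" using tb[OF z] M c by (intro mult_left_mono power_mono) auto
    finally show ?thesis .
  qed
  define H where "H z = (\<Sum>m. T m z)" for z
  have ul: "uniform_limit (ball z0 \<sigma>) (\<lambda>n z. \<Sum>m<n. T m z) H sequentially"
    unfolding H_def by (rule Weierstrass_m_test[OF Tb]) (auto intro!: summable_mult summable_geometric)
  have Tc: "chol (T m) z" if "z \<in> ball z0 \<sigma>" for m z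
    unfolding T_def[abs_def] using Gb(1) sub that by (intro chol_mult chol_divide chol_power \<tau>c chol_const) auto
  have Sc: "chol (\<lambda>z. \<Sum>m<n. T m z) z" if "z \<in> ball z0 \<sigma>" for n z
    using Tc that by (intro chol_sum)
  have lim: "chol H z \<and> (\<forall>v. (\<lambda>n. FD (\<lambda>z. \<Sum>m<n. T m z) z v) \<longlonglongrightarrow> FD H z v)" if "z \<in> ball z0 \<sigma>" for z
    by (rule chol_uniform_limit[OF open_ball _ ul that]) (rule Sc)
  have tel: "((\<lambda>s. \<Sum>m<Suc n. T m (z + s *s f z)) has_field_derivative \<tau> z ^ n / fact n * G (Suc n) z) (at 0)"
    if z: "z \<in> ball z0 \<sigma>" for n z
  proof (induction n)
    case 0
    have "chol g z" using Gb(1)[of z 0] sub z G0 by auto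
    then show ?case using chol_deriv_along[of g z "f z"] GS[of 0 z] by (simp add: T_def G0)
  next
    case (Suc n)
    have zS: "z \<in> S" "z \<in> ball z0 \<rho>" using z sub \<rho> ball_subset_cball by blast+
    have d\<tau>: "((\<lambda>s. \<tau> (z + s *s f z)) has_field_derivative - 1) (at 0)"
      unfolding \<tau>_def using fk[OF zS(1)] by (auto intro!: derivative_eq_intros)
    have dG: "((\<lambda>s. G (Suc n) (z + s *s f z)) has_field_derivative G (Suc (Suc n)) z) (at 0)"
      unfolding GS[of "Suc n"] by (rule chol_deriv_along[OF Gb(1)[OF zS(2)]])
    have dT: "((\<lambda>s. T (Suc n) (z + s *s f z)) has_field_derivative
       \<tau> z ^ Suc n / fact (Suc n) * G (Suc (Suc n)) z - \<tau> z ^ n / fact n * G (Suc n) z) (at 0)"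
      unfolding T_def
      by (rule DERIV_cong[OF DERIV_mult[OF DERIV_cdivide[OF DERIV_power[OF d\<tau>, of "Suc n"], of "fact (Suc n)"] dG]])
        (simp add: fact_Suc del: of_nat_Suc power_Suc)
    show ?case
      unfolding sum.lessThan_Suc[of _ "Suc n"] by (rule DERIV_cong[OF DERIV_add[OF Suc dT]]) simp
  qed
  have FDH: "FD H z (f z) = 0" if z: "z \<in> ball z0 \<sigma>" for z
  proof (rule LIMSEQ_unique)
    show "(\<lambda>n. FD (\<lambda>z. \<Sum>m<Suc n. T m z) z (f z)) \<longlonglongrightarrow> FD H z (f z)"
      using LIMSEQ_Suc[of "\<lambda>n. FD (\<lambda>z. \<Sum>m<n. T m z) z (f z)"] lim[OF z] by blast
    have e: "FD (\<lambda>z. \<Sum>m<Suc n. T m z) z (f z) = \<tau> z ^ n / fact n * G (Suc n) z" for n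
      by (rule FD_along[OF Sc[OF z] tel[OF z]])
    \<comment> \<open>The single term left by the telescoping; \<open>(n + 1) / 2 ^ n\<close> tends
      to 0.\<close>
    have b: "cmod (\<tau> z ^ n / fact n * G (Suc n) z) \<le> M * c * (real (Suc n) * (1/2) ^ n)" for n
    proof -
      have "cmod (\<tau> z ^ n / fact n * G (Suc n) z) = cmod (\<tau> z) ^ n / fact n * cmod (G (Suc n) z)"
        by (simp add: norm_mult norm_divide norm_power)
      also have "\<dots> \<le> cmod (\<tau> z) ^ n / fact n * (M * fact (Suc n) * c ^ Suc n)"
        by (intro mult_left_mono gb[OF z]) auto
      also have "\<dots> = M * c * (real (Suc n) * (cmod (\<tau> z) * c) ^ n)"
        by (simp add: power_mult_distrib fact_Suc field_simps)
      also have "\<dots> \<le> M * c * (real (Suc n) * (1/2) ^ n)"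
        using tb[OF z] M c by (intro mult_left_mono power_mono) auto
      finally show ?thesis .
    qed
    have "(\<lambda>n. real (Suc n) * (1/2) ^ n) \<longlonglongrightarrow> 0"
    proof -
      have "(\<lambda>n. real n * (1/2) ^ n) \<longlonglongrightarrow> (0::real)"
        using powser_times_n_limit_0[of "1/2::real"] by simp
      moreover have "(\<lambda>n. (1/2::real) ^ n) \<longlonglongrightarrow> 0" by (rule LIMSEQ_realpow_zero) auto
      ultimately show ?thesis using tendsto_add[of _ 0 _ _ 0] by (force simp: distrib_right add.commute)
    qed
    then have "(\<lambda>n. M * c * (real (Suc n) * (1/2) ^ n)) \<longlonglongrightarrow> 0"
      using tendsto_mult_right_zero by blast
    then show "(\<lambda>n. FD (\<lambda>z. \<Sum>m<Suc n. T m z) z (f z)) \<longlonglongrightarrow> 0"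
      unfolding e by (rule Lim_null_comparison[rotated]) (use b in auto)
  qed
  have Hg: "H z = g z" if "z $ k = z0 $ k" for z
  proof -
    have "T m z = 0" if "m \<noteq> 0" for m using that \<open>z $ k = z0 $ k\<close> by (simp add: T_def \<tau>_def)
    then have "H z = (\<Sum>m\<in>{0}. T m z)" unfolding H_def by (intro suminf_finite) auto
    then show ?thesis by (simp add: T_def G0)
  qed
  show thesis
  proof (rule that[of \<sigma> H])
    show "ball z0 \<sigma> \<subseteq> S" using sub \<rho> ball_subset_cball by blast
  qed (use \<sigma> lim FDH Hg in auto)
qed

text \<open>The new coordinates are, up to constants, \<open>z $ k\<close> and, for
  \<open>j \<noteq> k\<close>, the first integral that equals \<open>z $ j\<close> on the slice
  through \<open>z0\<close> where the \<open>k\<close>-th coordinate is constant. Tangency to the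
  \<open>k\<close>-th axis is all that a flow box asks, so the length of the field is left
  alone.\<close>

lemma rectification:
  fixes f :: "complex^'n \<Rightarrow> complex^'n"
  assumes S: "open S" "z0 \<in> S" and f: "\<And>z i. z \<in> S \<Longrightarrow> chol (\<lambda>w. f w $ i) z" and nz: "f z0 $ k \<noteq> 0"
  obtains U V h g where "open U" "U \<subseteq> S" "z0 \<in> U" "open V" "homeomorphism U V h g" "h z0 = 0"
    "\<And>z i. z \<in> U \<Longrightarrow> chol (\<lambda>w. h w $ i) z" "\<And>y i. y \<in> V \<Longrightarrow> chol (\<lambda>w. g w $ i) y"
    "\<And>z j. z \<in> U \<Longrightarrow> j \<noteq> k \<Longrightarrow> FD (\<lambda>w. h w $ j) z (f z) = 0"
proof -
  have ck: "continuous_on S (\<lambda>w. f w $ k)"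
    using f by (intro continuous_at_imp_continuous_on ballI chol_imp_continuous)
  have "open (S \<inter> (\<lambda>w. f w $ k) -` (- {0}))" by (rule continuous_open_preimage[OF ck S(1)]) auto
  define S' where "S' = S \<inter> (\<lambda>w. f w $ k) -` (- {0})"
  have S': "open S'" "z0 \<in> S'" "S' \<subseteq> S" using \<open>open (S \<inter> _)\<close> S nz by (auto simp: S'_def)
  \<comment> \<open>Division by the \<open>k\<close>-th component does not change the direction of
    the field and gives the normalization that \<open>first_integral\<close> requires.\<close>
  define f' where "f' z = (\<chi> i. f z $ i / f z $ k)" for z
  have f': "chol (\<lambda>w. f' w $ i) z" if "z \<in> S'" for z i
    unfolding f'_def using that f by (auto simp: S'_def intro!: chol_divide)
  have f'k: "f' z $ k = 1" if "z \<in> S'" for z using that by (simp add: f'_def S'_def)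
  have ff': "f z = f z $ k *s f' z" if "z \<in> S'" for z using that by (simp add: f'_def S'_def vec_eq_iff)
  have "\<exists>\<sigma> H. \<sigma> > 0 \<and> ball z0 \<sigma> \<subseteq> S' \<and> (\<forall>z\<in>ball z0 \<sigma>. chol H z \<and> FD H z (f' z) = 0) \<and> (\<forall>z. z $ k = z0 $ k \<longrightarrow> H z = z $ j)" for j
    by (rule first_integral[OF S'(1,2) f' f'k chol_nth]) blast+
  then obtain \<sigma> H where \<sigma>: "\<And>j. \<sigma> j > 0" "\<And>j. ball z0 (\<sigma> j) \<subseteq> S'"
    and H: "\<And>j z. z \<in> ball z0 (\<sigma> j) \<Longrightarrow> chol (H j) z"
      "\<And>j z. z \<in> ball z0 (\<sigma> j) \<Longrightarrow> FD (H j) z (f' z) = 0" "\<And>j z. z $ k = z0 $ k \<Longrightarrow> H j z = z $ j"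
    by metis
  define s where "s = Min (range \<sigma>)"
  have s: "s > 0" "s \<le> \<sigma> j" for j using \<sigma> by (auto simp: s_def)
  have sb: "z \<in> ball z0 (\<sigma> j)" if "z \<in> ball z0 s" for z j using that s(2)[of j] by simp
  define h where "h z = (\<chi> j. if j = k then z $ k - z0 $ k else H j z - z0 $ j)" for z
  have hj: "(\<lambda>w. h w $ j) = (if j = k then (\<lambda>z. z $ k - z0 $ k) else (\<lambda>z. H j z - z0 $ j))" for j
    by (auto simp: h_def)
  have hc: "chol (\<lambda>w. h w $ j) z" if "z \<in> ball z0 s" for z j
    unfolding hj using H(1)[OF sb[OF that]] by (auto intro!: chol_diff)
  have z0s: "z0 \<in> ball z0 s" using s by simp
  \<comment> \<open>The \<open>k\<close>-th component gives \<open>v $ k = 0\<close>; then the line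
    through \<open>z0\<close> in direction \<open>v\<close> stays in the slice, where
    \<open>H j\<close> is the \<open>j\<close>-th coordinate.\<close>
  have inj: "v = 0" if 0: "\<And>i. FD (\<lambda>w. h w $ i) z0 v = 0" for v
  proof -
    have "FD (\<lambda>w. h w $ k) z0 v = v $ k"
      by (rule FD_along[OF hc[OF z0s]]) (auto simp: h_def intro!: derivative_eq_intros)
    then have vk: "v $ k = 0" using 0 by simp
    have "v $ j = 0" for j
    proof (cases "j = k")
      case False
      have "FD (\<lambda>w. h w $ j) z0 v = v $ j"
      proof (rule FD_along[OF hc[OF z0s]])
        have "(\<lambda>s. h (z0 + s *s v) $ j) = (\<lambda>s. s * v $ j)" using False H(3) vk by (simp add: h_def)
        then show "((\<lambda>s. h (z0 + s *s v) $ j) has_field_derivative v $ j) (at 0)"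
          by (auto intro!: derivative_eq_intros)
      qed
      then show ?thesis using 0 by simp
    qed (use vk in simp)
    then show "v = 0" by (simp add: vec_eq_iff)
  qed
  obtain U V g where U: "open U" "U \<subseteq> ball z0 s" "z0 \<in> U" "open V" "homeomorphism U V h g"
    "\<And>y i. y \<in> V \<Longrightarrow> chol (\<lambda>w. g w $ i) y"
    by (rule holomorphic_inverse_function[of "ball z0 s" z0 h],
        rule open_ball, rule z0s, erule hc, rule inj, simp, rule that)
  show thesis
  proof (rule that[OF U(1) _ U(3-5) _ _ U(6)])
    show "U \<subseteq> S" using U(2) sb \<sigma>(2) S'(3) by blast
    show "h z0 = 0" using H(3) by (simp add: h_def vec_eq_iff)
    show "chol (\<lambda>w. h w $ i) z" if "z \<in> U" for z i using hc U that by blast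
    fix z j assume z: "z \<in> U" and j: "j \<noteq> k"
    then have zb: "z \<in> ball z0 s" using U by blast
    then have zS: "z \<in> S'" using sb \<sigma>(2) by blast
    have "FD (\<lambda>w. h w $ j) z (f' z) = FD (H j) z (f' z)"
    proof (rule FD_along[OF hc[OF zb]])
      show "((\<lambda>s. h (z + s *s f' z) $ j) has_field_derivative FD (H j) z (f' z)) (at 0)"
        using j by (auto simp: h_def intro!: derivative_eq_intros chol_deriv_along H(1)[OF sb[OF zb]])
    qed
    also have "\<dots> = 0" using H(2)[OF sb[OF zb]] .
    finally show "FD (\<lambda>w. h w $ j) z (f z) = 0"
      using chol_FD(2)[OF hc[OF zb]] ff'[OF zS] by (metis mult_zero_right)
  qed
qed

section \<open>Charts, flow boxes and leafwise curves\<close>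

lemma open_polydisc: "open {z :: complex^'n. \<forall>j. cmod (z $ j) < r}"
proof -
  have "{z :: complex^'n. \<forall>j. cmod (z $ j) < r} = (\<Inter>j. {z. cmod (z $ j) < r})" by auto
  moreover have "open {z :: complex^'n. cmod (z $ j) < r}" for j
    by (intro open_Collect_less continuous_intros)
  ultimately show ?thesis by auto
qed

lemma norm_le_sum_components: "norm (z :: complex^'n) \<le> (\<Sum>j\<in>UNIV. cmod (z $ j))"
  unfolding norm_vec_def by (rule L2_set_le_sum) auto

lemma polydisc_in_ball:
  assumes "r > 0"
  obtains s where "s > 0" "\<And>z :: complex^'n. (\<And>j. cmod (z $ j) < s) \<Longrightarrow> norm z < r"
proof (rule that[of "r / CARD('n)"])
  show "r / CARD('n) > 0" using assms by simp
  fix z :: "complex^'n" assume *: "\<And>j. cmod (z $ j) < r / CARD('n)"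
  have "norm z \<le> (\<Sum>j\<in>UNIV. cmod (z $ j))" by (rule norm_le_sum_components)
  also have "\<dots> < (\<Sum>j\<in>(UNIV::'n set). r / CARD('n))" by (rule sum_strict_mono) (use * in auto)
  finally show "norm z < r" by simp
qed

locale foliated =
  fixes A :: "('a::{t2_space, second_countable_topology}, 'n::finite) chart set"
    and E :: "'a set" and F :: "('a, 'n) foliation"
  assumes cm: "complex_manifold A" and sh: "shfc A E F"
begin

lemma chart_cover: obtains c where "c \<in> A" "p \<in> fst c"
  using cm unfolding complex_manifold_def by blast

lemma is_chart: "c \<in> A \<Longrightarrow> is_chart c"
  using cm unfolding complex_manifold_def by blast

lemma chart_open: "c \<in> A \<Longrightarrow> open (fst c)" "c \<in> A \<Longrightarrow> open (snd c ` fst c)"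
  using is_chart unfolding is_chart_def by blast+

lemma chart_homeo:
  assumes "c \<in> A" shows "homeomorphism (fst c) (snd c ` fst c) (snd c) (chart_inv c)"
proof -
  obtain h where h: "homeomorphism (fst c) (snd c ` fst c) (snd c) h"
    using is_chart[OF assms] unfolding is_chart_def by blast
  have inj: "inj_on (snd c) (fst c)" using h by (metis homeomorphism_apply1 inj_on_inverseI)
  have "chart_inv c y = h y" if "y \<in> snd c ` fst c" for y
    using that h inj unfolding chart_inv_def by (auto simp: homeomorphism_apply1)
  then show ?thesis using homeomorphism_cong[OF h] by auto
qed

lemma chart_inv_snd [simp]: "c \<in> A \<Longrightarrow> x \<in> fst c \<Longrightarrow> chart_inv c (snd c x) = x"
  using homeomorphism_apply1[OF chart_homeo] .

lemma snd_chart_inv: "c \<in> A \<Longrightarrow> z \<in> snd c ` fst c \<Longrightarrow> snd c (chart_inv c z) = z"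
  using homeomorphism_apply2[OF chart_homeo] .

lemma chart_inv_in: "c \<in> A \<Longrightarrow> z \<in> snd c ` fst c \<Longrightarrow> chart_inv c z \<in> fst c"
  using homeomorphism_image2[OF chart_homeo] by blast

lemma chart_cont: "c \<in> A \<Longrightarrow> continuous_on (fst c) (snd c)"
  using homeomorphism_cont1[OF chart_homeo] .

lemma chart_inv_cont: "c \<in> A \<Longrightarrow> continuous_on (snd c ` fst c) (chart_inv c)"
  using homeomorphism_cont2[OF chart_homeo] .

lemma chart_inj: "c \<in> A \<Longrightarrow> x \<in> fst c \<Longrightarrow> y \<in> fst c \<Longrightarrow> snd c x = snd c y \<Longrightarrow> x = y"
  by (metis chart_inv_snd)

lemma chart_preimage_open:
  assumes "c \<in> A" "open O'" shows "open {x \<in> fst c. snd c x \<in> O'}"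
proof -
  have "open (fst c \<inter> snd c -` O')"
    by (rule continuous_open_preimage[OF chart_cont[OF assms(1)] chart_open(1)[OF assms(1)] assms(2)])
  moreover have "fst c \<inter> snd c -` O' = {x \<in> fst c. snd c x \<in> O'}" by auto
  ultimately show ?thesis by simp
qed

lemma chart_image_open:
  assumes "c \<in> A" "open S" shows "open (snd c ` (fst c \<inter> S))"
proof -
  have "openin (top_of_set (snd c ` fst c)) (snd c ` (fst c \<inter> S))"
    using homeomorphism_imp_open_map[OF chart_homeo[OF assms(1)]] assms(2)
    by (simp add: openin_open_Int)
  then show ?thesis using chart_open(2)[OF assms(1)] openin_open_trans by blast
qed

lemma transition_chol:
  assumes "c \<in> A" "d \<in> A" "p \<in> fst c" "p \<in> fst d"
  shows "chol (\<lambda>w. transition c d w $ i) (snd c p)"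
proof -
  have "compatible_charts c d" using cm assms unfolding complex_manifold_def by blast
  then show ?thesis using assms unfolding compatible_charts_def sc_holomorphic_map_on_chol by blast
qed

lemma jacobian_nth:
  assumes "c \<in> A" "d \<in> A" "p \<in> fst c" "p \<in> fst d"
  shows "jacobian c d p v $ i = FD (\<lambda>w. transition c d w $ i) (snd c p) v"
proof -
  note tc = transition_chol[OF assms]
  have "(transition c d has_derivative (\<lambda>v. \<chi> i. FD (\<lambda>w. transition c d w $ i) (snd c p) v)) (at (snd c p))"
    by (rule has_derivative_vec) (rule chol_FD(1)[OF tc])
  from frechet_derivative_at[OF this] have "jacobian c d p = (\<lambda>v. \<chi> i. FD (\<lambda>w. transition c d w $ i) (snd c p) v)"
    by (simp add: jacobian_def)
  then show ?thesis by simp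
qed

lemma jacobian_scale:
  assumes "c \<in> A" "d \<in> A" "p \<in> fst c" "p \<in> fst d"
  shows "jacobian c d p (k *s v) = k *s jacobian c d p v"
  by (simp add: vec_eq_iff jacobian_nth[OF assms] chol_FD(2)[OF transition_chol[OF assms]])

text \<open>The atlas being maximal, charts may be restricted and composed with biholomorphic maps.\<close>

lemma chart_compose:
  assumes c: "c \<in> A" and U: "open U" "U \<subseteq> snd c ` fst c" and V: "open V"
    and hg: "homeomorphism U V h g"
    and h: "\<And>z i. z \<in> U \<Longrightarrow> chol (\<lambda>w. h w $ i) z" and g: "\<And>y i. y \<in> V \<Longrightarrow> chol (\<lambda>w. g w $ i) y"
  defines "c' \<equiv> ({x \<in> fst c. snd c x \<in> U}, \<lambda>x. h (snd c x))"
  shows "c' \<in> A" "snd c' ` fst c' = V" "\<And>y. y \<in> V \<Longrightarrow> chart_inv c' y = chart_inv c (g y)"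
proof -
  have gV: "g y \<in> U" if "y \<in> V" for y using hg that homeomorphism_image2 by blast
  have hU: "h z \<in> V" if "z \<in> U" for z using hg that homeomorphism_image1 by blast
  have gh: "g (h z) = z" if "z \<in> U" for z using homeomorphism_apply1[OF hg that] .
  have hg': "h (g y) = y" if "y \<in> V" for y using homeomorphism_apply2[OF hg that] .
  have fst': "fst c' = {x \<in> fst c. snd c x \<in> U}" and snd': "snd c' = (\<lambda>x. h (snd c x))"
    by (simp_all add: c'_def)
  show im: "snd c' ` fst c' = V"
  proof
    show "snd c' ` fst c' \<subseteq> V" using hU by (auto simp: fst' snd')
    show "V \<subseteq> snd c' ` fst c'"
    proof
      fix y assume y: "y \<in> V"
      have "g y \<in> snd c ` fst c" using gV[OF y] U by blast
      then have "chart_inv c (g y) \<in> fst c'" "snd c' (chart_inv c (g y)) = y"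
        using gV[OF y] hg'[OF y] by (auto simp: fst' snd' chart_inv_in[OF c] snd_chart_inv[OF c])
      then show "y \<in> snd c' ` fst c'" by (metis image_eqI)
    qed
  qed
  have homeo: "homeomorphism (fst c') V (snd c') (\<lambda>y. chart_inv c (g y))"
  proof (rule homeomorphismI)
    show "continuous_on (fst c') (snd c')"
      unfolding fst' snd' using chart_cont[OF c]  homeomorphism_cont1[OF hg]
      by (auto intro!: continuous_on_compose2[of U h] intro: continuous_on_subset)
    show "continuous_on V (\<lambda>y. chart_inv c (g y))"
      using chart_inv_cont[OF c] homeomorphism_cont2[OF hg] U gV
      by (auto intro!: continuous_on_compose2[of "snd c ` fst c" "chart_inv c"])
    show "(\<lambda>y. chart_inv c (g y)) ` V \<subseteq> fst c'"
      using U gV chart_inv_in[OF c] snd_chart_inv[OF c] by (force simp: fst')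
    show "snd c' ` fst c' \<subseteq> V" by (simp add: im)
    show "chart_inv c (g (snd c' x)) = x" if "x \<in> fst c'" for x
      using that c gh by (simp add: fst' snd')
    show "snd c' (chart_inv c (g y)) = y" if "y \<in> V" for y
      using gV[OF that] U hg'[OF that] snd_chart_inv[OF c, of "g y"] by (simp add: snd' subset_iff)
  qed
  have inj: "inj_on (snd c') (fst c')" using homeo by (metis homeomorphism_apply1 inj_on_inverseI)
  show inv: "chart_inv c' y = chart_inv c (g y)" if "y \<in> V" for y
  proof -
    have "chart_inv c (g y) \<in> fst c'" "snd c' (chart_inv c (g y)) = y"
      using homeo that homeomorphism_image2 homeomorphism_apply2 by blast+
    then show ?thesis unfolding chart_inv_def using inv_into_f_f[OF inj] by (metis chart_inv_def)
  qed
  have opn: "open (fst c')" unfolding fst' using chart_preimage_open[OF c U(1)] .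
  have "is_chart c'" unfolding is_chart_def im using opn V homeo by blast
  moreover have "compatible_charts c' d" if d: "d \<in> A" for d
    unfolding compatible_charts_def sc_holomorphic_map_on_chol
  proof (intro conjI ballI allI)
    fix z i assume "z \<in> snd c' ` (fst c' \<inter> fst d)"
    then obtain x where x: "x \<in> fst c'" "x \<in> fst d" "z = snd c' x" by blast
    have zV: "z \<in> V" using x im by blast
    have gz: "g z = snd c x" using x gh by (simp add: fst' snd')
    have "chol (\<lambda>w. transition c d (g w) $ i) z"
      by (rule chol_compose[where f=g and g="\<lambda>w. transition c d w $ i"])
        (use transition_chol[OF c d] x g[OF zV] gz in \<open>auto simp: fst'\<close>)
    then show "chol (\<lambda>w. transition c' d w $ i) z"
      by (rule chol_cong[OF _ V zV]) (simp add: transition_def inv)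
  next
    fix z i assume "z \<in> snd d ` (fst c' \<inter> fst d)"
    then obtain x where x: "x \<in> fst c'" "x \<in> fst d" "z = snd d x" by blast
    have e: "transition d c z = snd c x" using x d by (simp add: transition_def)
    have "chol (\<lambda>w. h (transition d c w) $ i) z"
      by (rule chol_compose[where f="transition d c" and g="\<lambda>w. h w $ i"])
        (use transition_chol[OF d c, of x] x h e in \<open>auto simp: fst'\<close>)
    then show "chol (\<lambda>w. transition d c' w $ i) z"
      by (simp add: transition_def snd')
  qed
  ultimately show "c' \<in> A" using cm unfolding complex_manifold_def by blast
qed

text \<open>\<open>holomorphic_disc\<close> on other parameter sets: small balls, punctured discs
  and complements of discrete sets occur below.\<close>

definition hol_curve :: "complex set \<Rightarrow> (complex \<Rightarrow> 'a) \<Rightarrow> bool" where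
  "hol_curve S \<gamma> \<longleftrightarrow> continuous_on S \<gamma> \<and>
     (\<forall>c\<in>A. \<forall>i. (\<lambda>t. snd c (\<gamma> t) $ i) holomorphic_on {t \<in> S. \<gamma> t \<in> fst c})"

lemma holomorphic_disc_hol_curve: "holomorphic_disc A f \<longleftrightarrow> hol_curve unit_disc f"
  by (simp add: holomorphic_disc_def hol_curve_def)

lemma hol_curve_subset: "hol_curve S \<gamma> \<Longrightarrow> T \<subseteq> S \<Longrightarrow> hol_curve T \<gamma>"
  unfolding hol_curve_def
proof (intro conjI ballI allI)
  fix c i
  assume a: "continuous_on S \<gamma> \<and> (\<forall>c\<in>A. \<forall>i. (\<lambda>t. snd c (\<gamma> t) $ i) holomorphic_on {t \<in> S. \<gamma> t \<in> fst c})"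
     "T \<subseteq> S" "c \<in> A"
  then have "(\<lambda>t. snd c (\<gamma> t) $ i) holomorphic_on {t \<in> S. \<gamma> t \<in> fst c}" by blast
  then show "(\<lambda>t. snd c (\<gamma> t) $ i) holomorphic_on {t \<in> T. \<gamma> t \<in> fst c}"
    by (rule holomorphic_on_subset) (use a(2) in auto)
qed (auto intro: continuous_on_subset)

lemma hol_curve_preimage_open:
  assumes "hol_curve S \<gamma>" "open S" "open O'" shows "open {t \<in> S. \<gamma> t \<in> O'}"
proof -
  have "open (S \<inter> \<gamma> -` O')"
    using assms unfolding hol_curve_def by (intro continuous_open_preimage) auto
  moreover have "S \<inter> \<gamma> -` O' = {t \<in> S. \<gamma> t \<in> O'}" by auto
  ultimately show ?thesis by simp
qed

lemma hol_curve_velocity: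
  assumes "hol_curve S \<gamma>" "open S" "c \<in> A" "t \<in> S" "\<gamma> t \<in> fst c"
  shows "((\<lambda>s. snd c (\<gamma> s) $ i) has_field_derivative velocity c \<gamma> t $ i) (at t)"
proof -
  have "open {t \<in> S. \<gamma> t \<in> fst c}" using hol_curve_preimage_open assms chart_open by blast
  moreover have "(\<lambda>t. snd c (\<gamma> t) $ i) holomorphic_on {t \<in> S. \<gamma> t \<in> fst c}"
    using assms unfolding hol_curve_def by blast
  ultimately show ?thesis
    using holomorphic_derivI[of "\<lambda>t. snd c (\<gamma> t) $ i" "{t \<in> S. \<gamma> t \<in> fst c}" t] assms
    by (simp add: velocity_def)
qed

lemma velocity_transform:
  assumes "hol_curve S \<gamma>" "open S" "c \<in> A" "d \<in> A" "t \<in> S" "\<gamma> t \<in> fst c" "\<gamma> t \<in> fst d"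
  shows "velocity d \<gamma> t = jacobian c d (\<gamma> t) (velocity c \<gamma> t)"
proof -
  have "velocity d \<gamma> t $ i = jacobian c d (\<gamma> t) (velocity c \<gamma> t) $ i" for i
  proof -
    have "((\<lambda>s. transition c d (snd c (\<gamma> s)) $ i) has_field_derivative
       FD (\<lambda>w. transition c d w $ i) (snd c (\<gamma> t)) (velocity c \<gamma> t)) (at t)"
      by (rule chol_curve[where \<gamma> = "\<lambda>s. snd c (\<gamma> s)" and g = "\<lambda>w. transition c d w $ i"])
        (use transition_chol hol_curve_velocity assms in blast)+
    then have "((\<lambda>s. snd d (\<gamma> s) $ i) has_field_derivative
       FD (\<lambda>w. transition c d w $ i) (snd c (\<gamma> t)) (velocity c \<gamma> t)) (at t)"
    proof (rule has_field_derivative_transform_within_open)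
      show "open {t \<in> S. \<gamma> t \<in> fst c}" using hol_curve_preimage_open assms chart_open by blast
    qed (use assms in \<open>auto simp: transition_def\<close>)
    from DERIV_unique[OF this hol_curve_velocity[OF assms(1,2,4,5,7)]]
    show ?thesis using jacobian_nth assms by simp
  qed
  then show ?thesis by (simp add: vec_eq_iff)
qed

text \<open>One chart near each parameter is enough, the transition maps being holomorphic;
  \<open>hol_curve\<close> itself speaks of all charts.\<close>

lemma hol_curveI:
  assumes "open S" "\<And>t. t \<in> S \<Longrightarrow> \<exists>c N. c \<in> A \<and> open N \<and> t \<in> N \<and> N \<subseteq> S \<and> \<gamma> ` N \<subseteq> fst c \<and>
     (\<forall>i. (\<lambda>s. snd c (\<gamma> s) $ i) holomorphic_on N)"
  shows "hol_curve S \<gamma>"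
proof -
  have cont: "isCont \<gamma> t" if tS: "t \<in> S" for t
  proof -
    obtain c N where N: "c \<in> A" "open N" "t \<in> N" "\<gamma> ` N \<subseteq> fst c"
      "\<And>i. (\<lambda>s. snd c (\<gamma> s) $ i) holomorphic_on N" using assms(2)[OF tS] by blast
    have "continuous_on N (\<lambda>s. \<chi> i. snd c (\<gamma> s) $ i)"
      by (intro continuous_on_vec_lambda holomorphic_on_imp_continuous_on N)
    then have "continuous_on N (\<lambda>s. chart_inv c (snd c (\<gamma> s)))"
      using N by (auto intro!: continuous_on_compose2[OF chart_inv_cont])
    then have "continuous_on N \<gamma>"
      by (rule continuous_on_eq) (use N in auto)
    then show ?thesis using N continuous_on_eq_continuous_at by blast
  qed
  then have cS: "continuous_on S \<gamma>" using continuous_at_imp_continuous_on by blast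
  have "(\<lambda>t. snd d (\<gamma> t) $ i) holomorphic_on {t \<in> S. \<gamma> t \<in> fst d}" if d: "d \<in> A" for d i
    unfolding holomorphic_on_def
  proof
    fix t assume t: "t \<in> {t \<in> S. \<gamma> t \<in> fst d}"
    obtain c N where N: "c \<in> A" "open N" "t \<in> N" "\<gamma> ` N \<subseteq> fst c"
      "\<And>i. (\<lambda>s. snd c (\<gamma> s) $ i) holomorphic_on N" using assms(2) t by blast
    have "((\<lambda>s. transition c d (snd c (\<gamma> s)) $ i) has_field_derivative
       FD (\<lambda>w. transition c d w $ i) (snd c (\<gamma> t)) (velocity c \<gamma> t)) (at t)"
      by (rule chol_curve[where \<gamma> = "\<lambda>s. snd c (\<gamma> s)" and g = "\<lambda>w. transition c d w $ i"])
       (use transition_chol[of c d "\<gamma> t" i] d t N holomorphic_derivI[OF N(5,2,3)] in \<open>auto simp: velocity_def\<close>)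
    then have "((\<lambda>s. snd d (\<gamma> s) $ i) has_field_derivative
       FD (\<lambda>w. transition c d w $ i) (snd c (\<gamma> t)) (velocity c \<gamma> t)) (at t)"
      by (rule has_field_derivative_transform_within_open[OF _ N(2,3)])
        (use N in \<open>auto simp: transition_def\<close>)
    then show "(\<lambda>t. snd d (\<gamma> t) $ i) field_differentiable at t within {t \<in> S. \<gamma> t \<in> fst d}"
      using field_differentiable_at_within field_differentiable_def by blast
  qed
  then show ?thesis using cS by (simp add: hol_curve_def)
qed

section \<open>Generators and flow boxes\<close>

abbreviation fbox where "fbox \<equiv> flow_box A E F"

lemma gen_cover: obtains U X where "(U, X) \<in> F" "p \<in> U"
proof -
  have "(\<Union>(U, X)\<in>F. U) = UNIV" using sh unfolding shfc_def by simp
  then have "p \<in> (\<Union>(U, X)\<in>F. U)" by simp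
  then show thesis using that by auto
qed

lemma gen:
  assumes "(U, X) \<in> F"
  shows "open U" "holomorphic_vfield_on A U X" "vfield_zeros A U X = E \<inter> U"
  using sh assms unfolding shfc_def by blast+

lemma gen_transform:
  assumes "(U, X) \<in> F" "c \<in> A" "d \<in> A" "p \<in> U" "p \<in> fst c" "p \<in> fst d"
  shows "X d p = jacobian c d p (X c p)"
  using gen(2)[OF assms(1)] assms unfolding holomorphic_vfield_on_def by blast

text \<open>\<open>vfield_zeros\<close> tests all charts, but a field that vanishes in one chart
  vanishes in every other because the Jacobian is linear.\<close>

lemma gen_nonzero:
  assumes "(U, X) \<in> F" "c \<in> A" "p \<in> U" "p \<in> fst c"
  shows "X c p \<noteq> 0 \<longleftrightarrow> p \<notin> E"
proof
  assume nz: "X c p \<noteq> 0"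
  then have "p \<notin> vfield_zeros A U X" unfolding vfield_zeros_def using assms by blast
  then show "p \<notin> E" using gen(3)[OF assms(1)] assms by blast
next
  assume "p \<notin> E"
  then have "p \<notin> vfield_zeros A U X" using gen(3)[OF assms(1)] by blast
  then obtain d where d: "d \<in> A" "p \<in> fst d" "X d p \<noteq> 0" unfolding vfield_zeros_def using assms by blast
  show "X c p \<noteq> 0"
  proof
    assume "X c p = 0"
    then have "X d p = jacobian c d p (0 *s X c p)" using gen_transform[OF assms(1,2) d(1) assms(3,4) d(2)] by simp
    then show False using d jacobian_scale[OF assms(2) d(1) assms(4) d(2), of 0] by simp
  qed
qed

lemma gen_proportional:
  assumes "(U, X) \<in> F" "(V, Y) \<in> F" "c \<in> A" "p \<in> fst c" "p \<in> U" "p \<in> V" "p \<notin> E"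
  obtains h where "X c p = h *s Y c p"
proof -
  have "\<forall>(U, X)\<in>F. \<forall>(V, Y)\<in>F. \<forall>c\<in>A. \<forall>p \<in> fst c \<inter> U \<inter> V - E. \<exists>h. X c p = h *s Y c p"
    using sh unfolding shfc_def by simp
  then show thesis using assms that by fast
qed

lemma gen_chol:
  assumes "(U, X) \<in> F" "c \<in> A" "z \<in> snd c ` (fst c \<inter> U)"
  shows "chol (\<lambda>w. X c (chart_inv c w) $ i) z"
  using gen(2)[OF assms(1)] assms unfolding holomorphic_vfield_on_def sc_holomorphic_map_on_chol by blast

lemma fboxD:
  assumes "fbox c i"
  shows "c \<in> A" "fst c \<inter> E = {}" "snd c ` fst c = {z. \<forall>j. cmod (z $ j) < 1}"
    "\<And>U X p j. (U, X) \<in> F \<Longrightarrow> p \<in> U \<Longrightarrow> p \<in> fst c \<Longrightarrow> j \<noteq> i \<Longrightarrow> X c p $ j = 0"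
  using assms unfolding flow_box_def by fast+

text \<open>A generator does not vanish at \<open>p\<close>; rectifying it in a chart and rescaling
  gives the box, and the other generators are tangent to the same axis because they are proportional
  to this one off \<open>E\<close>.\<close>

theorem flow_box_exists:
  assumes p: "p \<notin> E"
  obtains c i where "fbox c i" "p \<in> fst c" "snd c p = 0"
proof -
  obtain U X where X: "(U, X) \<in> F" "p \<in> U" by (rule gen_cover)
  obtain c where c: "c \<in> A" "p \<in> fst c" by (rule chart_cover)
  have nz: "X c p \<noteq> 0" using gen_nonzero[OF X(1) c(1) X(2) c(2)] p by simp
  then obtain k where k: "X c p $ k \<noteq> 0" by (auto simp: vec_eq_iff)
  define f where "f z = X c (chart_inv c z)" for z
  define S0 where "S0 = snd c ` (fst c \<inter> U)"
  have S0: "open S0" unfolding S0_def using chart_image_open[OF c(1) gen(1)[OF X(1)]] .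
  have fc: "chol (\<lambda>w. f w $ i) z" if "z \<in> S0" for z i
    unfolding f_def using gen_chol[OF X(1) c(1)] that by (simp add: S0_def)
  \<comment> \<open>Where the \<open>k\<close>-th component is nonzero the generator does not
    vanish, so the box will be disjoint from \<open>E\<close>.\<close>
  define S where "S = S0 \<inter> (\<lambda>z. f z $ k) -` (- {0})"
  have S: "open S" unfolding S_def
    by (rule continuous_open_preimage[OF _ S0])
      (auto intro!: continuous_at_imp_continuous_on chol_imp_continuous fc)
  have pS: "snd c p \<in> S" using c X k by (auto simp: S_def S0_def f_def)
  obtain U1 V1 h1 g1 where R: "open U1" "U1 \<subseteq> S" "snd c p \<in> U1" "open V1" "homeomorphism U1 V1 h1 g1"
    "h1 (snd c p) = 0" "\<And>z i. z \<in> U1 \<Longrightarrow> chol (\<lambda>w. h1 w $ i) z"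
    "\<And>y i. y \<in> V1 \<Longrightarrow> chol (\<lambda>w. g1 w $ i) y"
    "\<And>z j. z \<in> U1 \<Longrightarrow> j \<noteq> k \<Longrightarrow> FD (\<lambda>w. h1 w $ j) z (f z) = 0"
  proof (rule rectification[of S "snd c p" f k])
    show "f (snd c p) $ k \<noteq> 0" using k c by (simp add: f_def)
    show "chol (\<lambda>w. f w $ i) z" if "z \<in> S" for z i using fc that by (simp add: S_def)
  qed (use S pS in blast)+
  have "0 \<in> V1" using R(3,5,6) by (metis homeomorphism_image1 image_eqI)
  then obtain r where r: "r > 0" "ball 0 r \<subseteq> V1" using R(4) openE by blast
  obtain s where s: "s > 0" "\<And>z :: complex^'n. (\<And>j. cmod (z $ j) < s) \<Longrightarrow> norm z < r"
    using polydisc_in_ball[OF r(1)] by blast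
  define V where "V = {z :: complex^'n. \<forall>j. cmod (z $ j) < 1}"
  \<comment> \<open>Rescaling turns the polydisc of radius \<open>s\<close> in the image into the
    unit polydisc of \<open>flow_box\<close>.\<close>
  define h where "h z = of_real (1 / s) *s h1 z" for z
  define g where "g y = g1 (of_real s *s y)" for y
  have sV: "of_real s *s y \<in> V1" if "y \<in> V" for y
  proof -
    have "norm (of_real s *s y) < r"
      by (rule s(2)) (use that s(1) in \<open>auto simp: V_def norm_mult\<close>)
    then show ?thesis using r(2) by auto
  qed
  define U2 where "U2 = U1 \<inter> h -` V"
  have hc: "chol (\<lambda>w. h w $ i) z" if "z \<in> U1" for z i
    unfolding h_def vector_smult_component using R(7)[OF that] by (intro chol_mult chol_const)
  have gc: "chol (\<lambda>w. g w $ i) y" if "y \<in> V" for y i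
    unfolding g_def
    by (rule chol_compose[where f = "\<lambda>y. of_real s *s y" and g = "\<lambda>w. g1 w $ i"])
       (use R(8)[OF sV[OF that]] in \<open>auto intro!: chol_mult\<close>)
  have cont_h: "continuous_on U1 h"
  proof -
    have "continuous_on U1 (\<lambda>w. \<chi> i. h w $ i)"
      by (intro continuous_on_vec_lambda continuous_at_imp_continuous_on ballI chol_imp_continuous hc)
    then show ?thesis by simp
  qed
  have U2: "open U2" unfolding U2_def
    by (rule continuous_open_preimage[OF cont_h R(1)]) (simp add: V_def open_polydisc)
  have hom: "homeomorphism U2 V h g"
  proof (rule homeomorphismI)
    show "continuous_on U2 h" using cont_h by (rule continuous_on_subset) (simp add: U2_def)
    have "continuous_on V (\<lambda>w. \<chi> i. g w $ i)"
      by (intro continuous_on_vec_lambda continuous_at_imp_continuous_on ballI chol_imp_continuous gc)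
    then show "continuous_on V g" by simp
    show "h ` U2 \<subseteq> V" by (auto simp: U2_def)
    have hg: "h (g y) = y" if "y \<in> V" for y
      using homeomorphism_apply2[OF R(5) sV[OF that]] s(1) by (simp add: h_def g_def vec_eq_iff)
    then show "h (g y) = y" if "y \<in> V" for y using that .
    show "g ` V \<subseteq> U2"
      using hg homeomorphism_image2[OF R(5)] sV by (force simp: U2_def g_def)
    show "g (h z) = z" if "z \<in> U2" for z
    proof -
      have "of_real s *s h z = h1 z" using s(1) by (simp add: h_def vec_eq_iff)
      then show ?thesis using homeomorphism_apply1[OF R(5)] that by (simp add: g_def U2_def)
    qed
  qed
  have U2s: "U2 \<subseteq> snd c ` fst c" using R(2) by (auto simp: U2_def S_def S0_def)
  define c' where "c' = ({x \<in> fst c. snd c x \<in> U2}, \<lambda>x. h (snd c x))"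
  have hc2: "chol (\<lambda>w. h w $ i) z" if "z \<in> U2" for z i using hc that by (simp add: U2_def)
  have oV: "open V" by (simp add: V_def open_polydisc)
  note cc = chart_compose[OF c(1) U2 U2s oV hom hc2 gc, folded c'_def]
  have c'A: "c' \<in> A" using cc(1) by auto
  have in_c': "q \<in> fst c \<and> snd c q \<in> U2 \<and> q \<in> U \<and> X c q $ k \<noteq> 0" if "q \<in> fst c'" for q
  proof -
    have q: "q \<in> fst c" "snd c q \<in> U2" using that by (auto simp: c'_def)
    then have "snd c q \<in> S" using R(2) by (auto simp: U2_def)
    then obtain x where "x \<in> fst c" "x \<in> U" "snd c q = snd c x" "f (snd c q) $ k \<noteq> 0"
      by (auto simp: S_def S0_def)
    then show ?thesis using q chart_inj[OF c(1)] c by (auto simp: f_def)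
  qed
  have noE: "q \<notin> E" if "q \<in> fst c'" for q
    using gen_nonzero[OF X(1) c(1), of q] in_c'[OF that] by auto
  have Xc': "X c' q $ j = 0" if q: "q \<in> fst c'" and j: "j \<noteq> k" for q j
  proof -
    note q' = in_c'[OF q]
    have zU: "snd c q \<in> U1" using q' by (simp add: U2_def)
    have "X c' q = jacobian c c' q (X c q)"
      using gen_transform[OF X(1) c(1) c'A] q' q by blast
    then have "X c' q $ j = FD (\<lambda>w. transition c c' w $ j) (snd c q) (X c q)"
      using jacobian_nth[OF c(1) c'A] q' q by simp
    also have "\<dots> = of_real (1/s) * FD (\<lambda>w. h1 w $ j) (snd c q) (X c q)"
    proof (rule FD_along)
      show tc: "chol (\<lambda>w. transition c c' w $ j) (snd c q)" using transition_chol[OF c(1) c'A] q' q by blast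
      have ch: "chol (\<lambda>w. of_real (1/s) * h1 w $ j) (snd c q)" using R(7)[OF zU] by (intro chol_mult chol_const)
      have "((\<lambda>w. transition c c' w $ j) has_derivative FD (\<lambda>w. of_real (1/s) * h1 w $ j) (snd c q)) (at (snd c q))"
      proof (rule has_derivative_transform_within_open[OF chol_FD(1)[OF ch] U2])
        show "of_real (1/s) * h1 w $ j = transition c c' w $ j" if "w \<in> U2" for w
          using that U2s snd_chart_inv[OF c(1)] by (auto simp: transition_def c'_def h_def)
      qed (use q' in simp)
      then have e: "FD (\<lambda>w. transition c c' w $ j) (snd c q) = FD (\<lambda>w. of_real (1/s) * h1 w $ j) (snd c q)"
        using frechet_derivative_at by metis
      have "FD (\<lambda>w. of_real (1/s) * h1 w $ j) (snd c q) (X c q) = of_real (1/s) * FD (\<lambda>w. h1 w $ j) (snd c q) (X c q)"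
        by (rule FD_along[OF ch]) (intro DERIV_cmult chol_deriv_along R(7)[OF zU])
      then show "((\<lambda>s'. transition c c' (snd c q + s' *s X c q) $ j) has_field_derivative
          of_real (1/s) * FD (\<lambda>w. h1 w $ j) (snd c q) (X c q)) (at 0)"
        using chol_deriv_along[OF tc, of "X c q"] e by simp
    qed
    also have "\<dots> = 0" using R(9)[OF zU j] q' c by (simp add: f_def)
    finally show ?thesis .
  qed
  have "fbox c' k"
    unfolding flow_box_def
  proof (intro conjI)
    show "c' \<in> A" by fact
    show "fst c' \<inter> E = {}" using noE by blast
    show "snd c' ` fst c' = {z. \<forall>j. cmod (z $ j) < 1}" using cc(2) by (auto simp: V_def)
    have "Y c' q $ j = 0" if *: "(W, Y) \<in> F" "q \<in> W" "q \<in> fst c'" "j \<noteq> k" for W Y q j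
    proof -
      obtain a where "Y c' q = a *s X c' q"
        using gen_proportional[OF *(1) X(1) c'A *(3,2)] in_c'[OF *(3)] noE[OF *(3)] by blast
      then show ?thesis using Xc'[OF *(3,4)] by simp
    qed
    then show "\<forall>(W, Y)\<in>F. \<forall>q\<in>W \<inter> fst c'. \<forall>j. j \<noteq> k \<longrightarrow> Y c' q $ j = 0" by blast
  qed
  moreover have "p \<in> fst c'" "snd c' p = 0"
  proof -
    have "h (snd c p) = 0" using R(6) by (simp add: h_def vec_eq_iff)
    then show "p \<in> fst c'" "snd c' p = 0" using c R(3) by (auto simp: c'_def U2_def V_def)
  qed
  ultimately show thesis using that by blast
qed

end

section \<open>The leaf topology\<close>

context foliated
begin

text \<open>Some generator is nonzero at \<open>p\<close> and spans the \<open>i\<close>-th axis in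
  \<open>c\<close> and the \<open>k\<close>-th axis in \<open>d\<close>; the Jacobian carries the
  one to the other.\<close>

lemma fbox_frame:
  assumes c: "fbox c i" and d: "fbox d k" and p: "p \<in> fst c" "p \<in> fst d"
    and v: "\<And>j. j \<noteq> i \<Longrightarrow> v $ j = 0" and m: "m \<noteq> k"
  shows "jacobian c d p v $ m = 0"
proof -
  note cA = fboxD(1)[OF c] and dA = fboxD(1)[OF d]
  obtain U X where X: "(U, X) \<in> F" "p \<in> U" by (rule gen_cover)
  have "p \<notin> E" using fboxD(2)[OF c] p by blast
  then have "X c p \<noteq> 0" using gen_nonzero[OF X(1) cA X(2) p(1)] by simp
  moreover have X0: "X c p $ j = 0" if "j \<noteq> i" for j using fboxD(4)[OF c X p(1)] that by blast
  ultimately have Xi: "X c p $ i \<noteq> 0" by (metis vec_eq_iff zero_index)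
  have "v = (v $ i / X c p $ i) *s X c p" unfolding vec_eq_iff
  proof
    fix l show "v $ l = ((v $ i / X c p $ i) *s X c p) $ l" by (cases "l = i") (use Xi X0 v in auto)
  qed
  then have "jacobian c d p v = (v $ i / X c p $ i) *s jacobian c d p (X c p)"
    using jacobian_scale[OF cA dA p] by metis
  also have "jacobian c d p (X c p) = X d p" using gen_transform[OF X(1) cA dA X(2) p] by simp
  finally show ?thesis using fboxD(4)[OF d X p(2) m] by simp
qed

text \<open>Tangency in one box per parameter; by \<open>fbox_frame\<close> it holds in every box
  (\<open>leafwise_velocity\<close>). The condition also keeps the curve off \<open>E\<close>, as
  flow boxes do not meet it.\<close>

definition leafwise :: "complex set \<Rightarrow> (complex \<Rightarrow> 'a) \<Rightarrow> bool" where
  "leafwise S \<gamma> \<longleftrightarrow> hol_curve S \<gamma> \<and>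
     (\<forall>t\<in>S. \<exists>c i. fbox c i \<and> \<gamma> t \<in> fst c \<and> (\<forall>j. j \<noteq> i \<longrightarrow> velocity c \<gamma> t $ j = 0))"

lemma leafwise_hol_curve: "leafwise S \<gamma> \<Longrightarrow> hol_curve S \<gamma>"
  by (simp add: leafwise_def)

lemma leafwise_notin_E: "leafwise S \<gamma> \<Longrightarrow> t \<in> S \<Longrightarrow> \<gamma> t \<notin> E"
  unfolding leafwise_def using fboxD(2) by blast

lemma leafwise_subset: "leafwise S \<gamma> \<Longrightarrow> T \<subseteq> S \<Longrightarrow> leafwise T \<gamma>"
  unfolding leafwise_def using hol_curve_subset by blast

lemma leafwise_velocity:
  assumes "leafwise S \<gamma>" "open S" "fbox d k" "t \<in> S" "\<gamma> t \<in> fst d" "m \<noteq> k"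
  shows "velocity d \<gamma> t $ m = 0"
proof -
  obtain c i where c: "fbox c i" "\<gamma> t \<in> fst c" "\<And>j. j \<noteq> i \<Longrightarrow> velocity c \<gamma> t $ j = 0"
    using assms unfolding leafwise_def by blast
  have "velocity d \<gamma> t = jacobian c d (\<gamma> t) (velocity c \<gamma> t)"
    using velocity_transform[OF leafwise_hol_curve[OF assms(1)] assms(2) fboxD(1)[OF c(1)] fboxD(1)[OF assms(3)]]
      assms c by blast
  then show ?thesis using fbox_frame[OF c(1) assms(3) c(2) assms(5) c(3) assms(6)] by simp
qed

lemma leafwise_const:
  assumes "leafwise S \<gamma>" "open S" "fbox d k" "N \<subseteq> S" "open N" "connected N" "\<gamma> ` N \<subseteq> fst d"
    "s \<in> N" "t \<in> N" "m \<noteq> k"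
  shows "snd d (\<gamma> s) $ m = snd d (\<gamma> t) $ m"
proof -
  have "(\<lambda>s. snd d (\<gamma> s) $ m) constant_on N"
  proof (rule has_field_derivative_0_imp_constant_on)
    fix z assume z: "z \<in> N"
    have zS: "z \<in> S" "\<gamma> z \<in> fst d" using assms z by auto
    then show "((\<lambda>s. snd d (\<gamma> s) $ m) has_field_derivative 0) (at z)"
      using hol_curve_velocity[OF leafwise_hol_curve[OF assms(1)] assms(2) fboxD(1)[OF assms(3)] zS, of m]
        leafwise_velocity[OF assms(1-3) zS assms(10)] by simp
  qed (use assms in auto)
  then show ?thesis using assms(8,9) by (auto simp: constant_on_def)
qed

lemma leafwiseI_const:
  assumes "hol_curve S \<gamma>" "open S"
    "\<And>t. t \<in> S \<Longrightarrow> \<exists>c i N. fbox c i \<and> open N \<and> t \<in> N \<and> N \<subseteq> S \<and> \<gamma> ` N \<subseteq> fst c \<and>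
       (\<forall>s\<in>N. \<forall>j. j \<noteq> i \<longrightarrow> snd c (\<gamma> s) $ j = snd c (\<gamma> t) $ j)"
  shows "leafwise S \<gamma>"
  unfolding leafwise_def
proof (intro conjI ballI)
  fix t assume t: "t \<in> S"
  obtain c i N where c: "fbox c i" "open N" "t \<in> N" "N \<subseteq> S" "\<gamma> ` N \<subseteq> fst c"
     "\<And>s j. s \<in> N \<Longrightarrow> j \<noteq> i \<Longrightarrow> snd c (\<gamma> s) $ j = snd c (\<gamma> t) $ j"
    using assms(3)[OF t] by (elim exE conjE) (rule that, auto)
  have v0: "velocity c \<gamma> t $ j = 0" if j: "j \<noteq> i" for j
  proof -
    have "((\<lambda>s. snd c (\<gamma> s) $ j) has_field_derivative velocity c \<gamma> t $ j) (at t)"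
      by (rule hol_curve_velocity[OF assms(1,2) fboxD(1)[OF c(1)] t]) (use c in auto)
    moreover have "((\<lambda>s. snd c (\<gamma> s) $ j) has_field_derivative 0) (at t)"
      by (rule has_field_derivative_transform_within_open[OF DERIV_const c(2,3)]) (use c(6) j in auto)
    ultimately show ?thesis using DERIV_unique by blast
  qed
  show "\<exists>c i. fbox c i \<and> \<gamma> t \<in> fst c \<and> (\<forall>j. j \<noteq> i \<longrightarrow> velocity c \<gamma> t $ j = 0)"
  proof (intro exI conjI allI impI)
    show "fbox c i" by (rule c(1))
    show "\<gamma> t \<in> fst c" using c(3,5) by auto
  qed (rule v0)
qed fact

section \<open>Plaques and the leaf topology\<close>

abbreviation leaftop where "leaftop \<equiv> leaf_topology A E F"

definition plaque :: "('a, 'n) chart \<Rightarrow> 'n \<Rightarrow> 'a \<Rightarrow> 'a set" where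
  "plaque c i p = {x \<in> fst c. \<forall>j. j \<noteq> i \<longrightarrow> snd c x $ j = snd c p $ j}"

lemma plaques_eq: "plaques A E F = {plaque c i p | c i p. fbox c i \<and> p \<in> fst c}"
  by (simp add: plaques_def plaque_def)

lemma openin_plaque: "fbox c i \<Longrightarrow> p \<in> fst c \<Longrightarrow> openin leaftop (plaque c i p)"
  unfolding leaf_topology_def plaques_eq by (rule topology_generated_by_Basis) blast

lemma plaque_self: "p \<in> fst c \<Longrightarrow> p \<in> plaque c i p"
  by (simp add: plaque_def)

lemma Union_plaques: "\<Union> (plaques A E F) = - E"
proof
  show "\<Union> (plaques A E F) \<subseteq> - E" unfolding plaques_eq plaque_def using fboxD(2) by blast
  show "- E \<subseteq> \<Union> (plaques A E F)"
  proof
    fix p assume "p \<in> - E"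
    then obtain c i where "fbox c i" "p \<in> fst c" using flow_box_exists by blast
    then show "p \<in> \<Union> (plaques A E F)" unfolding plaques_eq using plaque_self by blast
  qed
qed

lemma topspace_leaftop: "topspace leaftop = - E"
  by (simp add: leaf_topology_def Union_plaques)

lemma open_compl_E: "open (- E)"
proof (subst open_subopen, intro ballI)
  fix p assume "p \<in> - E"
  then obtain c i where c: "fbox c i" "p \<in> fst c" using flow_box_exists by blast
  show "\<exists>T. open T \<and> p \<in> T \<and> T \<subseteq> - E"
    by (rule exI[of _ "fst c"]) (use c fboxD(2)[OF c(1)] chart_open(1)[OF fboxD(1)[OF c(1)]] in auto)
qed

lemma leafwise_local:
  assumes "leafwise S \<gamma>" "open S" "fbox d k" "t \<in> S" "\<gamma> t \<in> fst d"
  obtains r where "r > 0" "ball t r \<subseteq> S" "\<gamma> ` ball t r \<subseteq> plaque d k (\<gamma> t)"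
proof -
  have "open {s \<in> S. \<gamma> s \<in> fst d}"
    by (rule hol_curve_preimage_open[OF leafwise_hol_curve[OF assms(1)] assms(2) chart_open(1)[OF fboxD(1)[OF assms(3)]]])
  then obtain r where r: "r > 0" "ball t r \<subseteq> {s \<in> S. \<gamma> s \<in> fst d}" using assms openE by blast
  have "\<gamma> s \<in> plaque d k (\<gamma> t)" if "s \<in> ball t r" for s
    unfolding plaque_def using leafwise_const[OF assms(1-3), of "ball t r" s t] r that by auto
  then show thesis using that r by blast
qed

text \<open>Plaques generate the topology, so only their preimages matter, and near each parameter
  the curve stays in one plaque.\<close>

lemma leafwise_continuous:
  assumes "leafwise S \<gamma>" "open S"
  shows "continuous_map (top_of_set S) leaftop \<gamma>"
  unfolding leaf_topology_def
proof (rule continuous_on_generated_topo)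
  show "\<gamma> ` topspace (top_of_set S) \<subseteq> \<Union> (plaques A E F)"
    unfolding Union_plaques using leafwise_notin_E[OF assms(1)] by auto
  fix Q assume "Q \<in> plaques A E F"
  then obtain d k p where Q: "Q = plaque d k p" "fbox d k" "p \<in> fst d" unfolding plaques_eq by blast
  have "open (\<gamma> -` Q \<inter> S)"
  proof (subst open_subopen, intro ballI)
    fix t assume t: "t \<in> \<gamma> -` Q \<inter> S"
    then have "\<gamma> t \<in> fst d" by (auto simp: Q plaque_def)
    then obtain r where r: "r > 0" "ball t r \<subseteq> S" "\<gamma> ` ball t r \<subseteq> plaque d k (\<gamma> t)"
      using leafwise_local[OF assms Q(2)] t by blast
    have "plaque d k (\<gamma> t) \<subseteq> Q" using t by (auto simp: Q plaque_def)
    then show "\<exists>T. open T \<and> t \<in> T \<and> T \<subseteq> \<gamma> -` Q \<inter> S"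
      using r by (intro exI[of _ "ball t r"]) (auto simp: image_subset_iff)
  qed
  then show "openin (top_of_set S) (\<gamma> -` Q \<inter> topspace (top_of_set S))"
    by (simp add: open_subset)
qed

section \<open>Leaves and the curves in them\<close>

abbreviation leafs where "leafs \<equiv> leaves A E F"

lemma leaf_exists: assumes "p \<notin> E" obtains L where "L \<in> leafs" "p \<in> L"
  using assms Union_connected_components_of[of leaftop] unfolding topspace_leaftop leaves_def by blast

lemma leaf_unique: "L \<in> leafs \<Longrightarrow> L' \<in> leafs \<Longrightarrow> p \<in> L \<Longrightarrow> p \<in> L' \<Longrightarrow> L = L'"
  unfolding leaves_def using connected_components_of_overlap by blast

lemma leaf_subset: "L \<in> leafs \<Longrightarrow> L \<subseteq> - E"
  unfolding leaves_def topspace_leaftop[symmetric] by (rule connected_components_of_subset)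

lemma leafwise_in_leaf:
  assumes "leafwise S \<gamma>" "open S" "connected S" "t \<in> S" "L \<in> leafs" "\<gamma> t \<in> L"
  shows "\<gamma> ` S \<subseteq> L"
proof -
  have "connectedin leaftop (\<gamma> ` S)"
    by (rule connectedin_continuous_map_image[OF leafwise_continuous[OF assms(1,2)]])
      (simp add: assms connectedin_subtopology)
  moreover have "\<not> disjnt L (\<gamma> ` S)" using assms by (auto simp: disjnt_def)
  ultimately show ?thesis
    using connected_components_of_maximal assms(5) unfolding leaves_def by blast
qed

text \<open>The plaque through \<open>x\<close>, parametrized by its own \<open>i\<close>-th
  coordinate: \<open>x\<close> sits at the parameter \<open>snd c x $ i\<close>, which may differ
  from 0.\<close>

definition plaque_disc :: "('a, 'n) chart \<Rightarrow> 'n \<Rightarrow> 'a \<Rightarrow> complex \<Rightarrow> 'a" where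
  "plaque_disc c i x \<xi> = chart_inv c (\<chi> j. if j = i then \<xi> else snd c x $ j)"

lemma plaque_disc_props:
  assumes c: "fbox c i" and x: "x \<in> fst c"
  shows "\<xi> \<in> unit_disc \<Longrightarrow> plaque_disc c i x \<xi> \<in> fst c"
    "\<xi> \<in> unit_disc \<Longrightarrow> snd c (plaque_disc c i x \<xi>) $ j = (if j = i then \<xi> else snd c x $ j)"
    "plaque_disc c i x (snd c x $ i) = x"
    "leafwise unit_disc (plaque_disc c i x)"
proof -
  note cA = fboxD(1)[OF c]
  have in1: "(\<chi> j. if j = i then \<xi> else snd c x $ j) \<in> snd c ` fst c" if "\<xi> \<in> unit_disc" for \<xi>
    using that x fboxD(3)[OF c] by auto
  show 1: "plaque_disc c i x \<xi> \<in> fst c" if "\<xi> \<in> unit_disc" for \<xi>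
    unfolding plaque_disc_def using chart_inv_in[OF cA in1[OF that]] .
  show 2: "snd c (plaque_disc c i x \<xi>) $ j = (if j = i then \<xi> else snd c x $ j)" if "\<xi> \<in> unit_disc" for \<xi> j
    unfolding plaque_disc_def using snd_chart_inv[OF cA in1[OF that]] by simp
  have "(\<chi> j. if j = i then snd c x $ i else snd c x $ j) = snd c x" by (simp add: vec_eq_iff)
  then show "plaque_disc c i x (snd c x $ i) = x" using cA x by (simp add: plaque_disc_def)
  have hc: "hol_curve unit_disc (plaque_disc c i x)"
  proof (rule hol_curveI)
    fix t :: complex assume "t \<in> unit_disc"
    moreover have "(\<lambda>s. snd c (plaque_disc c i x s) $ j) holomorphic_on unit_disc" for j
    proof (rule holomorphic_transform)
      show "(\<lambda>s. if j = i then s else snd c x $ j) holomorphic_on unit_disc"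
        by (cases "j = i") auto
    qed (simp only: 2)
    moreover have "plaque_disc c i x ` unit_disc \<subseteq> fst c" using 1 by blast
    ultimately show "\<exists>c' N. c' \<in> A \<and> open N \<and> t \<in> N \<and> N \<subseteq> unit_disc \<and> plaque_disc c i x ` N \<subseteq> fst c' \<and>
        (\<forall>j. (\<lambda>s. snd c' (plaque_disc c i x s) $ j) holomorphic_on N)"
      using cA open_ball by blast
  qed simp
  show "leafwise unit_disc (plaque_disc c i x)"
  proof (rule leafwiseI_const[OF hc open_ball])
    fix t :: complex assume t: "t \<in> unit_disc"
    have "\<forall>s\<in>unit_disc. \<forall>j. j \<noteq> i \<longrightarrow> snd c (plaque_disc c i x s) $ j = snd c (plaque_disc c i x t) $ j"
      using 2 t by simp
    moreover have "plaque_disc c i x ` unit_disc \<subseteq> fst c" using 1 by blast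
    ultimately show "\<exists>c' i' N. fbox c' i' \<and> open N \<and> t \<in> N \<and> N \<subseteq> unit_disc \<and> plaque_disc c i x ` N \<subseteq> fst c' \<and>
       (\<forall>s\<in>N. \<forall>j. j \<noteq> i' \<longrightarrow> snd c' (plaque_disc c i x s) $ j = snd c' (plaque_disc c i x t) $ j)"
      using c t open_ball by blast
  qed
qed

section \<open>Uniformizations and leaf discs as leafwise maps\<close>

lemma uniformization_image:
  assumes "uniformization_of A E F L \<alpha>" "L \<in> leafs" shows "\<alpha> ` unit_disc = L"
  using assms leaf_subset[OF assms(2)] unfolding uniformization_of_def is_covering_map_def
  by (auto simp: topspace_leaftop)

lemma uniformization_continuous:
  assumes "uniformization_of A E F L \<alpha>"
  shows "continuous_map (top_of_set unit_disc) leaftop \<alpha>"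
  using assms unfolding uniformization_of_def is_covering_map_def
  by (simp add: continuous_map_in_subtopology)

text \<open>Continuity into the leaf topology makes the preimage of a plaque open, so the map stays
  in a plaque near each parameter.\<close>

lemma uniformization_leafwise:
  assumes u: "uniformization_of A E F L \<alpha>" and L: "L \<in> leafs"
  shows "leafwise unit_disc \<alpha>"
proof (rule leafwiseI_const[OF _ open_ball])
  show "hol_curve unit_disc \<alpha>" using u by (simp add: uniformization_of_def holomorphic_disc_hol_curve)
  fix t :: complex assume t: "t \<in> unit_disc"
  then have "\<alpha> t \<notin> E" using uniformization_image[OF u L] leaf_subset[OF L] by blast
  then obtain c i where c: "fbox c i" "\<alpha> t \<in> fst c" using flow_box_exists by blast
  define N where "N = {s \<in> unit_disc. \<alpha> s \<in> plaque c i (\<alpha> t)}"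
  have "openin (top_of_set unit_disc) N"
    unfolding N_def using openin_continuous_map_preimage[OF uniformization_continuous[OF u] openin_plaque[OF c]] by simp
  then have "open N" using openin_open_trans open_ball by blast
  moreover have "t \<in> N" using t plaque_self[OF c(2)] by (simp add: N_def)
  ultimately show "\<exists>c i N. fbox c i \<and> open N \<and> t \<in> N \<and> N \<subseteq> unit_disc \<and> \<alpha> ` N \<subseteq> fst c \<and>
       (\<forall>s\<in>N. \<forall>j. j \<noteq> i \<longrightarrow> snd c (\<alpha> s) $ j = snd c (\<alpha> t) $ j)"
    using c by (intro exI[of _ c] exI[of _ i] exI[of _ N]) (auto simp: N_def plaque_def)
qed

text \<open>Distinct plaques have disjoint open preimages in the disc, and a disjoint family of open
  sets there is countable; each transverse coordinate is constant on a plaque.\<close>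

lemma leaf_countable_plaques:
  assumes u: "uniformization_of A E F L \<alpha>" and L: "L \<in> leafs" and c: "fbox c i" and j: "j \<noteq> i"
  shows "countable ((\<lambda>x. snd c x $ j) ` (L \<inter> fst c))"
proof -
  define O' where "O' x = {s \<in> unit_disc. \<alpha> s \<in> plaque c i x}" for x
  define T where "T = O' ` (L \<inter> fst c)"
  have "countable T"
  proof (rule countable_disjoint_open_subsets)
    fix S assume "S \<in> T"
    then obtain x where x: "x \<in> L" "x \<in> fst c" "S = O' x" by (auto simp: T_def)
    have "openin (top_of_set unit_disc) S"
      unfolding x O'_def
      using openin_continuous_map_preimage[OF uniformization_continuous[OF u] openin_plaque[OF c x(2)]] by simp
    then show "open S" using openin_open_trans open_ball by blast
  next
    show "pairwise disjnt T"
    proof (rule pairwiseI)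
      fix S S' assume "S \<in> T" "S' \<in> T" "S \<noteq> S'"
      then obtain x y where xy: "S = O' x" "S' = O' y" by (auto simp: T_def)
      have "plaque c i x = plaque c i y" if "\<alpha> s \<in> plaque c i x" "\<alpha> s \<in> plaque c i y" for s
        using that by (auto simp: plaque_def)
      then show "disjnt S S'" using \<open>S \<noteq> S'\<close> unfolding xy O'_def disjnt_def by blast
    qed
  qed
  moreover have "(\<lambda>x. snd c x $ j) ` (L \<inter> fst c) \<subseteq> (\<lambda>S. snd c (\<alpha> (SOME s. s \<in> S)) $ j) ` T"
  proof
    fix v assume "v \<in> (\<lambda>x. snd c x $ j) ` (L \<inter> fst c)"
    then obtain x where x: "x \<in> L" "x \<in> fst c" "v = snd c x $ j" by blast
    obtain t where "t \<in> unit_disc" "\<alpha> t = x" using uniformization_image[OF u L] x by blast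
    then have "t \<in> O' x" using plaque_self[OF x(2)] by (simp add: O'_def)
    then have "(SOME s. s \<in> O' x) \<in> O' x" by (rule someI)
    then have "snd c (\<alpha> (SOME s. s \<in> O' x)) $ j = v" using x j by (simp add: O'_def plaque_def)
    then show "v \<in> (\<lambda>S. snd c (\<alpha> (SOME s. s \<in> S)) $ j) ` T" unfolding T_def image_image using x by blast
  qed
  ultimately show ?thesis by (meson countable_image countable_subset)
qed

text \<open>A curve in a leaf moves in a single plaque locally, as the leaf meets a flow box in
  countably many plaques.\<close>

lemma leaf_disc_leafwise:
  assumes h: "hyperbolic_foliation A E F" and f: "f \<in> leaf_discs A E F"
  shows "leafwise unit_disc f"
proof (rule leafwiseI_const[OF _ open_ball])
  show hc: "hol_curve unit_disc f" using f by (simp add: leaf_discs_def holomorphic_disc_hol_curve)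
  obtain L where L: "L \<in> leafs" "f ` unit_disc \<subseteq> L" using f by (auto simp: leaf_discs_def)
  obtain \<alpha> where u: "uniformization_of A E F L \<alpha>" using h L by (auto simp: hyperbolic_foliation_def)
  fix t :: complex assume t: "t \<in> unit_disc"
  then have "f t \<notin> E" using L leaf_subset by blast
  then obtain c i where c: "fbox c i" "f t \<in> fst c" using flow_box_exists by blast
  note cA = fboxD(1)[OF c(1)]
  have "open {s \<in> unit_disc. f s \<in> fst c}"
    using hol_curve_preimage_open[OF hc open_ball] chart_open(1)[OF cA] by blast
  then obtain r where r: "r > 0" "ball t r \<subseteq> {s \<in> unit_disc. f s \<in> fst c}" using t c(2) openE by blast
  have fc: "snd c (f s) $ j = snd c (f t) $ j" if s: "s \<in> ball t r" and j: "j \<noteq> i" for s j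
  proof (rule ccontr)
    assume ne: "snd c (f s) $ j \<noteq> snd c (f t) $ j"
    have "continuous_on (ball t r) (\<lambda>s. snd c (f s) $ j)"
    proof -
      have "(\<lambda>s. snd c (f s) $ j) holomorphic_on ball t r"
        using hc cA r by (auto simp: hol_curve_def intro: holomorphic_on_subset)
      then show ?thesis by (rule holomorphic_on_imp_continuous_on)
    qed
    \<comment> \<open>A value different from \<open>snd c (f t) $ j\<close> would make the image a
      connected set with two points, hence uncountable.\<close>
    then have "connected ((\<lambda>s. snd c (f s) $ j) ` ball t r)" using connected_continuous_image by blast
    then have "uncountable ((\<lambda>s. snd c (f s) $ j) ` ball t r)"
      using connected_uncountable[of _ "snd c (f s) $ j" "snd c (f t) $ j"] s r ne by auto
    moreover have "(\<lambda>s. snd c (f s) $ j) ` ball t r \<subseteq> (\<lambda>x. snd c x $ j) ` (L \<inter> fst c)"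
      using r(2) L(2) by fastforce
    ultimately show False using countable_subset[OF _ leaf_countable_plaques[OF u L(1) c(1) j]] by simp
  qed
  show "\<exists>c i N. fbox c i \<and> open N \<and> t \<in> N \<and> N \<subseteq> unit_disc \<and> f ` N \<subseteq> fst c \<and>
       (\<forall>s\<in>N. \<forall>j. j \<noteq> i \<longrightarrow> snd c (f s) $ j = snd c (f t) $ j)"
  proof (intro exI conjI ballI allI impI)
    show "ball t r \<subseteq> unit_disc" "f ` ball t r \<subseteq> fst c" "t \<in> ball t r" using r by auto
  qed (use c(1) fc in auto)
qed

end

section \<open>Lifting maps of the disc\<close>

text \<open>The set where the lifts agree is closed, and open because \<open>p\<close> is injective
  near a common value. The type \<open>'b\<close> carries no topology, so that \<open>p\<close> may
  be a map to a leaf, whose topology is not that of its type.\<close>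

lemma lift_unique:
  fixes p f :: "complex \<Rightarrow> 'b"
  assumes inj: "\<And>x. x \<in> X \<Longrightarrow> \<exists>u. open u \<and> x \<in> u \<and> inj_on p (u \<inter> X)"
    and T: "connected T" and h: "continuous_on T h" "continuous_on T h'"
    and X: "h ` T \<subseteq> X" "h' ` T \<subseteq> X" and eq: "\<And>t. t \<in> T \<Longrightarrow> p (h t) = p (h' t)"
    and a: "a \<in> T" "h a = h' a" and t: "t \<in> T"
  shows "h t = (h' t :: complex)"
proof -
  define K where "K = {s \<in> T. h s = h' s}"
  have "closedin (top_of_set T) K"
  proof -
    have "K = T \<inter> (\<lambda>s. h s - h' s) -` {0}" by (auto simp: K_def)
    then show ?thesis
      using continuous_closedin_preimage_constant[of T "\<lambda>s. h s - h' s" 0] h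
      by (simp add: continuous_on_diff vimage_def Int_def)
  qed
  moreover have "openin (top_of_set T) K"
  proof (subst openin_subopen, intro ballI)
    fix s assume s: "s \<in> K"
    then have sX: "s \<in> T" "h s \<in> X" "h' s = h s" using X by (auto simp: K_def)
    obtain u where u: "open u" "h s \<in> u" "inj_on p (u \<inter> X)" using inj[OF sX(2)] by blast
    let ?N = "(T \<inter> h -` u) \<inter> (T \<inter> h' -` u)"
    have "openin (top_of_set T) ?N"
      using continuous_openin_preimage_gen[OF h(1) u(1)] continuous_openin_preimage_gen[OF h(2) u(1)]
      by (rule openin_Int)
    moreover have "s \<in> ?N" using sX u by auto
    moreover have "?N \<subseteq> K"
    proof
      fix r assume r: "r \<in> ?N"
      then have "h r \<in> u \<inter> X" "h' r \<in> u \<inter> X" using X by auto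
      moreover have "p (h r) = p (h' r)" using eq r by blast
      ultimately have "h r = h' r" using u(3) by (meson inj_onD)
      then show "r \<in> K" using r by (auto simp: K_def)
    qed
    ultimately show "\<exists>N. openin (top_of_set T) N \<and> s \<in> N \<and> N \<subseteq> K" by blast
  qed
  ultimately have "K = {} \<or> K = T" using T unfolding connected_clopen by blast
  then show ?thesis using a t by (auto simp: K_def)
qed

text \<open>The lift is a section of the pull-back of \<open>p\<close> along \<open>f\<close>, which is a covering of the disc.\<close>

lemma disc_lift:
  fixes p f :: "complex \<Rightarrow> 'b" and X :: "complex set"
  defines "lifts T h \<equiv> continuous_on T h \<and> (\<forall>u\<in>T. h u \<in> X \<and> p (h u) = f u)"
  assumes inj: "\<And>x. x \<in> X \<Longrightarrow> \<exists>u. open u \<and> x \<in> u \<and> inj_on p (u \<inter> X)"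
    and loc: "\<And>b. b \<in> unit_disc \<Longrightarrow> \<exists>\<epsilon>>0. \<forall>t\<in>ball b \<epsilon> \<inter> unit_disc. \<forall>x\<in>X. p x = f t \<longrightarrow>
      (\<exists>h. lifts (ball b \<epsilon> \<inter> unit_disc) h \<and> h t = x)"
    and x0: "x0 \<in> X" "p x0 = f 0"
  obtains G where "lifts unit_disc G" "G 0 = x0"
proof -
  define Z where "Z = {(t, x). t \<in> unit_disc \<and> x \<in> X \<and> p x = f t}"
  \<comment> \<open>Over a \<open>nice\<close> set every point of a fibre extends to a section; the
    set is the same for all points of the fibre, which makes it evenly covered.\<close>
  define nice where "nice T \<longleftrightarrow> open T \<and> convex T \<and> T \<subseteq> unit_disc \<and>
    (\<forall>t\<in>T. \<forall>x\<in>X. p x = f t \<longrightarrow> (\<exists>h. lifts T h \<and> h t = x))" for T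
  have nice: "\<exists>T. nice T \<and> b \<in> T" if b: "b \<in> unit_disc" for b
  proof -
    obtain \<epsilon> where "\<epsilon> > 0" "\<forall>t\<in>ball b \<epsilon> \<inter> unit_disc. \<forall>x\<in>X. p x = f t \<longrightarrow>
      (\<exists>h. lifts (ball b \<epsilon> \<inter> unit_disc) h \<and> h t = x)" using loc[OF b] by blast
    then show ?thesis using b
      by (intro exI[of _ "ball b \<epsilon> \<inter> unit_disc"]) (auto simp: nice_def intro: convex_Int)
  qed
  have all: "t' \<in> fst ` Z" if T: "nice T" and t: "t \<in> T" "t \<in> fst ` Z" and t': "t' \<in> T" for T t t'
  proof -
    obtain x where "x \<in> X" "p x = f t" using t by (auto simp: Z_def)
    then obtain h where "lifts T h" using T t unfolding nice_def by blast
    then have "(t', h t') \<in> Z" using t' T by (auto simp: Z_def lifts_def nice_def)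
    then show ?thesis by force
  qed
  \<comment> \<open>A \<open>nice\<close> set that meets the projection of \<open>Z\<close> lies in
    it, so the projection is open and closed in the disc; \<open>x0\<close> makes it
    nonempty.\<close>
  have surj: "fst ` Z = unit_disc"
  proof -
    have "openin (top_of_set unit_disc) (fst ` Z)"
    proof (subst openin_subopen, intro ballI)
      fix t assume t: "t \<in> fst ` Z"
      then have "t \<in> unit_disc" by (auto simp: Z_def)
      then obtain T where T: "nice T" "t \<in> T" using nice by blast
      have "openin (top_of_set unit_disc) T" using T by (auto simp: nice_def open_subset)
      then show "\<exists>T. openin (top_of_set unit_disc) T \<and> t \<in> T \<and> T \<subseteq> fst ` Z"
        using all[OF T(1,2) t] T by blast
    qed
    moreover have "openin (top_of_set unit_disc) (unit_disc - fst ` Z)"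
    proof (subst openin_subopen, intro ballI)
      fix t assume t: "t \<in> unit_disc - fst ` Z"
      then obtain T where T: "nice T" "t \<in> T" using nice by blast
      have o: "openin (top_of_set unit_disc) T" using T by (auto simp: nice_def open_subset)
      have "T \<subseteq> unit_disc - fst ` Z"
      proof
        fix s assume s: "s \<in> T"
        then have "s \<notin> fst ` Z" using all[OF T(1) s _ T(2)] t by blast
        then show "s \<in> unit_disc - fst ` Z" using s T by (auto simp: nice_def)
      qed
      then show "\<exists>T. openin (top_of_set unit_disc) T \<and> t \<in> T \<and> T \<subseteq> unit_disc - fst ` Z" using o T by blast
    qed
    ultimately have "fst ` Z = {} \<or> fst ` Z = unit_disc"
      using connected_ball[of "0::complex" 1] unfolding connected_clopen
      by (metis (no_types, lifting) openin_closedin_eq openin_subset topspace_euclidean_subtopology closedin_def double_diff order_refl)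
    moreover have "(0, x0) \<in> Z" using x0 by (simp add: Z_def)
    ultimately show ?thesis by blast
  qed
  have "covering_space Z fst unit_disc"
    unfolding covering_space_def
  proof (intro conjI ballI)
    show "continuous_on Z fst" by (intro continuous_intros)
    show "fst ` Z = unit_disc" by (rule surj)
    fix b :: complex assume "b \<in> unit_disc"
    then obtain T where T: "nice T" "b \<in> T" using nice by blast
    have oT: "open T" and cT: "connected T" and Ts: "T \<subseteq> unit_disc"
      using T by (auto simp: nice_def convex_connected)
    \<comment> \<open>The sheets over \<open>T\<close> are the graphs of the sections. They are open
      in \<open>Z\<close> by local injectivity of \<open>p\<close> and disjoint by
      \<open>lift_unique\<close>.\<close>
    define gr where "gr h = (\<lambda>t::complex. (t, h t :: complex)) ` T" for h
    define V where "V = gr ` {h. lifts T h}"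
    have "\<Union>V = Z \<inter> fst -` T"
    proof
      show "\<Union>V \<subseteq> Z \<inter> fst -` T" using Ts by (auto simp: V_def gr_def Z_def lifts_def)
      show "Z \<inter> fst -` T \<subseteq> \<Union>V"
      proof
        fix z assume z: "z \<in> Z \<inter> fst -` T"
        obtain t x where tx: "z = (t, x)" "t \<in> T" "x \<in> X" "p x = f t" using z by (auto simp: Z_def)
        then obtain h where "lifts T h" "h t = x" using T unfolding nice_def by blast
        then show "z \<in> \<Union>V" using tx by (auto simp: V_def gr_def)
      qed
    qed
    moreover have "openin (top_of_set Z) u" if u: "u \<in> V" for u
    proof -
      obtain h where h: "lifts T h" "u = gr h" using u by (auto simp: V_def)
      show ?thesis unfolding h(2)
      proof (subst openin_subopen, intro ballI)
        fix z assume "z \<in> gr h"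
        then obtain t where t: "t \<in> T" "z = (t, h t)" by (auto simp: gr_def)
        have "h t \<in> X" using h t by (auto simp: lifts_def)
        then obtain w where w: "open w" "h t \<in> w" "inj_on p (w \<inter> X)" using inj by blast
        have "open (T \<inter> h -` w)"
          using continuous_open_preimage[OF _ oT w(1)] h by (auto simp: lifts_def)
        then have "openin (top_of_set Z) (Z \<inter> (T \<inter> h -` w) \<times> w)"
          using w by (intro openin_open_Int open_Times)
        moreover have "z \<in> Z \<inter> (T \<inter> h -` w) \<times> w"
          using t w h Ts by (auto simp: Z_def lifts_def)
        moreover have "Z \<inter> (T \<inter> h -` w) \<times> w \<subseteq> gr h"
        proof
          fix y assume "y \<in> Z \<inter> (T \<inter> h -` w) \<times> w"
          then obtain s x where y: "y = (s, x)" "s \<in> T" "h s \<in> w" "x \<in> w" "x \<in> X" "p x = f s"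
            by (auto simp: Z_def)
          have "h s \<in> X" "p (h s) = f s" using h y by (auto simp: lifts_def)
          then have "x = h s" using w(3) y by (metis Int_iff inj_onD)
          then show "y \<in> gr h" using y by (auto simp: gr_def)
        qed
        ultimately show "\<exists>N. openin (top_of_set Z) N \<and> z \<in> N \<and> N \<subseteq> gr h" by blast
      qed
    qed
    moreover have "pairwise disjnt V"
    proof (rule pairwiseI)
      fix u u' assume u: "u \<in> V" "u' \<in> V" "u \<noteq> u'"
      obtain h h' where h: "lifts T h" "u = gr h" "lifts T h'" "u' = gr h'" using u by (auto simp: V_def)
      show "disjnt u u'"
      proof (rule ccontr)
        assume "\<not> disjnt u u'"
        then obtain a where a: "a \<in> T" "h a = h' a" by (auto simp: disjnt_def h gr_def)
        have "h t = h' t" if "t \<in> T" for t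
          by (rule lift_unique[of X p T h h' a t]) (use inj cT h a that in \<open>auto simp: lifts_def\<close>)
        then show False using u(3) by (auto simp: h gr_def)
      qed
    qed
    moreover have "\<exists>q. homeomorphism u T fst q" if u: "u \<in> V" for u
    proof -
      obtain h where h: "lifts T h" "u = gr h" using u by (auto simp: V_def)
      have "homeomorphism u T fst (\<lambda>t. (t, h t))"
        unfolding h(2) gr_def
        by (rule homeomorphismI) (use h in \<open>auto simp: lifts_def intro!: continuous_intros\<close>)
      then show ?thesis by blast
    qed
    moreover have "openin (top_of_set unit_disc) T" using oT Ts by (simp add: open_subset)
    ultimately show "\<exists>T. b \<in> T \<and> openin (top_of_set unit_disc) T \<and> (\<exists>v. \<Union> v = Z \<inter> fst -` T \<and>
        (\<forall>u\<in>v. openin (top_of_set Z) u) \<and> pairwise disjnt v \<and> (\<forall>u\<in>v. \<exists>q. homeomorphism u T fst q))"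
      using T(2) by (intro exI[of _ T] conjI exI[of _ V]) auto
  qed
  then obtain g where g: "continuous_on unit_disc g" "g \<in> unit_disc \<rightarrow> Z" "g 0 = (0, x0)"
    "\<And>y. y \<in> unit_disc \<Longrightarrow> fst (g y) = y"
  proof (rule covering_space_lift_strong[where f = "\<lambda>x. x" and U = unit_disc and a = "(0, x0)" and z = 0])
    show "(0, x0) \<in> Z" using x0 by (simp add: Z_def)
    show "simply_connected unit_disc" by (simp add: convex_imp_simply_connected)
    show "locally path_connected unit_disc" by (simp add: open_imp_locally_path_connected)
  qed auto
  have "lifts unit_disc (snd \<circ> g)"
    unfolding lifts_def
  proof (intro conjI ballI)
    show "continuous_on unit_disc (snd \<circ> g)" using g(1) by (simp add: continuous_on_snd o_def)
    fix u :: complex assume u: "u \<in> unit_disc"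
    then have "(u, snd (g u)) \<in> Z" using g(2,4) by (metis PiE prod.collapse)
    then show "(snd \<circ> g) u \<in> X" "p ((snd \<circ> g) u) = f u" by (auto simp: Z_def)
  qed
  then show thesis using that g(3) by simp
qed

section \<open>Coverings by the disc\<close>

lemma is_covering_mapE:
  assumes "is_covering_map X Y p" "y \<in> topspace Y"
  obtains T \<V> where "y \<in> T" "openin Y T" "\<Union>\<V> = {x \<in> topspace X. p x \<in> T}"
    "\<And>u. u \<in> \<V> \<Longrightarrow> openin X u" "pairwise disjnt \<V>"
    "\<And>u. u \<in> \<V> \<Longrightarrow> homeomorphic_map (subtopology X u) (subtopology Y T) p"
proof -
  have "\<exists>T. y \<in> T \<and> openin Y T \<and>
        (\<exists>\<V>. \<Union>\<V> = {x \<in> topspace X. p x \<in> T} \<and> (\<forall>u\<in>\<V>. openin X u) \<and> pairwise disjnt \<V> \<and>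
           (\<forall>u\<in>\<V>. homeomorphic_map (subtopology X u) (subtopology Y T) p))"
    using assms unfolding is_covering_map_def by (elim conjE) (rule bspec)
  then show thesis by (elim exE conjE) (rule that, auto)
qed

lemma covering_locally_injective:
  assumes p: "is_covering_map (top_of_set unit_disc) Y p" and x: "x \<in> unit_disc"
  shows "\<exists>u. open u \<and> x \<in> u \<and> inj_on p (u \<inter> unit_disc)"
proof -
  have "p x \<in> topspace Y" using p x unfolding is_covering_map_def by auto
  then obtain T \<V> where T: "p x \<in> T" "\<Union>\<V> = {x \<in> unit_disc. p x \<in> T}"
    "\<And>u. u \<in> \<V> \<Longrightarrow> openin (top_of_set unit_disc) u"
    "\<And>u. u \<in> \<V> \<Longrightarrow> homeomorphic_map (subtopology (top_of_set unit_disc) u) (subtopology Y T) p"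
    by (rule is_covering_mapE[OF p, unfolded topspace_euclidean_subtopology]) (rule that)
  then obtain u where u: "u \<in> \<V>" "x \<in> u" using x by blast
  have us: "u \<subseteq> unit_disc" using T(3)[OF u(1)] openin_subset by fastforce
  have "inj_on p u"
    using T(4)[OF u(1)] us by (simp add: homeomorphic_map_def Int_absorb1)
  then have "inj_on p (u \<inter> unit_disc)" using inj_on_subset by blast
  moreover have "open u" using T(3)[OF u(1)] openin_open_trans open_ball by blast
  ultimately show ?thesis using u by blast
qed

text \<open>The form in which \<open>disc_lift\<close> takes a covering: \<open>f\<close> maps a
  ball about \<open>b\<close> into an evenly covered set, and the inverse of \<open>p\<close> on the
  sheet through \<open>x\<close> gives the section.\<close>

lemma covering_local_lift:
  assumes p: "is_covering_map (top_of_set unit_disc) Y p" and f: "continuous_map (top_of_set unit_disc) Y f"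
    and b: "b \<in> unit_disc"
  shows "\<exists>\<epsilon>>0. \<forall>t\<in>ball b \<epsilon> \<inter> unit_disc. \<forall>x\<in>unit_disc. p x = f t \<longrightarrow>
      (\<exists>h. (continuous_on (ball b \<epsilon> \<inter> unit_disc) h \<and>
         (\<forall>u\<in>ball b \<epsilon> \<inter> unit_disc. h u \<in> unit_disc \<and> p (h u) = f u)) \<and> h t = x)"
proof -
  have "f b \<in> topspace Y" using f b by (auto simp: continuous_map_def)
  then obtain T \<V> where T: "f b \<in> T" "openin Y T" "\<Union>\<V> = {x \<in> unit_disc. p x \<in> T}"
    "\<And>u. u \<in> \<V> \<Longrightarrow> openin (top_of_set unit_disc) u"
    "\<And>u. u \<in> \<V> \<Longrightarrow> homeomorphic_map (subtopology (top_of_set unit_disc) u) (subtopology Y T) p"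
    by (rule is_covering_mapE[OF p, unfolded topspace_euclidean_subtopology]) (rule that)
  have "openin (top_of_set unit_disc) {s \<in> unit_disc. f s \<in> T}"
    using openin_continuous_map_preimage[OF f T(2)] by simp
  then have "open {s \<in> unit_disc. f s \<in> T}" using openin_open_trans open_ball by blast
  then obtain \<epsilon> where \<epsilon>: "\<epsilon> > 0" "ball b \<epsilon> \<subseteq> {s \<in> unit_disc. f s \<in> T}" using b T(1) openE by blast
  show ?thesis
  proof (intro exI[of _ \<epsilon>] conjI ballI impI)
    fix t x assume t: "t \<in> ball b \<epsilon> \<inter> unit_disc" and x: "x \<in> unit_disc" "p x = f t"
    have "p x \<in> T" using \<epsilon> t x by auto
    then obtain u where u: "u \<in> \<V>" "x \<in> u" using x T(3) by blast
    have us: "u \<subseteq> unit_disc" using T(4)[OF u(1)] openin_subset by fastforce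
    obtain q where q: "homeomorphic_maps (subtopology (top_of_set unit_disc) u) (subtopology Y T) p q"
      using T(5)[OF u(1)] homeomorphic_map_maps by blast
    have topT: "topspace (subtopology Y T) = T" using T(2) openin_subset by (fastforce simp: topspace_subtopology)
    have topu: "topspace (subtopology (top_of_set unit_disc) u) = u" using us by auto
    have qu: "q y \<in> u" "p (q y) = y" if "y \<in> T" for y
      using q that unfolding homeomorphic_maps_def continuous_map_def topT topu by auto
    have qp: "q (p s) = s" if "s \<in> u" for s
      using q that unfolding homeomorphic_maps_def topu by auto
    have "continuous_map (top_of_set (ball b \<epsilon> \<inter> unit_disc)) (subtopology Y T) f"
      unfolding continuous_map_in_subtopology
    proof
      have "continuous_map (subtopology (top_of_set unit_disc) (ball b \<epsilon> \<inter> unit_disc)) Y f"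
        using f continuous_map_from_subtopology by blast
      then show "continuous_map (top_of_set (ball b \<epsilon> \<inter> unit_disc)) Y f"
        by (simp add: subtopology_subtopology Int_absorb1 inf.commute Int_absorb2)
    qed (use \<epsilon> in auto)
    then have "continuous_map (top_of_set (ball b \<epsilon> \<inter> unit_disc)) (subtopology (top_of_set unit_disc) u) (q \<circ> f)"
      by (rule continuous_map_compose) (use q in \<open>simp add: homeomorphic_maps_def\<close>)
    then have "continuous_map (top_of_set (ball b \<epsilon> \<inter> unit_disc)) euclidean (q \<circ> f)"
      by (simp add: continuous_map_in_subtopology)
    then have "continuous_on (ball b \<epsilon> \<inter> unit_disc) (q \<circ> f)" by simp
    moreover have "(q \<circ> f) t = x" using qp u x by (metis comp_apply)
    moreover have "(q \<circ> f) s \<in> unit_disc" "p ((q \<circ> f) s) = f s" if "s \<in> ball b \<epsilon> \<inter> unit_disc" for s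
    proof -
      have "f s \<in> T" using \<epsilon> that by auto
      then show "(q \<circ> f) s \<in> unit_disc" "p ((q \<circ> f) s) = f s" using qu[of "f s"] us by (auto simp del: mem_ball)
    qed
    ultimately show "\<exists>h. (continuous_on (ball b \<epsilon> \<inter> unit_disc) h \<and>
         (\<forall>u\<in>ball b \<epsilon> \<inter> unit_disc. h u \<in> unit_disc \<and> p (h u) = f u)) \<and> h t = x" by blast
  qed (use \<epsilon> in simp)
qed

text \<open>Used with an automorphism of the disc, so that a uniformization takes a prescribed value
  at 0.\<close>

lemma covering_precompose:
  assumes p: "is_covering_map X Y p" and m: "homeomorphic_maps X' X m n"
  shows "is_covering_map X' Y (p \<circ> m)"
  unfolding is_covering_map_def
proof (intro conjI ballI)
  have mc: "continuous_map X' X m" "continuous_map X X' n"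
    and mn: "\<And>x. x \<in> topspace X' \<Longrightarrow> n (m x) = x" "\<And>x. x \<in> topspace X \<Longrightarrow> m (n x) = x"
    using m by (auto simp: homeomorphic_maps_def)
  have mX: "m ` topspace X' = topspace X"
    using m homeomorphic_imp_surjective_map homeomorphic_maps_map by blast
  show "continuous_map X' Y (p \<circ> m)"
    using continuous_map_compose[OF mc(1), of Y p] p unfolding is_covering_map_def by blast
  show "(p \<circ> m) ` topspace X' = topspace Y"
    using p mX by (metis image_comp is_covering_map_def)
  fix y assume "y \<in> topspace Y"
  then obtain T \<V> where T: "y \<in> T" "openin Y T" "\<Union>\<V> = {x \<in> topspace X. p x \<in> T}"
    "\<And>u. u \<in> \<V> \<Longrightarrow> openin X u" "pairwise disjnt \<V>"
    "\<And>u. u \<in> \<V> \<Longrightarrow> homeomorphic_map (subtopology X u) (subtopology Y T) p"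
    by (rule is_covering_mapE[OF p]) (rule that)
  define w where "w u = {x \<in> topspace X'. m x \<in> u}" for u
  have "\<Union>(w ` \<V>) = {x \<in> topspace X'. (p \<circ> m) x \<in> T}"
  proof
    show "\<Union>(w ` \<V>) \<subseteq> {x \<in> topspace X'. (p \<circ> m) x \<in> T}" using T(3) by (auto simp: w_def)
    show "{x \<in> topspace X'. (p \<circ> m) x \<in> T} \<subseteq> \<Union>(w ` \<V>)"
    proof
      fix x assume x: "x \<in> {x \<in> topspace X'. (p \<circ> m) x \<in> T}"
      then have "m x \<in> \<Union>\<V>" unfolding T(3) using mX by auto
      then show "x \<in> \<Union>(w ` \<V>)" using x by (auto simp: w_def)
    qed
  qed
  moreover have "\<forall>v\<in>w ` \<V>. openin X' v"
    using openin_continuous_map_preimage[OF mc(1)] T(4) by (auto simp: w_def)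
  moreover have "pairwise disjnt (w ` \<V>)"
  proof (rule pairwiseI)
    fix v v' assume v: "v \<in> w ` \<V>" "v' \<in> w ` \<V>" "v \<noteq> v'"
    then obtain u u' where "u \<in> \<V>" "u' \<in> \<V>" "v = w u" "v' = w u'" "u \<noteq> u'" by blast
    moreover then have "disjnt u u'" using T(5) by (simp add: pairwise_def)
    ultimately show "disjnt v v'" by (auto simp: w_def disjnt_def)
  qed
  moreover have "\<forall>v\<in>w ` \<V>. homeomorphic_map (subtopology X' v) (subtopology Y T) (p \<circ> m)"
  proof
    fix v assume "v \<in> w ` \<V>"
    then obtain u where u: "u \<in> \<V>" "v = w u" by blast
    have "homeomorphic_map (subtopology X' v) (subtopology X u) m"
    proof (rule homeomorphic_map_subtopologies)
      show "homeomorphic_map X' X m" using m homeomorphic_maps_map by blast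
      show "m ` (topspace X' \<inter> v) = topspace X \<inter> u" using mX u(2) by (auto simp: w_def)
    qed
    then show "homeomorphic_map (subtopology X' v) (subtopology Y T) (p \<circ> m)"
      using T(6)[OF u(1)] homeomorphic_map_compose by blast
  qed
  ultimately show "\<exists>T. y \<in> T \<and> openin Y T \<and> (\<exists>\<V>. \<Union> \<V> = {x \<in> topspace X'. (p \<circ> m) x \<in> T} \<and>
      (\<forall>u\<in>\<V>. openin X' u) \<and> pairwise disjnt \<V> \<and>
      (\<forall>u\<in>\<V>. homeomorphic_map (subtopology X' u) (subtopology Y T) (p \<circ> m)))"
    using T(1,2) by (intro exI[of _ T] conjI exI[of _ "w ` \<V>"])
qed

section \<open>The modulus of uniformization\<close>

context foliated
begin

lemma hol_curve_compose:
  assumes \<gamma>: "hol_curve S \<gamma>" "open S" and \<phi>: "\<phi> holomorphic_on T" "open T" "\<phi> ` T \<subseteq> S"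
  shows "hol_curve T (\<lambda>t. \<gamma> (\<phi> t))"
  unfolding hol_curve_def
proof (intro conjI ballI allI)
  have c\<phi>: "continuous_on T \<phi>" using \<phi>(1) by (rule holomorphic_on_imp_continuous_on)
  show "continuous_on T (\<lambda>t. \<gamma> (\<phi> t))"
    using \<gamma>(1) \<phi>(3) by (intro continuous_on_compose2[OF _ c\<phi>]) (auto simp: hol_curve_def)
  fix c i assume c: "c \<in> A"
  have "(\<lambda>t. snd c (\<gamma> t) $ i) holomorphic_on {t \<in> S. \<gamma> t \<in> fst c}"
    using \<gamma>(1) c by (simp add: hol_curve_def)
  moreover have "\<phi> holomorphic_on {t \<in> T. \<gamma> (\<phi> t) \<in> fst c}"
    using \<phi>(1) by (rule holomorphic_on_subset) auto
  ultimately have "((\<lambda>t. snd c (\<gamma> t) $ i) \<circ> \<phi>) holomorphic_on {t \<in> T. \<gamma> (\<phi> t) \<in> fst c}"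
    using \<phi>(3) by (intro holomorphic_on_compose_gen[where t = "{t \<in> S. \<gamma> t \<in> fst c}"]) auto
  then show "(\<lambda>t. snd c (\<gamma> (\<phi> t)) $ i) holomorphic_on {t \<in> T. \<gamma> (\<phi> t) \<in> fst c}"
    by (simp add: o_def)
qed

lemma velocity_compose:
  assumes \<gamma>: "hol_curve S \<gamma>" "open S" and \<phi>: "\<phi> holomorphic_on T" "open T" "\<phi> ` T \<subseteq> S"
    and t: "t \<in> T" "c \<in> A" "\<gamma> (\<phi> t) \<in> fst c" and f: "\<And>s. s \<in> T \<Longrightarrow> f s = \<gamma> (\<phi> s)"
  shows "velocity c f t = deriv \<phi> t *s velocity c \<gamma> (\<phi> t)"
proof -
  have "velocity c f t $ i = deriv \<phi> t * velocity c \<gamma> (\<phi> t) $ i" for i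
  proof -
    have "((\<lambda>s. snd c (\<gamma> s) $ i) has_field_derivative velocity c \<gamma> (\<phi> t) $ i) (at (\<phi> t))"
      using t \<phi>(3) by (intro hol_curve_velocity[OF \<gamma>]) auto
    moreover have "(\<phi> has_field_derivative deriv \<phi> t) (at t)"
      using \<phi> t holomorphic_derivI by blast
    ultimately have "((\<lambda>s. snd c (\<gamma> (\<phi> s)) $ i) has_field_derivative velocity c \<gamma> (\<phi> t) $ i * deriv \<phi> t) (at t)"
      by (rule DERIV_chain2)
    then have "((\<lambda>s. snd c (f s) $ i) has_field_derivative velocity c \<gamma> (\<phi> t) $ i * deriv \<phi> t) (at t)"
      by (rule has_field_derivative_transform_within_open[OF _ \<phi>(2) t(1)]) (simp add: f)
    then show ?thesis unfolding velocity_def by (simp add: DERIV_imp_deriv mult.commute)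
  qed
  then show ?thesis by (simp add: vec_eq_iff)
qed

lemma leafwise_compose:
  assumes \<gamma>: "leafwise S \<gamma>" "open S" and \<phi>: "\<phi> holomorphic_on T" "open T" "\<phi> ` T \<subseteq> S"
  shows "leafwise T (\<lambda>t. \<gamma> (\<phi> t))"
  unfolding leafwise_def
proof (intro conjI ballI)
  show "hol_curve T (\<lambda>t. \<gamma> (\<phi> t))"
    by (rule hol_curve_compose[OF leafwise_hol_curve[OF \<gamma>(1)] \<gamma>(2) \<phi>])
  fix t assume t: "t \<in> T"
  then have "\<phi> t \<in> S" using \<phi> by blast
  then obtain c i where c: "fbox c i" "\<gamma> (\<phi> t) \<in> fst c" "\<forall>j. j \<noteq> i \<longrightarrow> velocity c \<gamma> (\<phi> t) $ j = 0"
    using \<gamma>(1) unfolding leafwise_def by blast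
  have "velocity c (\<lambda>t. \<gamma> (\<phi> t)) t = deriv \<phi> t *s velocity c \<gamma> (\<phi> t)"
    by (rule velocity_compose[OF leafwise_hol_curve[OF \<gamma>(1)] \<gamma>(2) \<phi> t fboxD(1)[OF c(1)] c(2) refl])
  with c(3) have "\<forall>j. j \<noteq> i \<longrightarrow> velocity c (\<lambda>t. \<gamma> (\<phi> t)) t $ j = 0" by simp
  with c(1,2) show "\<exists>c i. fbox c i \<and> \<gamma> (\<phi> t) \<in> fst c \<and> (\<forall>j. j \<noteq> i \<longrightarrow> velocity c (\<lambda>t. \<gamma> (\<phi> t)) t $ j = 0)"
    by blast
qed

text \<open>In a flow box the other components of the velocity of a leafwise map vanish, so for such
  a map this says that the derivative is nowhere zero.\<close>

definition immersed :: "(complex \<Rightarrow> 'a) \<Rightarrow> bool" where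
  "immersed \<alpha> \<longleftrightarrow> (\<forall>x\<in>unit_disc. \<forall>c i. fbox c i \<longrightarrow> \<alpha> x \<in> fst c \<longrightarrow> velocity c \<alpha> x $ i \<noteq> 0)"

text \<open>In a plaque the \<open>i\<close>-th coordinate determines the point, which reduces
  questions about leafwise maps to one scalar holomorphic function.\<close>

lemma leafwise_component:
  assumes \<alpha>: "leafwise S \<alpha>" "open S" and c: "fbox c i" "x \<in> S" "\<alpha> x \<in> fst c"
  obtains r where "r > 0" "ball x r \<subseteq> S" "\<alpha> ` ball x r \<subseteq> plaque c i (\<alpha> x)"
    "(\<lambda>s. snd c (\<alpha> s) $ i) holomorphic_on ball x r"
    "\<And>s s'. s \<in> ball x r \<Longrightarrow> s' \<in> ball x r \<Longrightarrow> snd c (\<alpha> s) $ i = snd c (\<alpha> s') $ i \<Longrightarrow> \<alpha> s = \<alpha> s'"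
proof -
  obtain r where r: "r > 0" "ball x r \<subseteq> S" "\<alpha> ` ball x r \<subseteq> plaque c i (\<alpha> x)"
    using leafwise_local[OF \<alpha> c] by blast
  have "(\<lambda>s. snd c (\<alpha> s) $ i) holomorphic_on {s \<in> S. \<alpha> s \<in> fst c}"
    using leafwise_hol_curve[OF \<alpha>(1)] fboxD(1)[OF c(1)] by (simp add: hol_curve_def)
  then have "(\<lambda>s. snd c (\<alpha> s) $ i) holomorphic_on ball x r"
    by (rule holomorphic_on_subset) (use r in \<open>auto simp: plaque_def\<close>)
  moreover have "\<alpha> s = \<alpha> s'" if s: "s \<in> ball x r" "s' \<in> ball x r" "snd c (\<alpha> s) $ i = snd c (\<alpha> s') $ i" for s s'
  proof (rule chart_inj[OF fboxD(1)[OF c(1)]])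
    have p: "\<alpha> s \<in> plaque c i (\<alpha> x)" "\<alpha> s' \<in> plaque c i (\<alpha> x)" using s r by blast+
    then show "\<alpha> s \<in> fst c" "\<alpha> s' \<in> fst c" by (auto simp: plaque_def)
    have "snd c (\<alpha> s) $ j = snd c (\<alpha> s') $ j" for j
      by (cases "j = i") (use p s(3) in \<open>auto simp: plaque_def\<close>)
    then show "snd c (\<alpha> s) = snd c (\<alpha> s')" by (simp add: vec_eq_iff)
  qed
  ultimately show thesis using that[OF r] by blast
qed

text \<open>A covering is locally injective, hence so is its coordinate along the plaque, and an
  injective holomorphic function has nonzero derivative.\<close>

lemma uniformization_immersed:
  assumes u: "uniformization_of A E F L \<alpha>" and L: "L \<in> leafs"
  shows "immersed \<alpha>"
  unfolding immersed_def
proof (intro ballI allI impI)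
  fix x :: complex and c i assume x: "x \<in> unit_disc" and c: "fbox c i" "\<alpha> x \<in> fst c"
  obtain r where r: "r > 0" "ball x r \<subseteq> unit_disc"
    "(\<lambda>s. snd c (\<alpha> s) $ i) holomorphic_on ball x r"
    "\<And>s s'. s \<in> ball x r \<Longrightarrow> s' \<in> ball x r \<Longrightarrow> snd c (\<alpha> s) $ i = snd c (\<alpha> s') $ i \<Longrightarrow> \<alpha> s = \<alpha> s'"
    by (rule leafwise_component[OF uniformization_leafwise[OF u L] open_ball c(1) x c(2)]) (rule that)
  obtain w where w: "open w" "x \<in> w" "inj_on \<alpha> (w \<inter> unit_disc)"
    using covering_locally_injective[OF _ x] u unfolding uniformization_of_def by blast
  have "inj_on (\<lambda>s. snd c (\<alpha> s) $ i) (w \<inter> ball x r)"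
  proof (rule inj_onI)
    fix s s' assume s: "s \<in> w \<inter> ball x r" "s' \<in> w \<inter> ball x r" "snd c (\<alpha> s) $ i = snd c (\<alpha> s') $ i"
    then have "\<alpha> s = \<alpha> s'" using r(4) by blast
    moreover have "s \<in> w \<inter> unit_disc" "s' \<in> w \<inter> unit_disc" using s r(2) by blast+
    ultimately show "s = s'" using w(3) by (meson inj_onD)
  qed
  then have "deriv (\<lambda>s. snd c (\<alpha> s) $ i) x \<noteq> 0"
    using w r by (intro holomorphic_injective_imp_regular[of _ "w \<inter> ball x r"])
      (auto intro: holomorphic_on_subset)
  then show "velocity c \<alpha> x $ i \<noteq> 0" by (simp add: velocity_def)
qed

lemma immersed_chart:
  assumes \<alpha>: "leafwise unit_disc \<alpha>" "immersed \<alpha>" and x: "x \<in> unit_disc" and c: "fbox c i" "\<alpha> x \<in> fst c"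
  obtains r where "r > 0" "ball x r \<subseteq> unit_disc" "\<alpha> ` ball x r \<subseteq> plaque c i (\<alpha> x)"
    "(\<lambda>s. snd c (\<alpha> s) $ i) holomorphic_on ball x r" "inj_on (\<lambda>s. snd c (\<alpha> s) $ i) (ball x r)"
proof -
  obtain r where r: "r > 0" "ball x r \<subseteq> unit_disc" "\<alpha> ` ball x r \<subseteq> plaque c i (\<alpha> x)"
    "(\<lambda>s. snd c (\<alpha> s) $ i) holomorphic_on ball x r"
    by (rule leafwise_component[OF \<alpha>(1) open_ball c(1) x c(2)]) (rule that)
  have "deriv (\<lambda>s. snd c (\<alpha> s) $ i) x \<noteq> 0"
    using \<alpha>(2)[unfolded immersed_def, rule_format, OF x c] by (simp add: velocity_def)
  then obtain r' where "r' > 0" "ball x r' \<subseteq> ball x r" "inj_on (\<lambda>s. snd c (\<alpha> s) $ i) (ball x r')"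
    using has_complex_derivative_locally_injective[OF r(4) _ open_ball] r(1) by (metis centre_in_ball)
  then show thesis using r by (intro that[of r']) (auto intro: holomorphic_on_subset)
qed

lemma immersed_locally_injective:
  assumes \<alpha>: "leafwise unit_disc \<alpha>" "immersed \<alpha>" and x: "x \<in> unit_disc"
  shows "\<exists>u. open u \<and> x \<in> u \<and> inj_on \<alpha> (u \<inter> unit_disc)"
proof -
  obtain c i where c: "fbox c i" "\<alpha> x \<in> fst c"
    using flow_box_exists[OF leafwise_notin_E[OF \<alpha>(1) x]] by blast
  obtain r where r: "r > 0" "ball x r \<subseteq> unit_disc" "inj_on (\<lambda>s. snd c (\<alpha> s) $ i) (ball x r)"
    by (rule immersed_chart[OF \<alpha> x c]) (rule that)
  have "inj_on \<alpha> (ball x r)" by (rule inj_onI) (metis r(3) inj_onD)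
  then show ?thesis using r by (intro exI[of _ "ball x r"]) (auto intro: inj_on_subset)
qed

text \<open>Near each parameter the lift is the coordinate of \<open>f\<close> along the plaque
  followed by the holomorphic inverse of the coordinate of \<open>\<alpha>\<close>.\<close>

lemma lift_holomorphic:
  assumes \<alpha>: "leafwise unit_disc \<alpha>" "immersed \<alpha>" and f: "hol_curve unit_disc f"
    and G: "continuous_on unit_disc G" "\<And>t. t \<in> unit_disc \<Longrightarrow> G t \<in> unit_disc \<and> \<alpha> (G t) = f t"
  shows "G holomorphic_on unit_disc"
  unfolding holomorphic_on_def
proof
  fix t :: complex assume t: "t \<in> unit_disc"
  have x: "G t \<in> unit_disc" using G(2) t by blast
  obtain c i where c: "fbox c i" "\<alpha> (G t) \<in> fst c"
    using flow_box_exists[OF leafwise_notin_E[OF \<alpha>(1) x]] by blast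
  obtain r where r: "r > 0" "ball (G t) r \<subseteq> unit_disc" "\<alpha> ` ball (G t) r \<subseteq> plaque c i (\<alpha> (G t))"
    "(\<lambda>s. snd c (\<alpha> s) $ i) holomorphic_on ball (G t) r" "inj_on (\<lambda>s. snd c (\<alpha> s) $ i) (ball (G t) r)"
    by (rule immersed_chart[OF \<alpha> x c]) (rule that)
  obtain g where g: "g holomorphic_on (\<lambda>s. snd c (\<alpha> s) $ i) ` ball (G t) r"
    "\<And>z. z \<in> ball (G t) r \<Longrightarrow> g (snd c (\<alpha> z) $ i) = z"
    using holomorphic_has_inverse[OF r(4) open_ball r(5)] by metis
  define N where "N = unit_disc \<inter> G -` ball (G t) r"
  have N: "open N" "t \<in> N"
    unfolding N_def using continuous_open_preimage[OF G(1) open_ball open_ball] t r by auto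
  have Nf: "f s = \<alpha> (G s)" "G s \<in> ball (G t) r" "s \<in> unit_disc" if "s \<in> N" for s
    using that G(2) by (auto simp: N_def)
  have fc: "f s \<in> fst c" if "s \<in> N" for s
  proof -
    have "\<alpha> (G s) \<in> plaque c i (\<alpha> (G t))" using Nf(2)[OF that] r(3) by blast
    then show ?thesis using Nf(1)[OF that] by (simp add: plaque_def)
  qed
  have "(\<lambda>s. snd c (f s) $ i) holomorphic_on {s \<in> unit_disc. f s \<in> fst c}"
    using f fboxD(1)[OF c(1)] by (simp add: hol_curve_def)
  then have "(\<lambda>s. snd c (f s) $ i) holomorphic_on N"
    by (rule holomorphic_on_subset) (use fc Nf in auto)
  then have "(g \<circ> (\<lambda>s. snd c (f s) $ i)) holomorphic_on N"
    using g(1) by (rule holomorphic_on_compose_gen) (use Nf in auto)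
  then have "G holomorphic_on N"
    by (rule holomorphic_transform) (use Nf g(2) in auto)
  then show "G field_differentiable at t within unit_disc"
    using N holomorphic_on_imp_differentiable_at field_differentiable_at_within by blast
qed

section \<open>Lengths of velocities and the modulus\<close>

lemma metric_length_scale: "metric_length g c p (k *s v) = cmod k * metric_length g c p v"
proof -
  have "sesq_form (g c p) (k *s v) (k *s v) = (k * cnj k) * sesq_form (g c p) v v"
    by (simp add: sesq_form_def sum_distrib_left mult_ac)
  also have "k * cnj k = of_real ((cmod k)\<^sup>2)" using complex_norm_square[of k] by simp
  finally have "Re (sesq_form (g c p) (k *s v) (k *s v)) = (cmod k)\<^sup>2 * Re (sesq_form (g c p) v v)"
    by simp
  then show ?thesis by (simp add: metric_length_def real_sqrt_mult)
qed

lemma metric_length_nonneg: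
  assumes "hermitian_metric A g" "c \<in> A" "p \<in> fst c" shows "metric_length g c p v \<ge> 0"
proof (cases "v = 0")
  case True
  then show ?thesis by (simp add: metric_length_def sesq_form_def)
next
  case False
  then have "0 < Re (sesq_form (g c p) v v)" using assms by (simp add: hermitian_metric_def)
  then show ?thesis by (simp add: metric_length_def)
qed

lemma metric_length_velocity:
  assumes "hermitian_metric A g" "hol_curve S f" "open S" "t \<in> S" "c \<in> A" "d \<in> A" "f t \<in> fst c" "f t \<in> fst d"
  shows "metric_length g d (f t) (velocity d f t) = metric_length g c (f t) (velocity c f t)"
proof -
  have "\<forall>c\<in>A. \<forall>d\<in>A. \<forall>p \<in> fst c \<inter> fst d. \<forall>v w.
        sesq_form (g d p) (jacobian c d p v) (jacobian c d p w) = sesq_form (g c p) v w"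
    using assms(1) by (simp add: hermitian_metric_def)
  then show ?thesis
    using velocity_transform[OF assms(2,3,5,6,4,7,8)] assms by (simp add: metric_length_def)
qed

lemma uniformization_lift:
  assumes u: "uniformization_of A E F L \<alpha>" "L \<in> leafs" and f: "leafwise unit_disc f" "f ` unit_disc \<subseteq> L"
    and x0: "x0 \<in> unit_disc" "\<alpha> x0 = f 0"
  obtains \<phi> where "\<phi> holomorphic_on unit_disc" "\<phi> 0 = x0"
    "\<And>t. t \<in> unit_disc \<Longrightarrow> \<phi> t \<in> unit_disc \<and> \<alpha> (\<phi> t) = f t"
proof -
  have cov: "is_covering_map (top_of_set unit_disc) (subtopology leaftop L) \<alpha>"
    using u by (simp add: uniformization_of_def)
  have fc: "continuous_map (top_of_set unit_disc) (subtopology leaftop L) f"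
    using leafwise_continuous[OF f(1) open_ball] f(2) by (simp add: continuous_map_in_subtopology image_subset_iff)
  obtain G where G: "continuous_on unit_disc G \<and> (\<forall>u\<in>unit_disc. G u \<in> unit_disc \<and> \<alpha> (G u) = f u)" "G 0 = x0"
    by (rule disc_lift[OF covering_locally_injective[OF cov] covering_local_lift[OF cov fc] x0])
  then show thesis
    using lift_holomorphic[OF uniformization_leafwise[OF u] uniformization_immersed[OF u] leafwise_hol_curve[OF f(1)]] that
    by blast
qed

text \<open>Schwarz's lemma bounds the derivative of \<open>\<phi>\<close> at 0, and
  \<open>f\<close> is \<open>\<alpha>\<close> after \<open>\<phi>\<close>. It is used with a
  uniformization and with a limit of uniformizations in the role of \<open>\<alpha>\<close>.\<close>

lemma lift_velocity_le:
  assumes g: "hermitian_metric A g" and \<alpha>: "hol_curve unit_disc \<alpha>" and c: "c \<in> A" "\<alpha> 0 \<in> fst c"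
    and \<phi>: "\<phi> holomorphic_on unit_disc" "\<phi> 0 = 0" "\<And>t. t \<in> unit_disc \<Longrightarrow> \<phi> t \<in> unit_disc \<and> \<alpha> (\<phi> t) = f t"
  shows "metric_length g c (\<alpha> 0) (velocity c f 0) \<le> metric_length g c (\<alpha> 0) (velocity c \<alpha> 0)"
proof -
  have "velocity c f 0 = deriv \<phi> 0 *s velocity c \<alpha> (\<phi> 0)"
    by (rule velocity_compose[OF \<alpha> open_ball \<phi>(1) open_ball]) (use \<phi> c in auto)
  moreover have "cmod (deriv \<phi> 0) \<le> 1"
    by (rule Schwarz_Lemma(2)[where \<xi> = 0, OF \<phi>(1,2)]) (use \<phi>(3) in auto)
  ultimately show ?thesis
    using metric_length_nonneg[OF g c] \<phi>(2)
    by (simp add: metric_length_scale mult_left_le_one_le)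
qed

lemma modulus_eq:
  assumes h: "hyperbolic_foliation A E F" and g: "hermitian_metric A g" and L: "L \<in> leafs"
    and u: "uniformization_of A E F L \<alpha>" and p: "\<alpha> 0 = p" and c: "c \<in> A" "p \<in> fst c"
  shows "modulus_of_uniformization A E F g p = metric_length g c p (velocity c \<alpha> 0)"
  unfolding modulus_of_uniformization_def
\<comment> \<open>The supremum is a maximum, attained at \<open>\<alpha>\<close>; this also disposes
  of boundedness, on which the real \<open>Sup\<close> depends.\<close>
proof (rule cSup_eq_maximum)
  have im: "\<alpha> ` unit_disc = L" by (rule uniformization_image[OF u L])
  have hc: "hol_curve unit_disc \<alpha>" using u by (simp add: uniformization_of_def holomorphic_disc_hol_curve)
  have "\<alpha> \<in> leaf_discs A E F" using u L im by (auto simp: leaf_discs_def uniformization_of_def)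
  then show "metric_length g c p (velocity c \<alpha> 0) \<in> {metric_length g c p (velocity c f 0) | f c.
            f \<in> leaf_discs A E F \<and> f 0 = p \<and> c \<in> A \<and> p \<in> fst c}" using c p by blast
  fix x assume "x \<in> {metric_length g c p (velocity c f 0) | f c.
            f \<in> leaf_discs A E F \<and> f 0 = p \<and> c \<in> A \<and> p \<in> fst c}"
  then obtain f d where f: "f \<in> leaf_discs A E F" "f 0 = p" "d \<in> A" "p \<in> fst d"
    "x = metric_length g d p (velocity d f 0)" by blast
  have lf: "leafwise unit_disc f" by (rule leaf_disc_leafwise[OF h f(1)])
  have "p \<in> L" using im p by force
  then have fL: "f ` unit_disc \<subseteq> L"
    using leafwise_in_leaf[OF lf open_ball connected_ball _ L, of 0] f(2) by simp
  obtain \<phi> where \<phi>: "\<phi> holomorphic_on unit_disc" "\<phi> 0 = 0"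
    "\<And>t. t \<in> unit_disc \<Longrightarrow> \<phi> t \<in> unit_disc \<and> \<alpha> (\<phi> t) = f t"
    by (rule uniformization_lift[OF u L lf fL, of 0]) (use p f(2) in auto)
  have "x = metric_length g c p (velocity c f 0)"
    using metric_length_velocity[OF g leafwise_hol_curve[OF lf] open_ball, of 0 c d] f c by simp
  also have "\<dots> \<le> metric_length g c p (velocity c \<alpha> 0)"
    using lift_velocity_le[OF g hc c(1) _ \<phi>] c p by simp
  finally show "x \<le> metric_length g c p (velocity c \<alpha> 0)" .
qed

lemma centered_uniformization:
  assumes h: "hyperbolic_foliation A E F" and p: "p \<notin> E"
  obtains L \<alpha> where "L \<in> leafs" "p \<in> L" "uniformization_of A E F L \<alpha>" "\<alpha> 0 = p"
proof -
  obtain L where L: "L \<in> leafs" "p \<in> L" by (rule leaf_exists[OF p])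
  obtain \<alpha> where u: "uniformization_of A E F L \<alpha>" using h L by (auto simp: hyperbolic_foliation_def)
  obtain a where a: "a \<in> unit_disc" "\<alpha> a = p" using uniformization_image[OF u L(1)] L(2) by blast
  \<comment> \<open>\<open>m\<close> is an automorphism of the disc that moves \<open>a\<close> to 0
    and \<open>n\<close> its inverse; \<open>n\<close> reparametrizes
    \<open>\<alpha>\<close>.\<close>
  obtain m n where mn: "m a = 0" "m holomorphic_on ball 0 1" "m ` ball 0 1 \<subseteq> ball 0 1"
    "n holomorphic_on ball 0 1" "n ` ball 0 1 \<subseteq> ball 0 1"
    "\<And>z. z \<in> ball 0 1 \<Longrightarrow> m (n z) = z" "\<And>z. z \<in> ball 0 1 \<Longrightarrow> n (m z) = z"
    by (rule ball_biholomorphism_exists[OF a(1)]) (rule that)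
  have "homeomorphic_maps (top_of_set unit_disc) (top_of_set unit_disc) n m"
    using mn by (auto simp: homeomorphic_maps_def intro!: holomorphic_on_imp_continuous_on)
  then have "is_covering_map (top_of_set unit_disc) (subtopology leaftop L) (\<alpha> \<circ> n)"
    using u covering_precompose unfolding uniformization_of_def by blast
  moreover have "holomorphic_disc A (\<alpha> \<circ> n)"
    using hol_curve_compose[OF _ open_ball mn(4) open_ball mn(5), of \<alpha>] u
    by (simp add: holomorphic_disc_hol_curve uniformization_of_def o_def)
  ultimately have "uniformization_of A E F L (\<alpha> \<circ> n)" by (simp add: uniformization_of_def)
  moreover have "(\<alpha> \<circ> n) 0 = p" using mn(7)[OF a(1)] mn(1) a(2) by simp
  ultimately show thesis using that L by blast
qed

end

section \<open>Images of holomorphic discs are analytic\<close>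

text \<open>If \<open>f\<close> takes the value \<open>f \<xi>\<close> at \<open>\<xi>\<close> with
  order \<open>n\<close>, the difference is the \<open>n\<close>-th power of a local coordinate
  \<open>h\<close>, and \<open>\<tau>\<close> is the inverse of \<open>h\<close>. This gives a curve
  a parameter in which one coordinate is a power up to a constant.\<close>

lemma local_power_coordinate:
  assumes f: "f holomorphic_on ball \<xi> \<epsilon>" and e: "\<epsilon> > 0" and nc: "\<not> f constant_on ball \<xi> \<epsilon>"
  obtains n \<tau> \<rho> where "n > (0::nat)" "\<rho> > 0" "\<tau> holomorphic_on ball 0 \<rho>" "\<tau> 0 = \<xi>"
    "\<tau> ` ball 0 \<rho> \<subseteq> ball \<xi> \<epsilon>" "\<And>s. s \<in> ball 0 \<rho> \<Longrightarrow> f (\<tau> s) = f \<xi> + s ^ n"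
proof -
  have xi: "\<xi> \<in> ball \<xi> \<epsilon>" using e by simp
  have "\<exists>n>0. (deriv ^^ n) f \<xi> \<noteq> 0"
  proof (rule ccontr)
    assume "\<not> ?thesis"
    then have "f w = f \<xi>" if "w \<in> ball \<xi> \<epsilon>" for w
      using holomorphic_fun_eq_const_on_connected[OF f open_ball connected_ball _ xi that] by blast
    then show False using nc by (auto simp: constant_on_def)
  qed
  then obtain n0 where n0: "n0 > 0 \<and> (deriv ^^ n0) f \<xi> \<noteq> 0" by blast
  define n where "n = (LEAST n. n > 0 \<and> (deriv ^^ n) f \<xi> \<noteq> 0)"
  have n: "n > 0" "(deriv ^^ n) f \<xi> \<noteq> 0" unfolding n_def using LeastI[of "\<lambda>n. n > 0 \<and> (deriv ^^ n) f \<xi> \<noteq> 0", OF n0] by auto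
  have nmin: "(deriv ^^ i) f \<xi> = 0" if "0 < i" "i < n" for i
    using not_less_Least[of i "\<lambda>n. n > 0 \<and> (deriv ^^ n) f \<xi> \<noteq> 0"] that by (auto simp: n_def)
  obtain g r where g: "0 < r" "g holomorphic_on ball \<xi> r"
    "\<And>w. w \<in> ball \<xi> r \<Longrightarrow> f w - f \<xi> = ((w - \<xi>) * g w) ^ n" "\<And>w. w \<in> ball \<xi> r \<Longrightarrow> g w \<noteq> 0"
    by (rule holomorphic_factor_order_of_zero_strong[OF f open_ball xi n nmin]) (auto intro: that)
  define h where "h w = (w - \<xi>) * g w" for w
  define r1 where "r1 = min r \<epsilon>"
  have r1: "r1 > 0" "ball \<xi> r1 \<subseteq> ball \<xi> r" "ball \<xi> r1 \<subseteq> ball \<xi> \<epsilon>" using g(1) e by (auto simp: r1_def)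
  have hh: "h holomorphic_on ball \<xi> r1"
    unfolding h_def using holomorphic_on_subset[OF g(2) r1(2)] by (intro holomorphic_intros)
  have "(g has_field_derivative deriv g \<xi>) (at \<xi>)"
    by (rule holomorphic_derivI[OF g(2) open_ball]) (use g(1) in simp)
  then have "(h has_field_derivative g \<xi>) (at \<xi>)"
    unfolding h_def by (auto intro!: derivative_eq_intros)
  then have "deriv h \<xi> \<noteq> 0" using DERIV_imp_deriv g(1,4) by fastforce
  then obtain r2 where r2: "r2 > 0" "ball \<xi> r2 \<subseteq> ball \<xi> r1" "inj_on h (ball \<xi> r2)"
    using has_complex_derivative_locally_injective[OF hh _ open_ball] r1(1) by (metis centre_in_ball)
  have h2: "h holomorphic_on ball \<xi> r2" by (rule holomorphic_on_subset[OF hh r2(2)])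
  obtain \<tau> where \<tau>: "\<tau> holomorphic_on h ` ball \<xi> r2" "\<And>z. z \<in> ball \<xi> r2 \<Longrightarrow> \<tau> (h z) = z"
    using holomorphic_has_inverse[OF h2 open_ball r2(3)] by metis
  have "open (h ` ball \<xi> r2)" by (rule open_mapping_thm3[OF h2 open_ball r2(3)])
  moreover have "0 \<in> h ` ball \<xi> r2" using r2(1) by (intro image_eqI[of _ _ \<xi>]) (auto simp: h_def)
  ultimately obtain \<rho> where \<rho>: "\<rho> > 0" "ball 0 \<rho> \<subseteq> h ` ball \<xi> r2" using openE by blast
  have st: "\<tau> s \<in> ball \<xi> r2" "h (\<tau> s) = s" if "s \<in> ball 0 \<rho>" for s
    using \<rho>(2) \<tau>(2) that by (auto simp: subset_iff image_iff)
  show thesis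
  proof (rule that[OF n(1) \<rho>(1)])
    show "\<tau> holomorphic_on ball 0 \<rho>" by (rule holomorphic_on_subset[OF \<tau>(1) \<rho>(2)])
    show "\<tau> 0 = \<xi>" using \<tau>(2)[of \<xi>] r2(1) by (simp add: h_def)
    show "\<tau> ` ball 0 \<rho> \<subseteq> ball \<xi> \<epsilon>" using st r2(2) r1(3) by blast
    show "f (\<tau> s) = f \<xi> + s ^ n" if "s \<in> ball 0 \<rho>" for s
    proof -
      have "\<tau> s \<in> ball \<xi> r" using st(1)[OF that] r2(2) r1(2) by blast
      then have "f (\<tau> s) - f \<xi> = h (\<tau> s) ^ n" using g(3) by (simp only: h_def)
      then show ?thesis using st(2)[OF that] by (simp add: algebra_simps)
    qed
  qed
qed

section \<open>Descent through the power map\<close>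

lemma complex_root_exists:
  assumes "k > 0" obtains s :: complex where "s ^ k = z"
proof (cases "z = 0")
  case True
  then show thesis using that[of 0] assms by simp
next
  case False
  have "exp (Ln z / of_nat k) ^ k = z"
    using False assms by (simp add: exp_of_nat_mult[symmetric])
  then show thesis using that by blast
qed

text \<open>\<open>b\<close> is \<open>a\<close> at any \<open>k\<close>-th root, well defined by
  invariance. Off 0 it is holomorphic because a local branch of the root exists; at 0 it is
  continuous, so the singularity is removable.\<close>

lemma roots_of_unity_invariant:
  fixes a :: "complex \<Rightarrow> complex"
  assumes k: "k > 0" and a: "a holomorphic_on ball 0 \<rho>"
    and inv: "\<And>\<omega> s. \<omega> ^ k = 1 \<Longrightarrow> s \<in> ball 0 \<rho> \<Longrightarrow> a (\<omega> * s) = a s"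
  obtains b where "b holomorphic_on ball 0 (\<rho> ^ k)" "\<And>s. s \<in> ball 0 \<rho> \<Longrightarrow> b (s ^ k) = a s"
proof (cases "\<rho> > 0")
  case False
  then have "ball (0::complex) \<rho> = {}" by simp
  have "\<exists>b. b holomorphic_on ball 0 (\<rho> ^ k) \<and> (\<forall>s\<in>ball 0 \<rho>. b (s ^ k) = a s)"
    unfolding \<open>ball 0 \<rho> = {}\<close> by (intro exI[of _ "\<lambda>_. 0"]) auto
  then show thesis using that by blast
next
  case \<rho>: True
  define rt where "rt z = (SOME s::complex. s ^ k = z)" for z
  have rt: "rt z ^ k = z" for z
  proof -
    have "\<exists>s::complex. s ^ k = z" using complex_root_exists[OF k] by blast
    then show ?thesis unfolding rt_def by (rule someI_ex)
  qed
  define b where "b z = a (rt z)" for z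
  have in_ball: "s \<in> ball 0 r" if "s ^ k \<in> ball 0 (r ^ k)" "r > 0" for s :: complex and r
    using that power_less_imp_less_base[of "cmod s" k r] by (simp add: norm_power)
  have bk: "b (s ^ k) = a s" if s: "s \<in> ball 0 \<rho>" for s
  proof (cases "s = 0")
    case True
    then have "rt (s ^ k) = 0" using rt[of "s ^ k"] k by (simp add: power_0_left)
    then show ?thesis using True by (simp add: b_def)
  next
    case False
    then have "(rt (s ^ k) / s) ^ k = 1" by (simp add: power_divide rt)
    then have "a (rt (s ^ k) / s * s) = a s" using inv s by blast
    then show ?thesis using False by (simp add: b_def)
  qed
  have diff: "\<exists>d. (b has_field_derivative d) (at z0)" if z0: "z0 \<in> ball 0 (\<rho> ^ k)" "z0 \<noteq> 0" for z0
  proof -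
    define s0 where "s0 = rt z0"
    have s0: "s0 ^ k = z0" by (simp add: s0_def rt)
    \<comment> \<open>A branch of the root near \<open>z0\<close> with value \<open>s0\<close>
      there; the logarithm is holomorphic since \<open>z / z0\<close> has positive real part on
      \<open>N\<close>.\<close>
    define r where "r z = s0 * exp (Ln (z / z0) / of_nat k)" for z
    define N where "N = ball 0 (\<rho> ^ k) \<inter> ball z0 (cmod z0)"
    have N: "open N" "z0 \<in> N" using z0 by (auto simp: N_def)
    have nz: "z / z0 \<notin> \<real>\<^sub>\<le>\<^sub>0" if "z \<in> N" for z
    proof -
      have "1 - z / z0 = (z0 - z) / z0" using z0 by (simp add: field_simps)
      then have "cmod (1 - z / z0) = cmod (z0 - z) / cmod z0" by (simp only: norm_divide)
      also have "\<dots> < 1" using that z0 by (simp add: N_def dist_norm)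
      finally have "Re (1 - z / z0) < 1" using complex_Re_le_cmod le_less_trans by blast
      then have "Re (z / z0) > 0" by simp
      then show ?thesis unfolding complex_nonpos_Reals_iff by linarith
    qed
    have rk: "r z ^ k = z" if "z \<in> N" for z
    proof -
      have "z / z0 \<noteq> 0" using nz[OF that] by auto
      then have "exp (Ln (z / z0) / of_nat k) ^ k = z / z0" using k by (simp add: exp_of_nat_mult[symmetric])
      then show ?thesis using z0 by (simp add: r_def power_mult_distrib s0)
    qed
    have rb: "r z \<in> ball 0 \<rho>" if "z \<in> N" for z
      using in_ball[of "r z" \<rho>] rk[OF that] that \<rho> by (simp add: N_def)
    have "r holomorphic_on N"
      unfolding r_def using nz z0 by (intro holomorphic_intros) auto
    then have "(a \<circ> r) holomorphic_on N"
      using a by (rule holomorphic_on_compose_gen) (use rb in blast)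
    then have "b holomorphic_on N"
      by (rule holomorphic_transform) (use bk rb rk in fastforce)
    then show ?thesis using N holomorphic_derivI by blast
  qed
  have cont0: "isCont b 0"
    unfolding continuous_at_eps_delta
  proof (intro allI impI)
    fix e :: real assume e: "e > 0"
    have "continuous_on (ball 0 \<rho>) a" using a by (rule holomorphic_on_imp_continuous_on)
    then have "isCont a 0" using \<rho> continuous_on_eq_continuous_at open_ball by (metis centre_in_ball)
    then obtain d where d: "d > 0" "\<And>s. dist s 0 < d \<Longrightarrow> dist (a s) (a 0) < e"
      using e unfolding continuous_at_eps_delta by blast
    have rt0: "rt 0 = 0" using rt[of 0] k by (simp add: power_0_left)
    have "dist (b z) (b 0) < e" if "dist z 0 < d ^ k" for z
    proof -
      have "rt z \<in> ball 0 d" using in_ball[of "rt z" d] rt that d by simp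
      then show ?thesis using d(2) by (simp add: b_def rt0)
    qed
    then show "\<exists>d>0. \<forall>z. dist z 0 < d \<longrightarrow> dist (b z) (b 0) < e" using d(1) by (intro exI[of _ "d ^ k"]) auto
  qed
  have "b holomorphic_on ball 0 (\<rho> ^ k)"
  proof (rule no_isolated_singularity[where K = "{0}"])
    show "continuous_on (ball 0 (\<rho> ^ k)) b"
    proof (intro continuous_at_imp_continuous_on ballI)
      fix z assume "z \<in> ball (0::complex) (\<rho> ^ k)"
      then show "isCont b z" using cont0 diff DERIV_isCont by (cases "z = 0") blast+
    qed
    show "b holomorphic_on ball 0 (\<rho> ^ k) - {0}"
      unfolding holomorphic_on_def field_differentiable_def
      using diff has_field_derivative_at_within by blast
  qed auto
  then show thesis using that bk by blast
qed

lemma coeff_prod_linear_holomorphic: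
  assumes "finite I" "\<And>w. w \<in> I \<Longrightarrow> g w holomorphic_on S"
  shows "(\<lambda>s. coeff (\<Prod>w\<in>I. [:g w s, 1:]) m) holomorphic_on S"
  using assms
proof (induction I arbitrary: m rule: finite_induct)
  case empty
  show ?case by simp
next
  case (insert x I)
  have "coeff (\<Prod>w\<in>insert x I. [:g w s, 1:]) m = g x s * coeff (\<Prod>w\<in>I. [:g w s, 1:]) m +
      (case m of 0 \<Rightarrow> 0 | Suc m' \<Rightarrow> coeff (\<Prod>w\<in>I. [:g w s, 1:]) m')" for s
    using insert by (simp add: coeff_pCons)
  moreover have "(\<lambda>s. (case m of 0 \<Rightarrow> 0 | Suc m' \<Rightarrow> coeff (\<Prod>w\<in>I. [:g w s, 1:]) m')) holomorphic_on S"
    using insert by (cases m) auto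
  ultimately show ?case using insert by (simp only:) (intro holomorphic_intros; simp)
qed

text \<open>The norm of \<open>\<mu> - l\<close> along the ramified covering \<open>s \<mapsto> s ^ k\<close>.\<close>

lemma roots_of_unity_product:
  fixes l :: "complex \<Rightarrow> complex"
  assumes k: "k > 0" and l: "l holomorphic_on ball 0 \<rho>"
  obtains b where "\<And>m. b m holomorphic_on ball 0 (\<rho> ^ k)"
    "\<And>s \<mu>. s \<in> ball 0 \<rho> \<Longrightarrow> (\<Sum>m\<le>card {w::complex. w ^ k = 1}. b m (s ^ k) * \<mu> ^ m) = (\<Prod>w\<in>{w. w ^ k = 1}. (\<mu> - l (w * s)))"
proof -
  let ?I = "{w::complex. w ^ k = 1}"
  have fin: "finite ?I" using finite_roots_unity[of k] k by simp
  have nw: "cmod w = 1" if "w \<in> ?I" for w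
  proof -
    have "cmod w ^ k = 1 ^ k" using that by (simp add: norm_power[symmetric])
    then show ?thesis using power_eq_imp_eq_base[of "cmod w" k 1] k by simp
  qed
  define R where "R s = (\<Prod>w\<in>?I. [:- l (w * s), 1:])" for s
  \<comment> \<open>Multiplication by \<open>\<omega>\<close> permutes the roots of unity, so the
    coefficients of \<open>R\<close> descend to functions of \<open>s ^ k\<close>.\<close>
  have inv: "R (\<omega> * s) = R s" if "\<omega> ^ k = 1" for \<omega> s
    unfolding R_def
  proof (rule prod.reindex_bij_witness[where i = "\<lambda>w. w / \<omega>" and j = "\<lambda>w. w * \<omega>"])
    have "\<omega> \<noteq> 0" using that k by (auto simp: power_0_left)
    then show "w * \<omega> / \<omega> = w" "w / \<omega> * \<omega> = w" for w by auto
  qed (auto simp: power_mult_distrib power_divide that mult.assoc)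
  have hol: "(\<lambda>s. coeff (R s) m) holomorphic_on ball 0 \<rho>" for m
    unfolding R_def
  proof (rule coeff_prod_linear_holomorphic[OF fin])
    fix w assume w: "w \<in> ?I"
    have "(l \<circ> (\<lambda>s. w * s)) holomorphic_on ball 0 \<rho>"
      by (rule holomorphic_on_compose_gen[OF _ l]) (use nw[OF w] in \<open>auto intro!: holomorphic_intros simp: norm_mult\<close>)
    then show "(\<lambda>s. - l (w * s)) holomorphic_on ball 0 \<rho>" by (auto simp: o_def intro: holomorphic_intros)
  qed
  have "\<exists>b. b holomorphic_on ball 0 (\<rho> ^ k) \<and> (\<forall>s\<in>ball 0 \<rho>. b (s ^ k) = coeff (R s) m)" for m
    by (rule roots_of_unity_invariant[OF k hol[of m]]) (use inv in auto)
  then obtain b where b: "\<And>m. b m holomorphic_on ball 0 (\<rho> ^ k)"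
     "\<And>m s. s \<in> ball 0 \<rho> \<Longrightarrow> b m (s ^ k) = coeff (R s) m" by metis
  show thesis
  proof (rule that[OF b(1)])
    fix s \<mu> assume s: "s \<in> ball (0::complex) \<rho>"
    have "degree (R s) \<le> (\<Sum>w\<in>?I. (degree \<circ> (\<lambda>w. [:- l (w * s), 1:])) w)"
      unfolding R_def by (rule degree_prod_sum_le[OF fin])
    then have deg: "degree (R s) \<le> card ?I" by simp
    have "(\<Sum>m\<le>card ?I. b m (s ^ k) * \<mu> ^ m) = (\<Sum>m\<le>card ?I. coeff (R s) m * \<mu> ^ m)" using b(2)[OF s] by simp
    also have "\<dots> = (\<Sum>m\<le>degree (R s). coeff (R s) m * \<mu> ^ m)"
      by (rule sum.mono_neutral_right) (use deg in \<open>auto simp: coeff_eq_0\<close>)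
    also have "\<dots> = poly (R s) \<mu>" by (simp add: poly_altdef)
    also have "\<dots> = (\<Prod>w\<in>?I. (\<mu> - l (w * s)))" by (simp add: R_def poly_prod)
    finally show "(\<Sum>m\<le>card ?I. b m (s ^ k) * \<mu> ^ m) = (\<Prod>w\<in>?I. (\<mu> - l (w * s)))" .
  qed
qed

text \<open>The coefficients form a Vandermonde matrix, so \<open>\<Lambda> m u\<close> is a polynomial in \<open>m\<close> of degree below \<open>CARD('n)\<close>.\<close>

lemma separating_functionals:
  obtains \<Lambda> :: "nat \<Rightarrow> complex^'n \<Rightarrow> complex" where
    "\<And>m u v. \<Lambda> m (u - v) = \<Lambda> m u - \<Lambda> m v" "\<And>m. \<exists>a. \<forall>u. \<Lambda> m u = (\<Sum>j\<in>UNIV. a j * u $ j)"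
    "\<And>u. u \<noteq> 0 \<Longrightarrow> finite {m. \<Lambda> m u = 0} \<and> card {m. \<Lambda> m u = 0} \<le> CARD('n)"
proof -
  obtain \<iota> :: "'n \<Rightarrow> nat" where \<iota>: "bij_betw \<iota> UNIV {0..<CARD('n)}"
    using ex_bij_betw_finite_nat[of "UNIV :: 'n set"] by auto
  have inj: "\<iota> j = \<iota> j' \<longleftrightarrow> j = j'" for j j' using \<iota> by (auto simp: bij_betw_def inj_on_def)
  have lt: "\<iota> j < CARD('n)" for j using \<iota> by (auto simp: bij_betw_def)
  define \<Lambda> where "\<Lambda> m u = (\<Sum>j\<in>UNIV. of_nat m ^ \<iota> j * u $ j)" for m :: nat and u :: "complex^'n"
  show thesis
  proof (rule that[of \<Lambda>])
    show "\<Lambda> m (u - v) = \<Lambda> m u - \<Lambda> m v" for m u v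
      by (simp add: \<Lambda>_def algebra_simps sum_subtractf)
    show "\<exists>a. \<forall>u. \<Lambda> m u = (\<Sum>j\<in>UNIV. a j * u $ j)" for m
      unfolding \<Lambda>_def by (intro exI[of _ "\<lambda>j. of_nat m ^ \<iota> j"]) simp
    fix u :: "complex^'n" assume "u \<noteq> 0"
    then obtain j0 where j0: "u $ j0 \<noteq> 0" by (auto simp: vec_eq_iff)
    define P where "P = (\<Sum>j\<in>UNIV. monom (u $ j) (\<iota> j))"
    have "coeff P (\<iota> j0) = (\<Sum>j\<in>UNIV. if j = j0 then u $ j else 0)"
      unfolding P_def coeff_sum by (rule sum.cong) (auto simp: inj)
    then have P0: "P \<noteq> 0" using j0 by auto
    have "degree P \<le> CARD('n)" unfolding P_def
      by (rule degree_sum_le) (auto intro: order_trans[OF degree_monom_le less_imp_le[OF lt]])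
    have e: "\<Lambda> m u = poly P (of_nat m)" for m
      by (simp add: \<Lambda>_def P_def poly_sum poly_monom mult.commute)
    have "of_nat ` {m. \<Lambda> m u = 0} \<subseteq> {x. poly P x = 0}" by (auto simp: e)
    moreover have f: "finite {x. poly P x = 0}" using P0 poly_roots_finite by blast
    ultimately have "finite (of_nat ` {m. \<Lambda> m u = 0} :: complex set)" "card (of_nat ` {m. \<Lambda> m u = 0} :: complex set) \<le> card {x. poly P x = 0}"
      using finite_subset card_mono by blast+
    moreover have inj': "inj_on (of_nat :: nat \<Rightarrow> complex) {m. \<Lambda> m u = 0}" by (simp add: inj_on_def)
    moreover have "card {x. poly P x = 0} \<le> degree P" using card_poly_roots_bound[OF P0] by simp
    ultimately show "finite {m. \<Lambda> m u = 0} \<and> card {m. \<Lambda> m u = 0} \<le> CARD('n)"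
      using \<open>degree P \<le> CARD('n)\<close> by (simp add: card_image finite_image_iff)
  qed
qed

section \<open>Local separatrices\<close>

context foliated
begin

lemma holomorphic_function_on_chart:
  assumes c: "c \<in> A" and W: "W \<subseteq> fst c" and Q: "\<And>x. x \<in> W \<Longrightarrow> chol Q (snd c x)"
  shows "holomorphic_function_on A W (\<lambda>x. Q (snd c x))"
  unfolding holomorphic_function_on_def sc_holomorphic_on_chol
proof (intro ballI)
  fix d z assume d: "d \<in> A" and "z \<in> snd d ` (fst d \<inter> W)"
  then obtain x where x: "x \<in> fst d" "x \<in> W" "z = snd d x" by blast
  have xc: "x \<in> fst c" using x W by blast
  have e: "transition d c z = snd c x" using x d by (simp add: transition_def)
  have "chol (\<lambda>w. Q (transition d c w)) z"
    by (rule chol_compose[where f = "transition d c"])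
      (use Q[OF x(2)] e transition_chol[OF d c x(1) xc] x in auto)
  then show "chol (\<lambda>z. Q (snd c (chart_inv d z))) z" by (simp add: transition_def)
qed

lemma holomorphic_function_on_curve:
  assumes f: "holomorphic_function_on A V f" and \<gamma>: "hol_curve S \<gamma>" "open S" "\<gamma> ` S \<subseteq> V"
  shows "(\<lambda>s. f (\<gamma> s)) holomorphic_on S"
  unfolding holomorphic_on_def
proof
  fix t assume t: "t \<in> S"
  obtain c where c: "c \<in> A" "\<gamma> t \<in> fst c" by (rule chart_cover)
  define N where "N = {s \<in> S. \<gamma> s \<in> fst c}"
  have N: "open N" "t \<in> N"
    unfolding N_def using hol_curve_preimage_open[OF \<gamma>(1,2) chart_open(1)[OF c(1)]] t c(2) by auto
  have "\<gamma> t \<in> fst c \<inter> V" using t \<gamma>(3) c(2) by blast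
  then have ch: "chol (\<lambda>z. f (chart_inv c z)) (snd c (\<gamma> t))"
    using f c unfolding holomorphic_function_on_def sc_holomorphic_on_chol by blast
  have "((\<lambda>s. f (chart_inv c (snd c (\<gamma> s)))) has_field_derivative
     FD (\<lambda>z. f (chart_inv c z)) (snd c (\<gamma> t)) (velocity c \<gamma> t)) (at t)"
    by (rule chol_curve[where \<gamma> = "\<lambda>s. snd c (\<gamma> s)", OF ch])
      (rule hol_curve_velocity[OF \<gamma>(1,2) c(1) t c(2)])
  then have "((\<lambda>s. f (\<gamma> s)) has_field_derivative
     FD (\<lambda>z. f (chart_inv c z)) (snd c (\<gamma> t)) (velocity c \<gamma> t)) (at t)"
    by (rule has_field_derivative_transform_within_open[OF _ N]) (use c in \<open>auto simp: N_def\<close>)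
  then show "(\<lambda>s. f (\<gamma> s)) field_differentiable at t within S"
    using field_differentiable_at_within field_differentiable_def by blast
qed

text \<open>An identity principle: the interior of the preimage is open and, by analytic
  continuation of the local equations of \<open>C\<close>, also closed in the ball.\<close>

lemma analytic_preimage_interior:
  assumes C: "analytic_subset A W C" and \<delta>: "hol_curve (ball a \<rho>) \<delta>" "\<delta> ` ball a \<rho> \<subseteq> W"
    and O': "open O'" "O' \<noteq> {}" "O' \<subseteq> {s \<in> ball a \<rho>. \<delta> s \<in> C}"
  shows "\<delta> ` ball a \<rho> \<subseteq> C"
proof -
  define B where "B = ball a \<rho>"
  define T where "T = {s \<in> B. \<delta> s \<in> C}"
  have int: "interior T \<subseteq> B" using interior_subset[of T] by (auto simp: T_def)
  \<comment> \<open>If a ball mapped into \<open>V\<close> meets the interior, the equations of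
    \<open>C\<close> in \<open>V\<close> vanish on an open piece of it, hence on the whole
    ball.\<close>
  have loc: "ball s r \<subseteq> interior T" if s: "s \<in> B" "ball s r \<subseteq> B" "ball s r \<inter> interior T \<noteq> {}"
    "\<delta> ` ball s r \<subseteq> V" "open V" "V \<subseteq> W" "finite G" "\<forall>f\<in>G. holomorphic_function_on A V f"
    "C \<inter> V = {x \<in> V. \<forall>f\<in>G. f x = 0}" for s r V G
  proof -
    have "ball s r \<subseteq> T"
    proof
      fix y assume y: "y \<in> ball s r"
      have "f (\<delta> y) = 0" if f: "f \<in> G" for f
      proof -
        have h: "(\<lambda>s. f (\<delta> s)) holomorphic_on ball s r"
          by (rule holomorphic_function_on_curve[OF _ hol_curve_subset[OF \<delta>(1)] open_ball s(4)])
            (use f s in \<open>auto simp: B_def\<close>)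
        have z: "f (\<delta> x) = 0" if x: "x \<in> ball s r \<inter> interior T" for x
        proof -
          have "\<delta> x \<in> C \<inter> V" using x s(4) interior_subset[of T] by (auto simp: T_def)
          then show ?thesis using f s(9) by auto
        qed
        obtain x0 where x0: "x0 \<in> ball s r \<inter> interior T" using s(3) by blast
        have "x0 islimpt (ball s r \<inter> interior T)"
          using x0 by (intro interior_limit_point) (simp add: interior_open open_Int)
        then show ?thesis
          using analytic_continuation[OF h open_ball connected_ball _ _ _ z y] x0 by blast
      qed
      then have "\<delta> y \<in> C \<inter> V" using y s(4,9) by auto
      then show "y \<in> T" using y s(2) by (auto simp: T_def)
    qed
    then show ?thesis by (simp add: interior_maximal)
  qed
  have nb: "\<exists>r>0. ball s r \<subseteq> B \<and> (ball s r \<inter> interior T \<noteq> {} \<longrightarrow> ball s r \<subseteq> interior T)" if s: "s \<in> B" for s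
  proof -
    have "\<delta> s \<in> W" using s \<delta>(2) by (auto simp: B_def)
    then obtain V G where V: "open V" "\<delta> s \<in> V" "V \<subseteq> W" "finite G"
        "\<forall>f\<in>G. holomorphic_function_on A V f" "C \<inter> V = {x \<in> V. \<forall>f\<in>G. f x = 0}"
      using C unfolding analytic_subset_def by meson
    have "open {x \<in> B. \<delta> x \<in> V}" using hol_curve_preimage_open[OF \<delta>(1) open_ball V(1)] by (simp add: B_def)
    then obtain r where r: "r > 0" "ball s r \<subseteq> {x \<in> B. \<delta> x \<in> V}" using s V(2) openE by blast
    then have "ball s r \<subseteq> B" "\<delta> ` ball s r \<subseteq> V" by auto
    then show ?thesis using r(1) loc[OF s _ _ _ V(1,3-6)] by blast
  qed
  have "openin (top_of_set B) (interior T)" using int by (simp add: open_subset)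
  moreover have "openin (top_of_set B) (B - interior T)"
  proof (subst openin_subopen, intro ballI)
    fix s assume s: "s \<in> B - interior T"
    then obtain r where r: "r > 0" "ball s r \<subseteq> B" "ball s r \<inter> interior T \<noteq> {} \<longrightarrow> ball s r \<subseteq> interior T"
      using nb by blast
    have "s \<in> ball s r" using r by simp
    then have "ball s r \<subseteq> B - interior T" using r s by blast
    then show "\<exists>N. openin (top_of_set B) N \<and> s \<in> N \<and> N \<subseteq> B - interior T"
      using r by (intro exI[of _ "ball s r"]) (auto simp: open_subset)
  qed
  then have "closedin (top_of_set B) (interior T)"
    using int by (simp add: closedin_def)
  ultimately have "interior T = {} \<or> interior T = B"
    using connected_ball[of a \<rho>] unfolding connected_clopen B_def by blast
  moreover have "O' \<subseteq> interior T" using O' by (intro interior_maximal) (auto simp: T_def B_def)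
  ultimately have "interior T = B" using O'(2) by blast
  then have "B \<subseteq> T" using interior_subset by blast
  then show ?thesis by (auto simp: T_def B_def)
qed

text \<open>If the preimage of the complement of \<open>C1\<close> is empty, \<open>C\<close> is
  \<open>C1\<close>; otherwise it is an open set that is mapped into \<open>C2\<close>, and
  \<open>analytic_preimage_interior\<close> puts all of \<open>C\<close> into
  \<open>C2\<close>.\<close>

lemma disc_image_irreducible:
  assumes C: "analytic_subset A W C" and \<delta>: "hol_curve (ball a \<rho>) \<delta>" "\<rho> > 0" and im: "C = \<delta> ` ball a \<rho>"
  shows "irreducible_analytic_subset A W C"
  unfolding irreducible_analytic_subset_def
proof (intro conjI allI impI)
  show "C \<noteq> {}" using im \<delta>(2) by auto
  fix C1 C2 assume "analytic_subset A W C1 \<and> analytic_subset A W C2 \<and> C = C1 \<union> C2"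
  then have C12: "analytic_subset A W C1" "analytic_subset A W C2" "C = C1 \<union> C2" by auto
  have W: "\<delta> ` ball a \<rho> \<subseteq> W" using C im by (simp add: analytic_subset_def)
  define O' where "O' = {s \<in> ball a \<rho>. \<delta> s \<notin> C1}"
  have "open O'"
  proof (subst open_subopen, intro ballI)
    fix s assume s: "s \<in> O'"
    then have "\<delta> s \<in> W" using W by (auto simp: O'_def)
    then obtain V G where V: "open V" "\<delta> s \<in> V" "V \<subseteq> W" "finite G"
        "\<forall>f\<in>G. holomorphic_function_on A V f" "C1 \<inter> V = {x \<in> V. \<forall>f\<in>G. f x = 0}"
      using C12(1) unfolding analytic_subset_def by meson
    define N where "N = {s \<in> ball a \<rho>. \<delta> s \<in> V}"
    have N: "open N" unfolding N_def by (rule hol_curve_preimage_open[OF \<delta>(1) open_ball V(1)])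
    have sN: "s \<in> N" using s V(2) by (auto simp: N_def O'_def)
    obtain f where f: "f \<in> G" "f (\<delta> s) \<noteq> 0" using s V(2,6) by (auto simp: O'_def)
    have "(\<lambda>s. f (\<delta> s)) holomorphic_on N"
      by (rule holomorphic_function_on_curve[OF _ hol_curve_subset[OF \<delta>(1)] N])
        (use f V in \<open>auto simp: N_def\<close>)
    then have "open (N \<inter> (\<lambda>s. f (\<delta> s)) -` (- {0}))"
      using continuous_open_preimage[OF holomorphic_on_imp_continuous_on N] by blast
    moreover have "N \<inter> (\<lambda>s. f (\<delta> s)) -` (- {0}) \<subseteq> O'" using f V(6) by (auto simp: N_def O'_def)
    ultimately show "\<exists>T. open T \<and> s \<in> T \<and> T \<subseteq> O'" using sN f(2) by blast
  qed
  show "C = C1 \<or> C = C2"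
  proof (cases "O' = {}")
    case True
    then have "C \<subseteq> C1" using im by (auto simp: O'_def)
    then show ?thesis using C12 by blast
  next
    case False
    have "O' \<subseteq> {s \<in> ball a \<rho>. \<delta> s \<in> C2}" using C12(3) im by (auto simp: O'_def)
    from analytic_preimage_interior[OF C12(2) \<delta>(1) W \<open>open O'\<close> False this]
    show ?thesis using C12 im by blast
  qed
qed fact

text \<open>The image of a disc has measure zero in two complex dimensions.\<close>

lemma disc_image_regular_dim:
  assumes \<delta>: "hol_curve (ball a \<rho>) \<delta>" and im: "C = \<delta> ` ball a \<rho>" and reg: "regular_point A C k x"
  shows "k \<le> 1"
proof (rule ccontr)
  assume "\<not> k \<le> 1"
  obtain e I where e: "e \<in> A" "x \<in> fst e" "x \<in> C" and I: "card I + k = CARD('n)"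
    and CI: "C \<inter> fst e = {y \<in> fst e. \<forall>i\<in>I. snd e y $ i = 0}"
    using reg unfolding regular_point_def by blast
  have "card (- I) = k" using I by (simp add: Compl_eq_Diff_UNIV card_Diff_subset)
  then have "\<not> card (- I) \<le> Suc 0" using \<open>\<not> k \<le> 1\<close> by simp
  then obtain i j where ij: "i \<notin> I" "j \<notin> I" "i \<noteq> j"
    using card_le_Suc0_iff_eq[of "- I"] by auto
  define S where "S = {s \<in> ball a \<rho>. \<delta> s \<in> fst e}"
  have S: "open S" unfolding S_def by (rule hol_curve_preimage_open[OF \<delta> open_ball chart_open(1)[OF e(1)]])
  \<comment> \<open>Two coordinates that vary freely on \<open>C\<close> in the chart. They map
    \<open>S\<close>, of real dimension 2, into a space of real dimension 4, so the image is
    negligible.\<close>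
  define f where "f s = (snd e (\<delta> s) $ i, snd e (\<delta> s) $ j)" for s
  have "f differentiable_on S"
    unfolding differentiable_on_def
  proof
    fix s assume s: "s \<in> S"
    have "((\<lambda>s. snd e (\<delta> s) $ l) has_derivative (\<lambda>h. velocity e \<delta> s $ l * h)) (at s)" for l
      using hol_curve_velocity[OF \<delta> open_ball e(1), of s l] s by (simp add: S_def has_field_derivative_def)
    then have "(f has_derivative (\<lambda>h. (velocity e \<delta> s $ i * h, velocity e \<delta> s $ j * h))) (at s)"
      unfolding f_def by (intro has_derivative_Pair)
    then show "f differentiable at s within S"
      using differentiable_at_withinI differentiable_def by blast
  qed
  then have neg: "negligible (f ` S)"
    by (rule negligible_differentiable_image_lowdim[rotated]) simp
  \<comment> \<open>Freezing the other coordinates at those of \<open>x\<close> embeds an open set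
    \<open>N\<close> of pairs in \<open>C\<close>; all these pairs are values of \<open>f\<close>,
    which is impossible for a null set.\<close>
  define g where "g uw = (\<chi> l. if l = i then fst uw else if l = j then snd uw else snd e x $ l)"
    for uw :: "complex \<times> complex"
  have gc: "continuous_on UNIV g"
    unfolding g_def
  proof (rule continuous_on_vec_lambda)
    fix l show "continuous_on UNIV (\<lambda>uw. if l = i then fst uw else if l = j then snd uw else snd e x $ l)"
      by (cases "l = i"; cases "l = j") (auto intro!: continuous_intros)
  qed
  define N where "N = g -` (snd e ` fst e)"
  have "open N" unfolding N_def by (rule open_vimage[OF chart_open(2)[OF e(1)] gc])
  moreover have "(snd e x $ i, snd e x $ j) \<in> N"
  proof -
    have "g (snd e x $ i, snd e x $ j) = snd e x" by (auto simp: g_def vec_eq_iff)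
    then show ?thesis using e(2) by (simp add: N_def)
  qed
  moreover have "N \<subseteq> f ` S"
  proof
    fix uw assume uw: "uw \<in> N"
    define y where "y = chart_inv e (g uw)"
    have y: "y \<in> fst e" "snd e y = g uw"
      using uw chart_inv_in[OF e(1)] snd_chart_inv[OF e(1)] by (auto simp: N_def y_def)
    have "\<forall>l\<in>I. snd e x $ l = 0" using CI e(2,3) by blast
    then have "\<forall>l\<in>I. snd e y $ l = 0" using ij by (auto simp: y(2) g_def)
    then have "y \<in> C" using CI y(1) by blast
    then obtain s where s: "s \<in> ball a \<rho>" "y = \<delta> s" using im by blast
    have "f s = uw" using y(2) ij s(2) by (simp add: f_def g_def)
    then show "uw \<in> f ` S" using s y(1) by (auto simp: S_def)
  qed
  ultimately show False using neg open_not_negligible negligible_subset by blast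
qed

text \<open>Several parameters may lie over \<open>x1\<close>, but near each of them the curve stays
  in the plaque of \<open>x1\<close>. The other parameters of a closed disc have a compact image
  avoiding \<open>x1\<close>; so near \<open>x1\<close> the image lies in that plaque, and by the
  open mapping theorem it fills the plaque there. The definition of \<open>analytic_dim\<close> asks
  for such a point.\<close>

lemma disc_image_regular_point:
  assumes \<delta>: "hol_curve (ball 0 \<rho>) \<delta>" and \<rho>: "\<rho> > 0" and lw: "leafwise (ball 0 \<rho> - {0}) \<delta>"
    and c: "c \<in> A" "\<delta> ` ball 0 \<rho> \<subseteq> fst c"
    and pow: "\<And>s. s \<in> ball 0 \<rho> \<Longrightarrow> snd c (\<delta> s) $ i = z0 + s ^ k" "k > 0"
  shows "\<exists>x. regular_point A (\<delta> ` ball 0 \<rho>) 1 x"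
proof -
  define S where "S = ball (0::complex) \<rho> - {0}"
  have S: "open S" "leafwise S \<delta>" using lw by (auto simp: S_def open_delete)
  define s1 where "s1 = (of_real (\<rho> / 2) :: complex)"
  have s1: "s1 \<in> S" "cmod s1 = \<rho> / 2" using \<rho> by (auto simp: S_def s1_def)
  define x1 where "x1 = \<delta> s1"
  have "x1 \<notin> E" using leafwise_notin_E[OF S(2) s1(1)] by (simp add: x1_def)
  then obtain d i' where d: "fbox d i'" "x1 \<in> fst d" using flow_box_exists by blast
  note dA = fboxD(1)[OF d(1)]
  \<comment> \<open>Beyond the modulus \<open>\<rho> / 2\<close> of \<open>s1\<close> and short of
    \<open>\<rho>\<close>, so that the closed disc is compact in the domain and contains all
    parameters over the neighbourhood \<open>N1\<close> of \<open>x1\<close>.\<close>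
  define \<rho>' where "\<rho>' = 3 * \<rho> / 4"
  have \<rho>': "0 < \<rho>'" "\<rho>' < \<rho>" "\<rho> / 2 < \<rho>'" using \<rho> by (auto simp: \<rho>'_def)
  define O' where "O' = \<Union>{ball s r | s r. ball s r \<subseteq> S \<and> \<delta> ` ball s r \<subseteq> plaque d i' x1}"
  have O': "open O'" unfolding O'_def by auto
  have Opl: "\<delta> ` O' \<subseteq> plaque d i' x1" unfolding O'_def by blast
  define K where "K = \<delta> ` (cball 0 \<rho>' - O')"
  have "compact (cball 0 \<rho>' - O')" using O' by (simp add: compact_diff)
  moreover have "continuous_on (cball 0 \<rho>' - O') \<delta>"
    using \<delta> \<rho>' by (auto simp: hol_curve_def elim!: continuous_on_subset)
  ultimately have "compact K" unfolding K_def using compact_continuous_image by blast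
  then have N0: "open (- K)" using compact_imp_closed by blast
  have x1K: "x1 \<notin> K"
  proof
    assume "x1 \<in> K"
    then obtain s where s: "cmod s \<le> \<rho>'" "s \<notin> O'" "\<delta> s = x1" unfolding K_def by auto
    have sb: "s \<in> ball 0 \<rho>" "s1 \<in> ball 0 \<rho>" using s \<rho>' s1 by auto
    have "s ^ k = s1 ^ k" using pow(1)[OF sb(1)] pow(1)[OF sb(2)] s(3) by (simp add: x1_def)
    then have "s \<noteq> 0" using s1 pow(2) by (auto simp: power_0_left S_def)
    then have "s \<in> S" using sb by (simp add: S_def)
    then obtain r where "r > 0" "ball s r \<subseteq> S" "\<delta> ` ball s r \<subseteq> plaque d i' (\<delta> s)"
      using leafwise_local[OF S(2,1) d(1), of s] d(2) s(3) by auto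
    then have "s \<in> O'" unfolding O'_def s(3) by (auto intro!: exI[of _ "ball s r"] exI[of _ s] exI[of _ r])
    then show False using s(2) by simp
  qed
  define N1 where "N1 = {x \<in> fst c. cmod (snd c x $ i - z0) < \<rho>' ^ k}"
  have N1: "open N1"
  proof -
    have "open {z :: complex^'n. cmod (z $ i - z0) < \<rho>' ^ k}" by (intro open_Collect_less continuous_intros)
    then show ?thesis unfolding N1_def using chart_preimage_open[OF c(1)] by fastforce
  qed
  have x1N1: "x1 \<in> N1"
    using s1 pow(1)[of s1] c(2) \<rho>' pow(2) \<rho>
    by (auto simp: N1_def x1_def S_def norm_power intro!: power_strict_mono)
  have CN: "\<delta> s \<in> plaque d i' x1" if s: "s \<in> ball 0 \<rho>" "\<delta> s \<in> - K \<inter> N1" for s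
  proof -
    have "cmod s ^ k < \<rho>' ^ k" using s pow(1)[OF s(1)] by (simp add: N1_def norm_power)
    then have "cmod s < \<rho>'" using \<rho>' power_less_imp_less_base by (metis less_imp_le)
    then have "s \<in> O'" using s(2) by (auto simp: K_def)
    then show ?thesis using Opl by blast
  qed
  obtain r where r: "r > 0" "ball s1 r \<subseteq> S" "\<delta> ` ball s1 r \<subseteq> plaque d i' (\<delta> s1)"
    "(\<lambda>s. snd d (\<delta> s) $ i') holomorphic_on ball s1 r"
    "\<And>s s'. s \<in> ball s1 r \<Longrightarrow> s' \<in> ball s1 r \<Longrightarrow> snd d (\<delta> s) $ i' = snd d (\<delta> s') $ i' \<Longrightarrow> \<delta> s = \<delta> s'"
    by (rule leafwise_component[OF S(2,1) d(1) s1(1)]) (use d(2) in \<open>auto simp: x1_def intro: that\<close>)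
  have nconst: "\<not> (\<lambda>s. snd d (\<delta> s) $ i') constant_on ball s1 r"
  proof
    assume "(\<lambda>s. snd d (\<delta> s) $ i') constant_on ball s1 r"
    then have eq: "\<delta> s = \<delta> s1" if "s \<in> ball s1 r" for s
      using r(5)[OF that, of s1] that r(1) by (auto simp: constant_on_def)
    have "s ^ k = s1 ^ k" if "s \<in> ball s1 r" for s
      using pow(1)[of s] pow(1)[of s1] eq[OF that] r(2) that s1 by (auto simp: S_def)
    then have fin: "ball s1 r \<subseteq> {s. s ^ k = s1 ^ k}" by blast
    have "finite {s. s ^ k = s1 ^ k}" using finite_nth_roots pow(2) by blast
    then have "finite (ball s1 r)" using fin finite_subset by blast
    then show False using r(1) finite_imp_not_open[of "ball s1 r"] by simp
  qed
  have "open ((\<lambda>s. snd d (\<delta> s) $ i') ` ball s1 r)"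
    by (rule open_mapping_thm[OF r(4) open_ball connected_ball open_ball order_refl nconst])
  moreover have "snd d x1 $ i' \<in> (\<lambda>s. snd d (\<delta> s) $ i') ` ball s1 r" using r(1) by (auto simp: x1_def)
  ultimately obtain \<eta> where \<eta>: "\<eta> > 0" "ball (snd d x1 $ i') \<eta> \<subseteq> (\<lambda>s. snd d (\<delta> s) $ i') ` ball s1 r"
    using openE by blast
  define U where "U = snd d ` (fst d \<inter> (- K \<inter> N1)) \<inter> {z. cmod (z $ i' - snd d x1 $ i') < \<eta>}"
  have U: "open U"
    unfolding U_def by (intro open_Int chart_image_open[OF dA] N0 N1 open_Collect_less continuous_intros)
  have Us: "U \<subseteq> snd d ` fst d" by (auto simp: U_def)
  \<comment> \<open>\<open>regular_point\<close> wants the coordinates other than \<open>i'\<close>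
    to vanish on the image, so \<open>x1\<close> is moved to the origin.\<close>
  define h where "h z = z - snd d x1" for z
  define h' where "h' z = z + snd d x1" for z
  have V: "open (h ` U)" unfolding h_def using open_translation_subtract[OF U] by simp
  have hom: "homeomorphism U (h ` U) h h'"
    by (rule homeomorphismI) (auto simp: h_def h'_def intro!: continuous_intros)
  have hch: "chol (\<lambda>w. h w $ l) z" for z l unfolding h_def by (auto intro!: chol_diff)
  have hch': "chol (\<lambda>w. h' w $ l) z" for z l unfolding h'_def by (auto intro!: chol_add)
  define e where "e = ({x \<in> fst d. snd d x \<in> U}, \<lambda>x. h (snd d x))"
  have eA: "e \<in> A" unfolding e_def by (rule chart_compose(1)[OF dA U Us V hom hch hch'])
  have x1e: "x1 \<in> fst e" using d(2) x1K x1N1 \<eta>(1) by (auto simp: e_def U_def)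
  have efst: "y \<in> fst d" "y \<in> - K \<inter> N1" "cmod (snd d y $ i' - snd d x1 $ i') < \<eta>" if "y \<in> fst e" for y
  proof -
    show yd: "y \<in> fst d" using that by (simp add: e_def)
    have "snd d y \<in> U" using that by (simp add: e_def)
    then obtain y' where "y' \<in> fst d" "y' \<in> - K \<inter> N1" "snd d y = snd d y'" by (auto simp: U_def)
    then show "y \<in> - K \<inter> N1" using chart_inj[OF dA yd] by metis
    show "cmod (snd d y $ i' - snd d x1 $ i') < \<eta>" using \<open>snd d y \<in> U\<close> by (simp add: U_def)
  qed
  have "\<delta> ` ball 0 \<rho> \<inter> fst e = {x \<in> fst e. \<forall>l\<in>- {i'}. snd e x $ l = 0}"
  proof (intro equalityI subsetI)
    fix y assume y: "y \<in> \<delta> ` ball 0 \<rho> \<inter> fst e"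
    then have "y \<in> plaque d i' x1" using CN efst(2) by blast
    then show "y \<in> {x \<in> fst e. \<forall>l\<in>- {i'}. snd e x $ l = 0}" using y by (auto simp: plaque_def e_def h_def)
  next
    fix y assume y: "y \<in> {x \<in> fst e. \<forall>l\<in>- {i'}. snd e x $ l = 0}"
    then have ye: "y \<in> fst e" and yl: "\<And>l. l \<noteq> i' \<Longrightarrow> snd d y $ l = snd d x1 $ l" by (auto simp: e_def h_def)
    have "snd d y $ i' \<in> ball (snd d x1 $ i') \<eta>" using efst(3)[OF ye] by (simp add: dist_norm norm_minus_commute)
    then obtain s where s: "s \<in> ball s1 r" "snd d y $ i' = snd d (\<delta> s) $ i'" using \<eta>(2) by blast
    have ps: "\<delta> s \<in> plaque d i' x1" using r(3) s(1) by (auto simp: x1_def)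
    have "snd d y $ l = snd d (\<delta> s) $ l" for l
      by (cases "l = i'") (use s(2) yl ps in \<open>auto simp: plaque_def\<close>)
    then have "y = \<delta> s" using chart_inj[OF dA efst(1)[OF ye]] ps by (simp add: vec_eq_iff plaque_def)
    moreover have "s \<in> ball 0 \<rho>" using s(1) r(2) by (auto simp: S_def)
    ultimately show "y \<in> \<delta> ` ball 0 \<rho> \<inter> fst e" using ye by blast
  qed
  moreover have "card (- {i'}) + 1 = CARD('n)" by (simp add: Compl_eq_Diff_UNIV card_Diff_subset)
  moreover have "x1 \<in> \<delta> ` ball 0 \<rho>" using s1 by (auto simp: x1_def S_def)
  ultimately show ?thesis unfolding regular_point_def using eA x1e
    by (intro exI[of _ x1] conjI bexI[of _ e] exI[of _ "- {i'}"]) auto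
qed

text \<open>In coordinates with \<open>z\<^sub>i = s ^ k\<close> the image is cut out by the norms, over the \<open>k\<close>-th roots of
  unity, of sufficiently many linear functionals.\<close>

lemma disc_image_analytic:
  assumes \<delta>: "hol_curve (ball 0 \<rho>) \<delta>" and \<rho>: "\<rho> > 0"
    and c: "c \<in> A" "\<delta> ` ball 0 \<rho> \<subseteq> fst c"
    and pow: "\<And>s. s \<in> ball 0 \<rho> \<Longrightarrow> snd c (\<delta> s) $ i = z0 + s ^ k" "k > 0"
  defines "W \<equiv> {x \<in> fst c. cmod (snd c x $ i - z0) < \<rho> ^ k}"
  shows "open W" "analytic_subset A W (\<delta> ` ball 0 \<rho>)"
proof -
  have "open {z :: complex^'n. cmod (z $ i - z0) < \<rho> ^ k}" by (intro open_Collect_less continuous_intros)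
  then show W: "open W" unfolding W_def using chart_preimage_open[OF c(1)] by fastforce
  let ?I = "{w::complex. w ^ k = 1}"
  have finI: "finite ?I" using finite_roots_unity[of k] pow(2) by simp
  obtain \<Lambda> :: "nat \<Rightarrow> complex^'n \<Rightarrow> complex" where
    \<Lambda>: "\<And>m u v. \<Lambda> m (u - v) = \<Lambda> m u - \<Lambda> m v" "\<And>m. \<exists>a. \<forall>u. \<Lambda> m u = (\<Sum>j\<in>UNIV. a j * u $ j)"
    "\<And>u. u \<noteq> 0 \<Longrightarrow> finite {m. \<Lambda> m u = 0} \<and> card {m. \<Lambda> m u = 0} \<le> CARD('n)"
    by (rule separating_functionals) (rule that)
  have \<Lambda>c: "chol (\<Lambda> m) z" for m z
  proof -
    obtain a where "\<Lambda> m = (\<lambda>u. \<Sum>j\<in>UNIV. a j * u $ j)" using \<Lambda>(2)[of m] by blast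
    then show ?thesis by (auto intro!: chol_sum chol_mult)
  qed
  have snd_hol: "(\<lambda>s. snd c (\<delta> s) $ j) holomorphic_on ball 0 \<rho>" for j
  proof -
    have "(\<lambda>t. snd c (\<delta> t) $ j) holomorphic_on {t \<in> ball 0 \<rho>. \<delta> t \<in> fst c}"
      using \<delta> c(1) by (simp add: hol_curve_def)
    then show ?thesis by (rule holomorphic_on_subset) (use c(2) in auto)
  qed
  have l: "(\<lambda>s. \<Lambda> m (snd c (\<delta> s))) holomorphic_on ball 0 \<rho>" for m
  proof -
    obtain a where "\<Lambda> m = (\<lambda>u. \<Sum>j\<in>UNIV. a j * u $ j)" using \<Lambda>(2)[of m] by blast
    then show ?thesis using snd_hol by (auto intro!: holomorphic_intros)
  qed
  have "\<exists>b. (\<forall>j. b j holomorphic_on ball 0 (\<rho> ^ k)) \<and> (\<forall>s\<in>ball 0 \<rho>. \<forall>\<mu>.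
      (\<Sum>j\<le>card ?I. b j (s ^ k) * \<mu> ^ j) = (\<Prod>w\<in>?I. (\<mu> - \<Lambda> m (snd c (\<delta> (w * s))))))" for m
    by (rule roots_of_unity_product[OF pow(2) l[of m]]) blast
  then have "\<exists>b. \<forall>m. (\<forall>j. b m j holomorphic_on ball 0 (\<rho> ^ k)) \<and> (\<forall>s\<in>ball 0 \<rho>. \<forall>\<mu>.
      (\<Sum>j\<le>card ?I. b m j (s ^ k) * \<mu> ^ j) = (\<Prod>w\<in>?I. (\<mu> - \<Lambda> m (snd c (\<delta> (w * s))))))"
    by (intro choice allI)
  then obtain b where b: "\<And>m j. b m j holomorphic_on ball 0 (\<rho> ^ k)"
    "\<And>m s \<mu>. s \<in> ball 0 \<rho> \<Longrightarrow> (\<Sum>j\<le>card ?I. b m j (s ^ k) * \<mu> ^ j) = (\<Prod>w\<in>?I. (\<mu> - \<Lambda> m (snd c (\<delta> (w * s)))))"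
    by blast
  \<comment> \<open>At a point whose \<open>i\<close>-th coordinate is \<open>z0 + s ^ k\<close>
    this is the product, over the roots of unity \<open>w\<close>, of \<open>\<Lambda> m\<close> of
    the coordinate differences to \<open>\<delta> (w * s)\<close>; written with the coefficients
    \<open>b\<close> it is a holomorphic function on \<open>W\<close>.\<close>
  define Q where "Q m z = (\<Sum>j\<le>card ?I. b m j (z $ i - z0) * \<Lambda> m z ^ j)" for m z
  have Qc: "chol (Q m) (snd c x)" if x: "x \<in> W" for m x
  proof -
    have "chol (\<lambda>z. b m j (z $ i - z0)) (snd c x)" for j
    proof (rule chol_compose_field[where f = "\<lambda>z. z $ i - z0" and h = "b m j"])
      show "chol (\<lambda>z. z $ i - z0) (snd c x)" by (auto intro!: chol_diff)
      have "snd c x $ i - z0 \<in> ball 0 (\<rho> ^ k)" using x by (simp add: W_def)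
      then show "(b m j has_field_derivative deriv (b m j) (snd c x $ i - z0)) (at (snd c x $ i - z0))"
        using b(1) holomorphic_derivI open_ball by blast
    qed
    then show ?thesis unfolding Q_def by (intro chol_sum chol_mult chol_power \<Lambda>c)
  qed
  \<comment> \<open>Each of the \<open>card ?I\<close> differences is annihilated by at most
    \<open>CARD('n)\<close> functionals, so among \<open>N\<close> of them one annihilates
    none.\<close>
  define N where "N = Suc (card ?I * CARD('n))"
  define G where "G = (\<lambda>m x. Q m (snd c x)) ` {..<N}"
  have zero: "(\<forall>f\<in>G. f x = 0) \<longleftrightarrow> x \<in> \<delta> ` ball 0 \<rho>" if x: "x \<in> W" for x
  proof -
    obtain s where s: "s ^ k = snd c x $ i - z0" using complex_root_exists[OF pow(2)] by blast
    have xc: "x \<in> fst c" using x by (simp add: W_def)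
    have "cmod s ^ k < \<rho> ^ k" using x by (simp add: W_def s[symmetric] norm_power)
    then have sb: "s \<in> ball 0 \<rho>" using power_less_imp_less_base[of "cmod s" k \<rho>] \<rho> by simp
    have Qe: "Q m (snd c x) = (\<Prod>w\<in>?I. (\<Lambda> m (snd c x) - \<Lambda> m (snd c (\<delta> (w * s)))))" for m
      unfolding Q_def using b(2)[OF sb, of m "\<Lambda> m (snd c x)"] s by simp
    have wb: "w * s \<in> ball 0 \<rho>" if "w \<in> ?I" for w
    proof -
      have "cmod w ^ k = 1 ^ k" using that by (simp add: norm_power[symmetric])
      then have "cmod w = 1" using power_eq_imp_eq_base[of "cmod w" k 1] pow(2) by simp
      then show ?thesis using sb by (simp add: norm_mult)
    qed
    show ?thesis
    proof
      assume 0: "\<forall>f\<in>G. f x = 0"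
      show "x \<in> \<delta> ` ball 0 \<rho>"
      proof (rule ccontr)
        assume nx: "x \<notin> \<delta> ` ball 0 \<rho>"
        define u where "u w = snd c x - snd c (\<delta> (w * s))" for w
        have une: "u w \<noteq> 0" if w: "w \<in> ?I" for w
        proof
          assume "u w = 0"
          moreover have "\<delta> (w * s) \<in> fst c" using c(2) wb[OF w] by blast
          ultimately have "x = \<delta> (w * s)" using chart_inj[OF c(1) xc, of "\<delta> (w * s)"] by (simp add: u_def)
          then show False using nx wb[OF w] by blast
        qed
        have "\<exists>w\<in>?I. \<Lambda> m (u w) = 0" if "m < N" for m
        proof -
          have "Q m (snd c x) = 0" using 0 that by (auto simp: G_def)
          then show ?thesis unfolding Qe u_def \<Lambda>(1) using finI by (simp add: prod_zero_iff)
        qed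
        then have cover: "{..<N} \<subseteq> (\<Union>w\<in>?I. {m. \<Lambda> m (u w) = 0})" by blast
        have f: "finite (\<Union>w\<in>?I. {m. \<Lambda> m (u w) = 0})" by (rule finite_UN_I[OF finI]) (use \<Lambda>(3)[OF une] in simp)
        have "N \<le> card (\<Union>w\<in>?I. {m. \<Lambda> m (u w) = 0})" using card_mono[OF f cover] by simp
        also have "\<dots> \<le> (\<Sum>w\<in>?I. card {m. \<Lambda> m (u w) = 0})" by (rule card_UN_le[OF finI])
        also have "\<dots> \<le> (\<Sum>w\<in>?I. CARD('n))" using \<Lambda>(3)[OF une] by (intro sum_mono) blast
        finally show False by (simp add: N_def)
      qed
    next
      assume "x \<in> \<delta> ` ball 0 \<rho>"
      then obtain s' where s': "s' \<in> ball 0 \<rho>" "x = \<delta> s'" by blast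
      have ss: "s' ^ k = s ^ k" using pow(1)[OF s'(1)] s s'(2) by simp
      have "\<exists>w\<in>?I. s' = w * s"
      proof (cases "s = 0")
        case True
        then have "s' = 0" using ss pow(2) by (simp add: power_0_left)
        then show ?thesis using True by (intro bexI[of _ 1]) auto
      next
        case False
        then have "(s' / s) ^ k = 1" using ss by (simp add: power_divide)
        then show ?thesis using False by (intro bexI[of _ "s' / s"]) auto
      qed
      then obtain w where "w \<in> ?I" "s' = w * s" by blast
      then have "Q m (snd c x) = 0" for m unfolding Qe using finI s'(2) by (intro prod_zero) auto
      then show "\<forall>f\<in>G. f x = 0" by (auto simp: G_def)
    qed
  qed
  have sub: "\<delta> ` ball 0 \<rho> \<subseteq> W"
  proof
    fix x assume "x \<in> \<delta> ` ball 0 \<rho>"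
    then obtain s where s: "s \<in> ball 0 \<rho>" "x = \<delta> s" by blast
    have "cmod s ^ k < \<rho> ^ k" using s(1) pow(2) by (intro power_strict_mono) auto
    then show "x \<in> W" using s pow(1)[OF s(1)] c(2) by (auto simp: W_def norm_power)
  qed
  show "analytic_subset A W (\<delta> ` ball 0 \<rho>)"
    unfolding analytic_subset_def
  proof (intro conjI ballI)
    fix p assume p: "p \<in> W"
    have "\<forall>f\<in>G. holomorphic_function_on A W f"
    proof -
      have "W \<subseteq> fst c" by (auto simp: W_def)
      then show ?thesis unfolding G_def using holomorphic_function_on_chart[OF c(1) _ Qc] by blast
    qed
    moreover have "\<delta> ` ball 0 \<rho> \<inter> W = {x \<in> W. \<forall>f\<in>G. f x = 0}" using zero by auto
    ultimately show "\<exists>V G. open V \<and> p \<in> V \<and> V \<subseteq> W \<and> finite G \<and>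
        (\<forall>f\<in>G. holomorphic_function_on A V f) \<and> \<delta> ` ball 0 \<rho> \<inter> V = {x \<in> V. \<forall>f\<in>G. f x = 0}"
      using W p by (intro exI[of _ W] exI[of _ G]) (auto simp: G_def)
  qed (rule sub)
qed

text \<open>Since \<open>\<beta> t0 \<notin> L\<close>, the curve is not constant, so some
  coordinate is a power of a suitable parameter up to a constant; the image of a small disc in that
  parameter is the separatrix.\<close>

theorem disc_local_separatrix:
  assumes \<beta>: "hol_curve (ball t0 \<epsilon>) \<beta>" and \<epsilon>: "\<epsilon> > 0" and lw: "leafwise (ball t0 \<epsilon> - {t0}) \<beta>"
    and L: "\<beta> ` (ball t0 \<epsilon> - {t0}) \<subseteq> L" "\<beta> t0 \<notin> L"
  shows "local_separatrix A L (\<beta> t0)"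
proof -
  obtain c where c: "c \<in> A" "\<beta> t0 \<in> fst c" by (rule chart_cover)
  have "open {t \<in> ball t0 \<epsilon>. \<beta> t \<in> fst c}"
    by (rule hol_curve_preimage_open[OF \<beta> open_ball chart_open(1)[OF c(1)]])
  then obtain r where r: "r > 0" "ball t0 r \<subseteq> {t \<in> ball t0 \<epsilon>. \<beta> t \<in> fst c}"
    using c(2) \<epsilon> openE by (metis (mono_tags, lifting) centre_in_ball mem_Collect_eq)
  have hol: "(\<lambda>t. snd c (\<beta> t) $ i) holomorphic_on ball t0 r" for i
    using \<beta> c(1) r(2) by (auto simp: hol_curve_def intro: holomorphic_on_subset)
  have "\<exists>i. \<not> (\<lambda>t. snd c (\<beta> t) $ i) constant_on ball t0 r"
  proof (rule ccontr)
    assume "\<not> ?thesis"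
    then have "snd c (\<beta> t) $ i = snd c (\<beta> t0) $ i" if "t \<in> ball t0 r" for i t
      using that r(1) unfolding constant_on_def by (metis centre_in_ball)
    then have "snd c (\<beta> t) = snd c (\<beta> t0)" if "t \<in> ball t0 r" for t using that by (simp add: vec_eq_iff)
    then have eq: "\<beta> t = \<beta> t0" if "t \<in> ball t0 r" for t
      using that chart_inj[OF c(1), of "\<beta> t" "\<beta> t0"] c(2) r(2) by blast
    obtain t where "t \<in> ball t0 r" "t \<noteq> t0"
      using perfect_choose_dist[of r t0] r(1) by (auto simp: dist_commute)
    then have "t \<in> ball t0 \<epsilon> - {t0}" using r(2) by blast
    then have "\<beta> t \<in> L" using L(1) by blast
    then show False using eq \<open>t \<in> ball t0 r\<close> L(2) by simp
  qed
  then obtain i where i: "\<not> (\<lambda>t. snd c (\<beta> t) $ i) constant_on ball t0 r" by blast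
  obtain k \<tau> \<rho> where \<tau>: "k > (0::nat)" "\<rho> > 0" "\<tau> holomorphic_on ball 0 \<rho>" "\<tau> 0 = t0"
    "\<tau> ` ball 0 \<rho> \<subseteq> ball t0 r" "\<And>s. s \<in> ball 0 \<rho> \<Longrightarrow> snd c (\<beta> (\<tau> s)) $ i = snd c (\<beta> t0) $ i + s ^ k"
    by (rule local_power_coordinate[OF hol r(1) i]) (rule that)
  define \<delta> where "\<delta> s = \<beta> (\<tau> s)" for s
  have \<tau>r: "\<tau> s \<in> ball t0 \<epsilon>" "\<beta> (\<tau> s) \<in> fst c" if "s \<in> ball 0 \<rho>" for s using \<tau>(5) r(2) that by blast+
  have \<tau>0: "\<tau> s \<noteq> t0" if "s \<in> ball 0 \<rho> - {0}" for s
  proof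
    assume "\<tau> s = t0"
    then show False using \<tau>(6)[of s] that by simp
  qed
  have \<delta>h: "hol_curve (ball 0 \<rho>) \<delta>"
    unfolding \<delta>_def by (rule hol_curve_compose[OF \<beta> open_ball \<tau>(3) open_ball]) (use \<tau>r in blast)
  have \<delta>l: "leafwise (ball 0 \<rho> - {0}) \<delta>"
    unfolding \<delta>_def
  proof (rule leafwise_compose[OF lw])
    show "open (ball t0 \<epsilon> - {t0})" "open (ball 0 \<rho> - {0::complex})" by (auto simp: open_delete)
    show "\<tau> holomorphic_on ball 0 \<rho> - {0}" using \<tau>(3) by (rule holomorphic_on_subset) auto
    show "\<tau> ` (ball 0 \<rho> - {0}) \<subseteq> ball t0 \<epsilon> - {t0}" using \<tau>r(1) \<tau>0 by blast
  qed
  have \<delta>c: "\<delta> ` ball 0 \<rho> \<subseteq> fst c" using \<tau>r(2) by (auto simp: \<delta>_def)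
  have pow: "snd c (\<delta> s) $ i = snd c (\<beta> t0) $ i + s ^ k" if "s \<in> ball 0 \<rho>" for s
    using \<tau>(6)[OF that] by (simp add: \<delta>_def)
  define W where "W = {x \<in> fst c. cmod (snd c x $ i - snd c (\<beta> t0) $ i) < \<rho> ^ k}"
  have W: "open W" "analytic_subset A W (\<delta> ` ball 0 \<rho>)"
    unfolding W_def using disc_image_analytic[OF \<delta>h \<tau>(2) c(1) \<delta>c pow \<tau>(1)] by auto
  have irr: "irreducible_analytic_subset A W (\<delta> ` ball 0 \<rho>)"
    by (rule disc_image_irreducible[OF W(2) \<delta>h \<tau>(2) refl])
  have dim: "analytic_dim A (\<delta> ` ball 0 \<rho>) 1"
    unfolding analytic_dim_def
    using disc_image_regular_point[OF \<delta>h \<tau>(2) \<delta>l c(1) \<delta>c pow \<tau>(1)] disc_image_regular_dim[OF \<delta>h refl] by blast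
  have q: "\<beta> t0 \<in> \<delta> ` ball 0 \<rho>" using \<tau>(2,4) by (intro image_eqI[of _ _ 0]) (auto simp: \<delta>_def)
  have "\<delta> ` ball 0 \<rho> - {\<beta> t0} \<subseteq> L"
  proof
    fix y assume "y \<in> \<delta> ` ball 0 \<rho> - {\<beta> t0}"
    then obtain s where s: "s \<in> ball 0 \<rho>" "y = \<beta> (\<tau> s)" "y \<noteq> \<beta> t0" by (auto simp: \<delta>_def)
    then have "\<tau> s \<in> ball t0 \<epsilon> - {t0}" using \<tau>r(1) by auto
    then show "y \<in> L" using s L(1) by blast
  qed
  moreover have "\<beta> t0 \<in> W" using W(2) q by (auto simp: analytic_subset_def)
  ultimately show ?thesis unfolding local_separatrix_def using W(1) irr dim q by blast
qed

end

section \<open>Limits of uniformizations\<close>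

lemma uniform_limit_compact:
  fixes f :: "nat \<Rightarrow> 'b::metric_space \<Rightarrow> 'c::metric_space"
  assumes K: "compact K"
    and loc: "\<And>t e. t \<in> K \<Longrightarrow> e > 0 \<Longrightarrow> \<exists>r>0. \<forall>\<^sub>F n in sequentially. \<forall>s\<in>ball t r. dist (f n s) (g s) < e"
  shows "uniform_limit K f g sequentially"
proof (rule uniform_limitI)
  fix e :: real assume e: "e > 0"
  have "\<forall>t\<in>K. \<exists>r. r > 0 \<and> (\<forall>\<^sub>F n in sequentially. \<forall>s\<in>ball t r. dist (f n s) (g s) < e)"
    using loc[OF _ e] by blast
  from bchoice[OF this] obtain r where r: "\<And>t. t \<in> K \<Longrightarrow> r t > 0"
    "\<And>t. t \<in> K \<Longrightarrow> \<forall>\<^sub>F n in sequentially. \<forall>s\<in>ball t (r t). dist (f n s) (g s) < e"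
    by blast
  obtain C where C: "C \<subseteq> K" "finite C" "K \<subseteq> (\<Union>t\<in>C. ball t (r t))"
    by (rule compactE_image[OF K, of K "\<lambda>t. ball t (r t)"]) (use r(1) in auto)
  have "\<forall>\<^sub>F n in sequentially. \<forall>t\<in>C. \<forall>s\<in>ball t (r t). dist (f n s) (g s) < e"
    using C(1,2) r(2) by (intro eventually_ball_finite) auto
  then show "\<forall>\<^sub>F n in sequentially. \<forall>x\<in>K. dist (f n x) (g x) < e"
    by eventually_elim (use C(3) in blast)
qed

text \<open>Rids convergence of the auxiliary metric: what is used later is that eventually a whole
  ball is mapped into a given neighbourhood.\<close>

lemma converges_locally_uniformly_local:
  assumes conv: "converges_locally_uniformly \<alpha> \<beta>" and \<beta>: "continuous_on unit_disc \<beta>"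
    and t: "t \<in> unit_disc" "open O'" "\<beta> t \<in> O'"
  obtains r where "r > 0" "ball t r \<subseteq> unit_disc" "\<beta> ` ball t r \<subseteq> O'"
    "\<forall>\<^sub>F n in sequentially. \<alpha> n ` ball t r \<subseteq> O'"
proof -
  obtain d where d: "Metric_space UNIV d" "Metric_space.mtopology UNIV d = euclidean"
    and lim: "\<And>K e. compact K \<Longrightarrow> K \<subseteq> unit_disc \<Longrightarrow> e > 0 \<Longrightarrow>
        \<forall>\<^sub>F n in sequentially. \<forall>t\<in>K. d (\<alpha> n t) (\<beta> t) < e"
    using conv unfolding converges_locally_uniformly_def by blast
  interpret Metric_space UNIV d by (rule d(1))
  obtain \<rho> where \<rho>: "\<rho> > 0" "mball (\<beta> t) \<rho> \<subseteq> O'"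
    using t(2,3) openin_mtopology[of O'] unfolding d(2) by auto
  have "openin mtopology (mball (\<beta> t) (\<rho> / 2))" by (rule openin_mball)
  then have "open (mball (\<beta> t) (\<rho> / 2))" unfolding d(2) by simp
  then have "open (unit_disc \<inter> \<beta> -` mball (\<beta> t) (\<rho> / 2))"
    using continuous_open_preimage[OF \<beta> open_ball] by blast
  moreover have "t \<in> unit_disc \<inter> \<beta> -` mball (\<beta> t) (\<rho> / 2)" using t(1) \<rho>(1) by simp
  ultimately obtain r where r: "r > 0" "cball t r \<subseteq> unit_disc \<inter> \<beta> -` mball (\<beta> t) (\<rho> / 2)"
    using open_contains_cball by metis
  have b: "d (\<beta> t) (\<beta> s) < \<rho> / 2" "s \<in> unit_disc" if "s \<in> ball t r" for s
    using r(2) that ball_subset_cball[of t r] by (auto simp: subset_iff)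
  have "\<forall>\<^sub>F n in sequentially. \<forall>s\<in>cball t r. d (\<alpha> n s) (\<beta> s) < \<rho> / 2"
    using r(2) \<rho>(1) by (intro lim) auto
  then have "\<forall>\<^sub>F n in sequentially. \<alpha> n ` ball t r \<subseteq> O'"
  proof eventually_elim
    case (elim n)
    have "\<alpha> n s \<in> O'" if s: "s \<in> ball t r" for s
    proof -
      have "d (\<beta> t) (\<alpha> n s) \<le> d (\<beta> t) (\<beta> s) + d (\<beta> s) (\<alpha> n s)" by (rule triangle) auto
      also have "d (\<beta> s) (\<alpha> n s) < \<rho> / 2" using elim s commute[of "\<beta> s"] by auto
      finally have "d (\<beta> t) (\<alpha> n s) < \<rho>" using b(1)[OF s] by linarith
      then show ?thesis using \<rho>(2) by auto
    qed
    then show ?case by blast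
  qed
  moreover have "\<beta> ` ball t r \<subseteq> O'"
  proof
    fix y assume "y \<in> \<beta> ` ball t r"
    then obtain s where s: "s \<in> ball t r" "y = \<beta> s" by blast
    have "d (\<beta> t) y < \<rho>" using b(1)[OF s(1)] \<rho>(1) unfolding s(2) by linarith
    then show "y \<in> O'" using \<rho>(2) by auto
  qed
  ultimately show thesis using that[OF r(1)] b(2) by blast
qed

text \<open>The situation after a convergent subsequence has been extracted: \<open>L\<close> is the
  leaf through the limit \<open>\<beta> 0\<close>, while the \<open>\<alpha> n\<close> may
  uniformize other leaves.\<close>

locale uniformization_limit = foliated +
  fixes \<alpha> :: "nat \<Rightarrow> complex \<Rightarrow> 'a" and \<beta> :: "complex \<Rightarrow> 'a" and L :: "'a set"
  assumes unif: "\<And>n. \<exists>L'\<in>leaves A E F. uniformization_of A E F L' (\<alpha> n)"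
    and disc: "holomorphic_disc A \<beta>" and conv: "converges_locally_uniformly \<alpha> \<beta>"
    and L: "L \<in> leaves A E F" "\<beta> 0 \<in> L" and nosep: "\<forall>q\<in>E. \<not> local_separatrix A L q"
begin

lemma \<beta>_hol: "hol_curve unit_disc \<beta>"
  using disc by (simp add: holomorphic_disc_hol_curve)

lemma \<beta>_cont: "continuous_on unit_disc \<beta>"
  using \<beta>_hol by (simp add: hol_curve_def)

lemma \<alpha>_leafwise: "leafwise unit_disc (\<alpha> n)"
  using unif[of n] uniformization_leafwise by blast

lemmas conv_local = converges_locally_uniformly_local[OF conv \<beta>_cont]

text \<open>Parameters vary with \<open>n\<close> because \<open>plaque_disc_lift\<close> evaluates
  the maps at converging lifts; there \<open>r\<close> is the subsequence chosen by Montel's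
  theorem.\<close>

lemma conv_seq:
  assumes t: "t \<in> unit_disc" and u: "u \<longlonglongrightarrow> t" and r: "strict_mono r"
  shows "(\<lambda>n. \<alpha> (r n) (u n)) \<longlonglongrightarrow> \<beta> t"
proof (rule topological_tendstoI)
  fix O' assume "open O'" "\<beta> t \<in> O'"
  then obtain \<rho> where \<rho>: "\<rho> > 0" "\<forall>\<^sub>F n in sequentially. \<alpha> n ` ball t \<rho> \<subseteq> O'"
    by (rule conv_local[OF t]) (rule that)
  have "\<forall>\<^sub>F n in sequentially. \<alpha> (r n) ` ball t \<rho> \<subseteq> O'"
    using \<rho>(2) eventually_subseq[OF r] by blast
  moreover have "\<forall>\<^sub>F n in sequentially. u n \<in> ball t \<rho>"
    using topological_tendstoD[OF u open_ball] \<rho>(1) by simp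
  ultimately show "\<forall>\<^sub>F n in sequentially. \<alpha> (r n) (u n) \<in> O'"
    by eventually_elim blast
qed

lemma conv_point: "t \<in> unit_disc \<Longrightarrow> (\<lambda>n. \<alpha> n t) \<longlonglongrightarrow> \<beta> t"
  using conv_seq[of t "\<lambda>_. t" "\<lambda>n. n"] by (simp add: strict_mono_def)

lemma conv_chart:
  assumes "t \<in> unit_disc" "c \<in> A" "\<beta> t \<in> fst c"
  shows "(\<lambda>n. snd c (\<alpha> n t)) \<longlonglongrightarrow> snd c (\<beta> t)"
  using continuous_on_tendsto_compose[OF chart_cont[OF assms(2)] conv_point[OF assms(1)] assms(3)]
    topological_tendstoD[OF conv_point[OF assms(1)] chart_open(1)[OF assms(2)] assms(3)] by simp

section \<open>The singular parameters of the limit\<close>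

definition T where "T = {t \<in> unit_disc. \<beta> t \<in> E}"

lemma zero_notin_T: "0 \<notin> T"
  using L leaf_subset by (auto simp: T_def)

lemma open_off_T: "open (unit_disc - T)"
proof -
  have "open {t \<in> unit_disc. \<beta> t \<in> - E}"
    by (rule hol_curve_preimage_open[OF \<beta>_hol open_ball open_compl_E])
  moreover have "{t \<in> unit_disc. \<beta> t \<in> - E} = unit_disc - T" by (auto simp: T_def)
  ultimately show ?thesis by simp
qed

lemma \<beta>_leafwise_off_T: "leafwise (unit_disc - T) \<beta>"
proof (rule leafwiseI_const[OF hol_curve_subset[OF \<beta>_hol] open_off_T])
  fix t assume t: "t \<in> unit_disc - T"
  then have "\<beta> t \<notin> E" by (auto simp: T_def)
  then obtain c i where c: "fbox c i" "\<beta> t \<in> fst c" using flow_box_exists by blast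
  note cA = fboxD(1)[OF c(1)]
  have tD: "t \<in> unit_disc" using t by blast
  obtain r where r: "r > 0" "ball t r \<subseteq> unit_disc" "\<beta> ` ball t r \<subseteq> fst c"
    "\<forall>\<^sub>F n in sequentially. \<alpha> n ` ball t r \<subseteq> fst c"
    by (rule conv_local[OF tD chart_open(1)[OF cA] c(2)]) (rule that)
  have sub: "ball t r \<subseteq> unit_disc - T" using r(2,3) fboxD(2)[OF c(1)] by (auto simp: T_def)
  \<comment> \<open>For large \<open>n\<close> each transverse coordinate of
    \<open>\<alpha> n\<close> is constant on the ball; pointwise convergence hands this on to
    \<open>\<beta>\<close>.\<close>
  have eq: "snd c (\<beta> s) $ j = snd c (\<beta> t) $ j" if s: "s \<in> ball t r" and j: "j \<noteq> i" for s j
  proof (rule LIMSEQ_unique)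
    have "(\<lambda>n. snd c (\<alpha> n s)) \<longlonglongrightarrow> snd c (\<beta> s)" using s r(2,3) by (intro conv_chart cA) auto
    then show "(\<lambda>n. snd c (\<alpha> n s) $ j) \<longlonglongrightarrow> snd c (\<beta> s) $ j" by (rule tendsto_vec_nth)
    have "(\<lambda>n. snd c (\<alpha> n t) $ j) \<longlonglongrightarrow> snd c (\<beta> t) $ j"
      by (intro tendsto_vec_nth conv_chart cA tD c(2))
    then show "(\<lambda>n. snd c (\<alpha> n s) $ j) \<longlonglongrightarrow> snd c (\<beta> t) $ j"
    proof (rule Lim_transform_eventually)
      show "\<forall>\<^sub>F n in sequentially. snd c (\<alpha> n t) $ j = snd c (\<alpha> n s) $ j"
        using r(4)
      proof eventually_elim
        case (elim n)
        then show ?case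
          using leafwise_const[OF \<alpha>_leafwise open_ball c(1) r(2) open_ball connected_ball elim, of t s j] s r(1) j by simp
      qed
    qed
  qed
  show "\<exists>c i N. fbox c i \<and> open N \<and> t \<in> N \<and> N \<subseteq> unit_disc - T \<and> \<beta> ` N \<subseteq> fst c \<and>
       (\<forall>s\<in>N. \<forall>j. j \<noteq> i \<longrightarrow> snd c (\<beta> s) $ j = snd c (\<beta> t) $ j)"
  proof (intro exI conjI ballI allI impI)
    show "t \<in> ball t r" using r(1) by simp
  qed (use c(1) r(3) sub eq in auto)
qed auto

text \<open>A limit point of \<open>T\<close> would, by the identity theorem for the equations of
  \<open>E\<close>, force \<open>\<beta>\<close> into \<open>E\<close> everywhere, against
  \<open>\<beta> 0 \<in> L\<close>.\<close>

lemma T_sparse: "T sparse_in unit_disc"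
  unfolding sparse_in_open[OF open_ball]
proof (intro ballI notI)
  fix t assume t: "t \<in> unit_disc" and lim: "t islimpt T"
  have EA: "analytic_subset A UNIV E" using sh by (simp add: shfc_def)
  have "\<beta> t \<in> E"
  proof (rule ccontr)
    assume "\<beta> t \<notin> E"
    then have "t \<in> unit_disc - T" using t by (auto simp: T_def)
    then obtain s where "s \<in> T" "s \<in> unit_disc - T" using lim open_off_T unfolding islimpt_def by blast
    then show False by blast
  qed
  have "\<exists>V G. open V \<and> \<beta> t \<in> V \<and> V \<subseteq> UNIV \<and> finite G \<and>
        (\<forall>f\<in>G. holomorphic_function_on A V f) \<and> E \<inter> V = {x \<in> V. \<forall>f\<in>G. f x = 0}"
    using EA unfolding analytic_subset_def by blast
  then obtain V G where V: "open V" "\<beta> t \<in> V"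
      "\<forall>f\<in>G. holomorphic_function_on A V f" "E \<inter> V = {x \<in> V. \<forall>f\<in>G. f x = 0}" by blast
  obtain r where r: "r > 0" "ball t r \<subseteq> unit_disc" "\<beta> ` ball t r \<subseteq> V"
    by (rule conv_local[OF t V(1,2)]) (rule that)
  have "f (\<beta> s) = 0" if f: "f \<in> G" and s: "s \<in> ball t r" for f s
  proof -
    have h: "(\<lambda>s. f (\<beta> s)) holomorphic_on ball t r"
      by (rule holomorphic_function_on_curve[OF _ hol_curve_subset[OF \<beta>_hol r(2)] open_ball r(3)]) (use V f in blast)
    have "t islimpt (ball t r \<inter> T)"
      using islimpt_Int_eventually[OF lim eventually_at_in_open'[OF open_ball, of t t r]] r(1)
      by (simp add: Int_commute)
    then show ?thesis
    proof (rule analytic_continuation[OF h open_ball connected_ball, rotated 2])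
      show "f (\<beta> z) = 0" if "z \<in> ball t r \<inter> T" for z
      proof -
        have "\<beta> z \<in> E \<inter> V" using that r(3) by (auto simp: T_def)
        then show ?thesis using V(4) f by auto
      qed
    qed (use r(1) s in auto)
  qed
  then have "ball t r \<subseteq> {s \<in> unit_disc. \<beta> s \<in> E}" using V(4) r(2,3) by blast
  then have "\<beta> ` unit_disc \<subseteq> E"
    using analytic_preimage_interior[OF EA \<beta>_hol _ open_ball[of t r]] r(1) by auto
  then have "\<beta> 0 \<in> E" by (simp add: image_subset_iff)
  then show False using zero_notin_T by (simp add: T_def)
qed

text \<open>A sparse set does not disconnect the disc, and a leafwise curve on a connected open set
  stays in the leaf where it starts.\<close>

lemma \<beta>_in_L_off_T: "\<beta> ` (unit_disc - T) \<subseteq> L"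
proof (rule leafwise_in_leaf[OF \<beta>_leafwise_off_T open_off_T _ _ L])
  show "connected (unit_disc - T)"
    using sparse_imp_connected[OF _ connected_ball open_ball T_sparse] by simp
  show "0 \<in> unit_disc - T" using zero_notin_T by simp
qed

lemma T_empty: "T = {}"
proof (rule ccontr)
  assume "T \<noteq> {}"
  then obtain t where t: "t \<in> T" by blast
  have tD: "t \<in> unit_disc" using t by (simp add: T_def)
  obtain B where B: "open B" "t \<in> B" "\<forall>y\<in>B. y \<noteq> t \<longrightarrow> y \<notin> T"
    by (rule sparse_in_not_in[OF T_sparse tD])
  obtain \<epsilon> where \<epsilon>: "\<epsilon> > 0" "ball t \<epsilon> \<subseteq> unit_disc \<inter> B"
    using openE[OF open_Int[OF open_ball B(1)], of t 0 1] tD B(2) by blast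
  have sub: "ball t \<epsilon> - {t} \<subseteq> unit_disc - T" using \<epsilon>(2) B(3) by blast
  have tE: "\<beta> t \<in> E" using t by (simp add: T_def)
  have "local_separatrix A L (\<beta> t)"
  proof (rule disc_local_separatrix[OF hol_curve_subset[OF \<beta>_hol] \<epsilon>(1)])
    show "ball t \<epsilon> \<subseteq> unit_disc" using \<epsilon>(2) by blast
    show "leafwise (ball t \<epsilon> - {t}) \<beta>" by (rule leafwise_subset[OF \<beta>_leafwise_off_T sub])
    show "\<beta> ` (ball t \<epsilon> - {t}) \<subseteq> L" using \<beta>_in_L_off_T sub by blast
    show "\<beta> t \<notin> L" using tE leaf_subset[OF L(1)] by blast
  qed
  then show False using nosep tE by blast
qed

section \<open>Lifting through the limit\<close>

lemma \<beta>_leafwise: "leafwise unit_disc \<beta>"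
  using \<beta>_leafwise_off_T by (simp add: T_empty)

lemma \<beta>_in_L: "\<beta> ` unit_disc \<subseteq> L"
  using \<beta>_in_L_off_T by (simp add: T_empty)

text \<open>Plaque discs through \<open>\<beta> s\<close> lift through \<open>\<beta>\<close>: approximate them by plaque discs through
  \<open>\<alpha> n s\<close>, lift these through the coverings \<open>\<alpha> n\<close>, and apply Montel's theorem to the lifts.\<close>

lemma plaque_disc_lift:
  assumes s: "s \<in> unit_disc" and c: "fbox c i" "\<beta> s \<in> fst c"
    and \<delta>: "\<delta> > 0" "cmod (snd c (\<beta> s) $ i) + \<delta> < 1"
  obtains \<sigma> where "\<sigma> holomorphic_on unit_disc" "\<sigma> ` unit_disc \<subseteq> unit_disc" "\<sigma> 0 = s"
    "\<And>\<xi>. \<xi> \<in> unit_disc \<Longrightarrow> \<beta> (\<sigma> \<xi>) = plaque_disc c i (\<beta> s) (snd c (\<beta> s) $ i + of_real \<delta> * \<xi>)"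
proof -
  note cA = fboxD(1)[OF c(1)]
  define x where "x n = \<alpha> n s" for n
  \<comment> \<open>The plaque disc of radius \<open>\<delta>\<close> about \<open>y\<close>,
    reparametrized so that \<open>y\<close> is the value at 0.\<close>
  define D where "D y \<xi> = plaque_disc c i y (snd c y $ i + of_real \<delta> * \<xi>)" for y \<xi>
  define good where "good n \<longleftrightarrow> x n \<in> fst c \<and> cmod (snd c (x n) $ i) + \<delta> < 1" for n
  have in1: "z + of_real \<delta> * \<xi> \<in> unit_disc" if "cmod z + \<delta> < 1" "\<xi> \<in> unit_disc" for z \<xi>
  proof -
    have "cmod (z + of_real \<delta> * \<xi>) \<le> cmod z + \<delta> * cmod \<xi>"
      using norm_triangle_ineq[of z "of_real \<delta> * \<xi>"] \<delta>(1) by (simp add: norm_mult)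
    also have "\<dots> \<le> cmod z + \<delta>" using that(2) \<delta>(1) by (simp add: mult_left_le)
    finally show ?thesis using that(1) by simp
  qed
  have xlim: "x \<longlonglongrightarrow> \<beta> s" unfolding x_def by (rule conv_point[OF s])
  have sxlim: "(\<lambda>n. snd c (x n)) \<longlonglongrightarrow> snd c (\<beta> s)" unfolding x_def by (rule conv_chart[OF s cA c(2)])
  have ev: "\<forall>\<^sub>F n in sequentially. good n"
  proof -
    have "\<forall>\<^sub>F n in sequentially. x n \<in> fst c"
      using topological_tendstoD[OF xlim chart_open(1)[OF cA] c(2)] .
    moreover have "(\<lambda>n. cmod (snd c (x n) $ i) + \<delta>) \<longlonglongrightarrow> cmod (snd c (\<beta> s) $ i) + \<delta>"
      by (intro tendsto_intros sxlim)
    then have "\<forall>\<^sub>F n in sequentially. cmod (snd c (x n) $ i) + \<delta> < 1"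
      using \<delta>(2) by (rule order_tendstoD)
    ultimately show ?thesis by eventually_elim (simp add: good_def)
  qed
  have "\<exists>\<sigma>. \<sigma> holomorphic_on unit_disc \<and> \<sigma> ` unit_disc \<subseteq> unit_disc \<and> \<sigma> 0 = s \<and>
      (good n \<longrightarrow> (\<forall>\<xi>\<in>unit_disc. \<alpha> n (\<sigma> \<xi>) = D (x n) \<xi>))" for n
  proof (cases "good n")
    case False
    \<comment> \<open>Default for the finitely many \<open>n\<close> whose \<open>x n\<close> lies
      outside the box or too close to its boundary; it keeps the whole sequence usable for Montel's
      theorem.\<close>
    then show ?thesis using s by (intro exI[of _ "\<lambda>_. s"]) auto
  next
    case True
    have lw: "leafwise unit_disc (D (x n))"
      unfolding D_def
    proof (rule leafwise_compose[OF plaque_disc_props(4)[OF c(1)] open_ball _ open_ball])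
      show "x n \<in> fst c" using True by (simp add: good_def)
      show "(\<lambda>\<xi>. snd c (x n) $ i + of_real \<delta> * \<xi>) holomorphic_on unit_disc" by (intro holomorphic_intros)
      show "(\<lambda>\<xi>. snd c (x n) $ i + of_real \<delta> * \<xi>) ` unit_disc \<subseteq> unit_disc"
        using in1 True by (auto simp only: good_def)
    qed
    have D0: "D (x n) 0 = \<alpha> n s"
      using plaque_disc_props(3)[OF c(1)] True by (simp add: D_def good_def x_def)
    obtain L' where L': "L' \<in> leafs" "uniformization_of A E F L' (\<alpha> n)" using unif by blast
    have "\<alpha> n s \<in> L'" using uniformization_image[OF L'(2,1)] s by blast
    then have "D (x n) ` unit_disc \<subseteq> L'"
      using leafwise_in_leaf[OF lw open_ball connected_ball _ L'(1), of 0] D0 by simp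
    from uniformization_lift[OF L'(2,1) lw this s] D0
    obtain \<sigma> where "\<sigma> holomorphic_on unit_disc" "\<sigma> 0 = s"
        "\<And>t. t \<in> unit_disc \<Longrightarrow> \<sigma> t \<in> unit_disc \<and> \<alpha> n (\<sigma> t) = D (x n) t" by metis
    then show ?thesis by (intro exI[of _ \<sigma>]) auto
  qed
  then obtain \<sigma> where \<sigma>: "\<And>n. \<sigma> n holomorphic_on unit_disc" "\<And>n. \<sigma> n ` unit_disc \<subseteq> unit_disc" "\<And>n. \<sigma> n 0 = s"
      "\<And>n \<xi>. good n \<Longrightarrow> \<xi> \<in> unit_disc \<Longrightarrow> \<alpha> n (\<sigma> n \<xi>) = D (x n) \<xi>" by metis
  obtain \<tau> r where \<tau>: "\<tau> holomorphic_on unit_disc" "strict_mono (r :: nat \<Rightarrow> nat)"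
      "\<And>\<xi>. \<xi> \<in> unit_disc \<Longrightarrow> (\<lambda>n. \<sigma> (r n) \<xi>) \<longlonglongrightarrow> \<tau> \<xi>"
  proof (rule Montel[OF open_ball, of "range \<sigma>" 0 1 \<sigma>])
    show "\<exists>B. \<forall>h\<in>range \<sigma>. \<forall>z\<in>K. cmod (h z) \<le> B" if "K \<subseteq> unit_disc" for K
    proof (intro exI[of _ 1] ballI)
      fix h z assume "h \<in> range \<sigma>" "z \<in> K"
      then have "h z \<in> unit_disc" using \<sigma>(2) that by blast
      then show "cmod (h z) \<le> 1" by simp
    qed
  qed (use \<sigma>(1) in auto)
  have \<tau>0: "\<tau> 0 = s" using LIMSEQ_unique[OF \<tau>(3)[of 0]] \<sigma>(3) by simp
  have \<tau>1: "cmod (\<tau> \<xi>) \<le> 1" if "\<xi> \<in> unit_disc" for \<xi>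
  proof (rule Lim_norm_ubound[OF _ \<tau>(3)[OF that]])
    have "cmod (\<sigma> (r n) \<xi>) \<le> 1" for n
    proof -
      have "\<sigma> (r n) \<xi> \<in> unit_disc" using \<sigma>(2) that by blast
      then show ?thesis by simp
    qed
    then show "\<forall>\<^sub>F n in sequentially. cmod (\<sigma> (r n) \<xi>) \<le> 1" by simp
  qed simp
  \<comment> \<open>So far the limit is only known to take values in the closed disc; unless it is
    constant, hence equal to \<open>s\<close>, its image is open and so avoids the boundary
    circle.\<close>
  have \<tau>D: "\<tau> ` unit_disc \<subseteq> unit_disc"
  proof (cases "\<tau> constant_on unit_disc")
    case True
    then have "\<tau> \<xi> = s" if "\<xi> \<in> unit_disc" for \<xi>
      using that \<tau>0 unfolding constant_on_def by (metis centre_in_ball zero_less_one)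
    then show ?thesis using s by auto
  next
    case False
    have "open (\<tau> ` unit_disc)"
      by (rule open_mapping_thm[OF \<tau>(1) open_ball connected_ball open_ball order_refl False])
    moreover have "\<tau> ` unit_disc \<subseteq> cball 0 1" using \<tau>1 by auto
    ultimately have "\<tau> ` unit_disc \<subseteq> interior (cball 0 1)" by (rule interior_maximal[rotated])
    then show ?thesis by simp
  qed
  show thesis
  proof (rule that[OF \<tau>(1) \<tau>D \<tau>0])
    fix \<xi> :: complex assume \<xi>: "\<xi> \<in> unit_disc"
    have "\<tau> \<xi> \<in> unit_disc" using \<tau>D \<xi> by blast
    then have l1: "(\<lambda>n. \<alpha> (r n) (\<sigma> (r n) \<xi>)) \<longlonglongrightarrow> \<beta> (\<tau> \<xi>)"
      by (rule conv_seq[OF _ \<tau>(3)[OF \<xi>] \<tau>(2)])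
    define z where "z y = (\<chi> j. if j = i then snd c y $ i + of_real \<delta> * \<xi> else snd c y $ j)" for y
    have zlim: "(\<lambda>n. z (x n)) \<longlonglongrightarrow> z (\<beta> s)"
    proof (rule vec_tendstoI)
      fix j
      have "(\<lambda>n. snd c (x n) $ i + of_real \<delta> * \<xi>) \<longlonglongrightarrow> snd c (\<beta> s) $ i + of_real \<delta> * \<xi>"
        "(\<lambda>n. snd c (x n) $ j) \<longlonglongrightarrow> snd c (\<beta> s) $ j"
        by (intro tendsto_intros sxlim)+
      then show "(\<lambda>n. z (x n) $ j) \<longlonglongrightarrow> z (\<beta> s) $ j" by (cases "j = i") (simp_all add: z_def)
    qed
    have zin: "z y \<in> snd c ` fst c" if y: "y \<in> fst c" "cmod (snd c y $ i) + \<delta> < 1" for y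
    proof -
      have "cmod (snd c y $ j) < 1" for j using y(1) fboxD(3)[OF c(1)] by blast
      moreover have "cmod (snd c y $ i + of_real \<delta> * \<xi>) < 1" using in1[OF y(2) \<xi>] by simp
      ultimately show ?thesis unfolding fboxD(3)[OF c(1)] by (simp add: z_def)
    qed
    have "(\<lambda>n. chart_inv c (z (x n))) \<longlonglongrightarrow> chart_inv c (z (\<beta> s))"
      by (rule continuous_on_tendsto_compose[OF chart_inv_cont[OF cA] zlim zin[OF c(2) \<delta>(2)]])
        (use ev in \<open>auto elim!: eventually_mono simp: good_def zin\<close>)
    then have "(\<lambda>n. D (x n) \<xi>) \<longlonglongrightarrow> D (\<beta> s) \<xi>" by (simp add: D_def plaque_disc_def z_def)
    then have "(\<lambda>n. D (x (r n)) \<xi>) \<longlonglongrightarrow> D (\<beta> s) \<xi>"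
      using LIMSEQ_subseq_LIMSEQ[OF _ \<tau>(2)] by (auto simp: o_def)
    moreover have "\<forall>\<^sub>F n in sequentially. D (x (r n)) \<xi> = \<alpha> (r n) (\<sigma> (r n) \<xi>)"
      using eventually_subseq[OF \<tau>(2) ev] by eventually_elim (simp add: \<sigma>(4)[OF _ \<xi>])
    ultimately have "(\<lambda>n. \<alpha> (r n) (\<sigma> (r n) \<xi>)) \<longlonglongrightarrow> D (\<beta> s) \<xi>"
      by (rule Lim_transform_eventually)
    then show "\<beta> (\<tau> \<xi>) = plaque_disc c i (\<beta> s) (snd c (\<beta> s) $ i + of_real \<delta> * \<xi>)"
      using LIMSEQ_unique[OF l1] by (simp add: D_def)
  qed
qed

text \<open>With a lift \<open>\<sigma>\<close> of a plaque disc, \<open>\<beta>\<close> after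
  \<open>\<sigma>\<close> moves along the \<open>i\<close>-th coordinate with speed
  \<open>\<delta>\<close>; by the chain rule the derivative of \<open>\<beta>\<close> cannot
  vanish.\<close>

lemma \<beta>_immersed: "immersed \<beta>"
  unfolding immersed_def
proof (intro ballI allI impI)
  fix s :: complex and c i assume s: "s \<in> unit_disc" and c: "fbox c i" "\<beta> s \<in> fst c"
  note cA = fboxD(1)[OF c(1)]
  have "cmod (snd c (\<beta> s) $ i) < 1" using c(2) fboxD(3)[OF c(1)] by blast
  define \<delta> where "\<delta> = (1 - cmod (snd c (\<beta> s) $ i)) / 2"
  have \<delta>: "\<delta> > 0" "cmod (snd c (\<beta> s) $ i) + \<delta> < 1" using \<open>_ < 1\<close> by (auto simp: \<delta>_def field_simps)
  obtain \<sigma> where \<sigma>: "\<sigma> holomorphic_on unit_disc" "\<sigma> ` unit_disc \<subseteq> unit_disc" "\<sigma> 0 = s"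
    "\<And>\<xi>. \<xi> \<in> unit_disc \<Longrightarrow> \<beta> (\<sigma> \<xi>) = plaque_disc c i (\<beta> s) (snd c (\<beta> s) $ i + of_real \<delta> * \<xi>)"
    by (rule plaque_disc_lift[OF s c \<delta>]) (rule that)
  define f where "f \<xi> = \<beta> (\<sigma> \<xi>)" for \<xi>
  have "velocity c f 0 = deriv \<sigma> 0 *s velocity c \<beta> (\<sigma> 0)"
    by (rule velocity_compose[OF \<beta>_hol open_ball \<sigma>(1) open_ball \<sigma>(2)]) (use \<sigma>(3) c cA in \<open>auto simp: f_def\<close>)
  moreover have "velocity c f 0 $ i = of_real \<delta>"
  proof -
    have "((\<lambda>\<xi>. snd c (\<beta> s) $ i + of_real \<delta> * \<xi>) has_field_derivative of_real \<delta>) (at 0)"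
      by (auto intro!: derivative_eq_intros)
    then have "((\<lambda>\<xi>. snd c (f \<xi>) $ i) has_field_derivative of_real \<delta>) (at 0)"
    proof (rule has_field_derivative_transform_within_open[OF _ open_ball[of 0 1]])
      fix \<xi> :: complex assume \<xi>: "\<xi> \<in> unit_disc"
      have "cmod (snd c (\<beta> s) $ i + of_real \<delta> * \<xi>) \<le> cmod (snd c (\<beta> s) $ i) + \<delta> * cmod \<xi>"
        using norm_triangle_ineq[of "snd c (\<beta> s) $ i" "of_real \<delta> * \<xi>"] \<delta>(1) by (simp add: norm_mult)
      also have "\<dots> \<le> cmod (snd c (\<beta> s) $ i) + \<delta>" using \<xi> \<delta>(1) by (simp add: mult_left_le)
      finally have "snd c (\<beta> s) $ i + of_real \<delta> * \<xi> \<in> unit_disc" using \<delta>(2) by simp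
      from plaque_disc_props(2)[OF c this, of i]
      show "snd c (\<beta> s) $ i + of_real \<delta> * \<xi> = snd c (f \<xi>) $ i" by (simp add: f_def \<sigma>(4)[OF \<xi>])
    qed simp
    then show ?thesis by (simp add: velocity_def DERIV_imp_deriv)
  qed
  ultimately show "velocity c \<beta> s $ i \<noteq> 0" using \<sigma>(3) \<delta>(1) by auto
qed

text \<open>\<open>disc_lift\<close> asks for one neighbourhood of \<open>b\<close> that serves all
  points over it. It exists because the size in \<open>plaque_disc_lift\<close> depends on the value
  of \<open>\<beta>\<close> alone, which is \<open>f t\<close> for all points in question.\<close>

lemma lift_through_\<beta>:
  assumes f: "leafwise unit_disc f" "f 0 = \<beta> 0"
  obtains G where "G holomorphic_on unit_disc" "G 0 = 0"
    "\<And>t. t \<in> unit_disc \<Longrightarrow> G t \<in> unit_disc \<and> \<beta> (G t) = f t"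
proof -
  have loc: "\<exists>\<epsilon>>0. \<forall>t\<in>ball b \<epsilon> \<inter> unit_disc. \<forall>x\<in>unit_disc. \<beta> x = f t \<longrightarrow>
      (\<exists>h. (continuous_on (ball b \<epsilon> \<inter> unit_disc) h \<and>
         (\<forall>u\<in>ball b \<epsilon> \<inter> unit_disc. h u \<in> unit_disc \<and> \<beta> (h u) = f u)) \<and> h t = x)"
    if b: "b \<in> unit_disc" for b
  proof -
    obtain c i where c: "fbox c i" "f b \<in> fst c"
      using flow_box_exists[OF leafwise_notin_E[OF f(1) b]] by blast
    note cA = fboxD(1)[OF c(1)]
    obtain r where r: "r > 0" "ball b r \<subseteq> unit_disc" "f ` ball b r \<subseteq> plaque c i (f b)"
      "(\<lambda>s. snd c (f s) $ i) holomorphic_on ball b r"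
      by (rule leafwise_component[OF f(1) open_ball c(1) b c(2)]) (rule that)
    define a where "a s = snd c (f s) $ i" for s
    have ca: "continuous_on (ball b r) a"
      unfolding a_def using r(4) by (rule holomorphic_on_imp_continuous_on)
    have ab: "cmod (a b) < 1" using c(2) fboxD(3)[OF c(1)] by (auto simp: a_def)
    \<comment> \<open>A third of the distance to the unit circle: \<open>a t\<close> is within
      \<open>\<delta>\<close> of \<open>a b\<close>, and a disc of radius \<open>\<delta>\<close>
      about \<open>a t\<close> still has room.\<close>
    define \<delta> where "\<delta> = (1 - cmod (a b)) / 3"
    have \<delta>: "\<delta> > 0" using ab by (simp add: \<delta>_def)
    have "open (ball b r \<inter> a -` ball (a b) (\<delta> / 2))"
      using continuous_open_preimage[OF ca open_ball open_ball] .
    then obtain \<epsilon> where \<epsilon>: "\<epsilon> > 0" "ball b \<epsilon> \<subseteq> ball b r \<inter> a -` ball (a b) (\<delta> / 2)"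
      using openE[of _ b] r(1) \<delta> by (metis IntI centre_in_ball half_gt_zero vimageI)
    have aa: "cmod (a u - a t) < \<delta>" if "u \<in> ball b \<epsilon>" "t \<in> ball b \<epsilon>" for u t
    proof -
      have "dist (a b) (a u) < \<delta> / 2" "dist (a b) (a t) < \<delta> / 2" using that \<epsilon>(2) by auto
      then show ?thesis using dist_triangle3[of "a u" "a t" "a b"] by (simp add: dist_norm)
    qed
    show ?thesis
    proof (intro exI[of _ \<epsilon>] conjI ballI impI)
      fix t x assume t: "t \<in> ball b \<epsilon> \<inter> unit_disc" and x: "x \<in> unit_disc" "\<beta> x = f t"
      have ft: "f t \<in> plaque c i (f b)" using t \<epsilon>(2) r(3) by blast
      then have tc: "\<beta> x \<in> fst c" using x by (simp add: plaque_def)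
      have "cmod (a t) + \<delta> < 1"
      proof -
        have "cmod (a t - a b) < \<delta>" using aa[of t b] t \<epsilon>(1) by simp
        moreover have "cmod (a t) \<le> cmod (a b) + cmod (a t - a b)" by (rule norm_triangle_sub)
        moreover have "3 * \<delta> = 1 - cmod (a b)" by (simp add: \<delta>_def)
        ultimately show ?thesis using \<delta> by linarith
      qed
      then have \<delta>1: "cmod (snd c (\<beta> x) $ i) + \<delta> < 1" by (simp add: a_def x(2))
      obtain \<sigma> where \<sigma>: "\<sigma> holomorphic_on unit_disc" "\<sigma> ` unit_disc \<subseteq> unit_disc" "\<sigma> 0 = x"
        "\<And>\<xi>. \<xi> \<in> unit_disc \<Longrightarrow> \<beta> (\<sigma> \<xi>) = plaque_disc c i (\<beta> x) (snd c (\<beta> x) $ i + of_real \<delta> * \<xi>)"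
        by (rule plaque_disc_lift[OF x(1) c(1) tc \<delta> \<delta>1]) (rule that)
      \<comment> \<open>The section through \<open>x\<close>: the lifted plaque disc, evaluated at
        the parameter that corresponds to the point \<open>f u\<close>.\<close>
      define h where "h u = \<sigma> ((a u - a t) / of_real \<delta>)" for u
      have arg: "(a u - a t) / of_real \<delta> \<in> unit_disc" if "u \<in> ball b \<epsilon>" for u
        using aa[OF that, of t] t \<delta> by (simp add: norm_divide)
      have "continuous_on (ball b \<epsilon> \<inter> unit_disc) h"
        unfolding h_def
      proof (rule continuous_on_compose2[OF holomorphic_on_imp_continuous_on[OF \<sigma>(1)]])
        have "continuous_on (ball b \<epsilon> \<inter> unit_disc) a"
          using ca \<epsilon>(2) by (auto elim!: continuous_on_subset)
        then show "continuous_on (ball b \<epsilon> \<inter> unit_disc) (\<lambda>u. (a u - a t) / of_real \<delta>)"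
          using \<delta> by (intro continuous_intros) auto
      qed (use arg in blast)
      moreover have "h u \<in> unit_disc \<and> \<beta> (h u) = f u" if u: "u \<in> ball b \<epsilon> \<inter> unit_disc" for u
      proof
        have ua: "(a u - a t) / of_real \<delta> \<in> unit_disc" using arg u by blast
        then show "h u \<in> unit_disc" using \<sigma>(2) unfolding h_def by blast
        have fu: "f u \<in> plaque c i (f b)" using u \<epsilon>(2) r(3) by blast
        have "\<beta> (h u) = plaque_disc c i (f t) (a u)"
          using \<sigma>(4)[OF ua] \<delta> by (simp add: h_def x(2) a_def)
        also have "\<dots> = plaque_disc c i (f u) (a u)"
        proof -
          have "(\<chi> j. if j = i then a u else snd c (f t) $ j) = (\<chi> j. if j = i then a u else snd c (f u) $ j)"
            using ft fu by (auto simp: vec_eq_iff plaque_def)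
          then show ?thesis by (simp add: plaque_disc_def)
        qed
        also have "\<dots> = f u"
          unfolding a_def by (rule plaque_disc_props(3)[OF c(1)]) (use fu in \<open>simp add: plaque_def\<close>)
        finally show "\<beta> (h u) = f u" .
      qed
      moreover have "h t = x" by (simp add: h_def \<sigma>(3))
      ultimately show "\<exists>h. (continuous_on (ball b \<epsilon> \<inter> unit_disc) h \<and>
         (\<forall>u\<in>ball b \<epsilon> \<inter> unit_disc. h u \<in> unit_disc \<and> \<beta> (h u) = f u)) \<and> h t = x" by blast
    qed (use \<epsilon>(1) in simp)
  qed
  obtain G where G: "continuous_on unit_disc G \<and> (\<forall>u\<in>unit_disc. G u \<in> unit_disc \<and> \<beta> (G u) = f u)" "G 0 = 0"
    by (rule disc_lift[OF immersed_locally_injective[OF \<beta>_leafwise \<beta>_immersed] loc, of 0]) (use f(2) in auto)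
  then show thesis
    using lift_holomorphic[OF \<beta>_leafwise \<beta>_immersed leafwise_hol_curve[OF f(1)]] that by blast
qed

section \<open>Convergence of the modulus\<close>

lemma modulus_limit:
  assumes h: "hyperbolic_foliation A E F" and g: "hermitian_metric A g" and c: "c \<in> A" "\<beta> 0 \<in> fst c"
  shows "modulus_of_uniformization A E F g (\<beta> 0) = metric_length g c (\<beta> 0) (velocity c \<beta> 0)"
proof -
  have "\<beta> 0 \<notin> E" using L leaf_subset by blast
  then obtain L' \<alpha>' where u: "L' \<in> leafs" "\<beta> 0 \<in> L'" "uniformization_of A E F L' \<alpha>'" "\<alpha>' 0 = \<beta> 0"
    using centered_uniformization[OF h] by blast
  have "L' = L" using leaf_unique[OF u(1) L(1) u(2) L(2)] .
  note lw = uniformization_leafwise[OF u(3,1)]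
  obtain G where G: "G holomorphic_on unit_disc" "G 0 = 0"
    "\<And>t. t \<in> unit_disc \<Longrightarrow> G t \<in> unit_disc \<and> \<beta> (G t) = \<alpha>' t"
    by (rule lift_through_\<beta>[OF lw u(4)]) (rule that)
  obtain \<phi> where \<phi>: "\<phi> holomorphic_on unit_disc" "\<phi> 0 = 0"
    "\<And>t. t \<in> unit_disc \<Longrightarrow> \<phi> t \<in> unit_disc \<and> \<alpha>' (\<phi> t) = \<beta> t"
    by (rule uniformization_lift[OF u(3,1) \<beta>_leafwise, of 0]) (use \<beta>_in_L \<open>L' = L\<close> u(4) in \<open>auto intro: that\<close>)
  have "metric_length g c (\<beta> 0) (velocity c \<alpha>' 0) \<le> metric_length g c (\<beta> 0) (velocity c \<beta> 0)"
    by (rule lift_velocity_le[OF g \<beta>_hol c G])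
  moreover have "metric_length g c (\<beta> 0) (velocity c \<beta> 0) \<le> metric_length g c (\<beta> 0) (velocity c \<alpha>' 0)"
    using lift_velocity_le[OF g leafwise_hol_curve[OF lw] c(1) _ \<phi>] c(2) u(4) by simp
  ultimately show ?thesis using modulus_eq[OF h g u(1,3,4) c] by simp
qed

lemma velocity_conv:
  assumes c: "c \<in> A" "\<beta> 0 \<in> fst c"
  shows "(\<lambda>n. velocity c (\<alpha> n) 0) \<longlonglongrightarrow> velocity c \<beta> 0"
proof (rule vec_tendstoI)
  fix i
  obtain r where r: "r > 0" "ball 0 r \<subseteq> unit_disc" "\<beta> ` ball 0 r \<subseteq> fst c"
    "\<forall>\<^sub>F n in sequentially. \<alpha> n ` ball 0 r \<subseteq> fst c"
    by (rule conv_local[OF _ chart_open(1)[OF c(1)] c(2)]) (auto intro: that)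
  \<comment> \<open>From \<open>N\<close> on the maps send the ball into the chart; shifting the
    index by \<open>N\<close> gives coordinate functions that are holomorphic for every
    index.\<close>
  obtain N where N: "\<And>n. n \<ge> N \<Longrightarrow> \<alpha> n ` ball 0 r \<subseteq> fst c" using r(4) by (auto simp: eventually_sequentially)
  define f where "f n s = snd c (\<alpha> (n + N) s) $ i" for n s
  define g where "g s = snd c (\<beta> s) $ i" for s
  have fd: "(f n has_field_derivative velocity c (\<alpha> (n + N)) s $ i) (at s)" if s: "s \<in> ball 0 r" for n s
    unfolding f_def
    by (rule hol_curve_velocity[OF leafwise_hol_curve[OF \<alpha>_leafwise] open_ball c(1)]) (use s r(2) N[of "n + N"] in auto)
  have loc: "\<exists>r'>0. \<forall>\<^sub>F n in sequentially. \<forall>y\<in>ball t r'. dist (f n y) (g y) < e"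
    if t: "t \<in> ball 0 r" and e: "e > 0" for t e
  proof -
    have tD: "t \<in> unit_disc" "\<beta> t \<in> fst c" using t r by blast+
    define O' where "O' = {x \<in> fst c. snd c x \<in> {z. cmod (z $ i - g t) < e / 2}}"
    have "open {z. cmod ((z :: complex^_) $ i - g t) < e / 2}" by (intro open_Collect_less continuous_intros)
    then have O': "open O'" unfolding O'_def by (rule chart_preimage_open[OF c(1)])
    have "\<beta> t \<in> O'" using tD e by (simp add: O'_def g_def)
    from conv_local[OF tD(1) O' this] obtain r' where r': "r' > 0" "\<beta> ` ball t r' \<subseteq> O'"
      "\<forall>\<^sub>F n in sequentially. \<alpha> n ` ball t r' \<subseteq> O'" by metis
    have "\<forall>\<^sub>F n in sequentially. \<alpha> (n + N) ` ball t r' \<subseteq> O'"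
      using r'(3) eventually_sequentially_seg[of "\<lambda>n. \<alpha> n ` ball t r' \<subseteq> O'" N] by simp
    then have "\<forall>\<^sub>F n in sequentially. \<forall>y\<in>ball t r'. dist (f n y) (g y) < e"
    proof eventually_elim
      case (elim n)
      show ?case
      proof
        fix y assume y: "y \<in> ball t r'"
        have "\<alpha> (n + N) y \<in> O'" "\<beta> y \<in> O'" using elim r'(2) y by blast+
        then have "cmod (f n y - g t) < e / 2" "cmod (g y - g t) < e / 2" by (simp_all add: O'_def f_def g_def)
        then show "dist (f n y) (g y) < e"
          using dist_triangle2[of "f n y" "g y" "g t"] by (simp add: dist_norm)
      qed
    qed
    then show ?thesis using r'(1) by blast
  qed
  have "\<exists>g'. \<forall>x\<in>ball 0 r. (g has_field_derivative g' x) (at x) \<and> (\<lambda>n. velocity c (\<alpha> (n + N)) x $ i) \<longlonglongrightarrow> g' x"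
  proof (rule has_complex_derivative_uniform_sequence[OF open_ball fd])
    fix x :: complex assume x: "x \<in> ball 0 r"
    then obtain d where d: "d > 0" "cball x d \<subseteq> ball 0 r" using open_contains_cball open_ball by blast
    have "uniform_limit (cball x d) f g sequentially"
      by (rule uniform_limit_compact[OF compact_cball loc]) (use d(2) in auto)
    then show "\<exists>d>0. cball x d \<subseteq> ball 0 r \<and> uniform_limit (cball x d) f g sequentially" using d by blast
  qed
  then obtain g' where g': "(g has_field_derivative g') (at 0)" "(\<lambda>n. velocity c (\<alpha> (n + N)) 0 $ i) \<longlonglongrightarrow> g'"
    using r(1) by (metis centre_in_ball)
  have "g' = velocity c \<beta> 0 $ i" using DERIV_imp_deriv[OF g'(1)] by (simp add: velocity_def g_def[abs_def])
  then show "(\<lambda>n. velocity c (\<alpha> n) 0 $ i) \<longlonglongrightarrow> velocity c \<beta> 0 $ i"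
    using g'(2) LIMSEQ_offset[of "\<lambda>n. velocity c (\<alpha> n) 0 $ i" N] by simp
qed

theorem modulus_conv:
  assumes h: "hyperbolic_foliation A E F" and g: "hermitian_metric A g"
  shows "(\<lambda>n. modulus_of_uniformization A E F g (\<alpha> n 0)) \<longlonglongrightarrow> modulus_of_uniformization A E F g (\<beta> 0)"
proof -
  obtain c where c: "c \<in> A" "\<beta> 0 \<in> fst c" by (rule chart_cover)
  have x: "(\<lambda>n. \<alpha> n 0) \<longlonglongrightarrow> \<beta> 0" by (rule conv_point) simp
  have sx: "(\<lambda>n. snd c (\<alpha> n 0)) \<longlonglongrightarrow> snd c (\<beta> 0)" by (rule conv_chart[OF _ c]) simp
  have ev: "\<forall>\<^sub>F n in sequentially. \<alpha> n 0 \<in> fst c" by (rule topological_tendstoD[OF x chart_open(1)[OF c(1)] c(2)])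
  have gl: "(\<lambda>n. g c (\<alpha> n 0) $ i $ j) \<longlonglongrightarrow> g c (\<beta> 0) $ i $ j" for i j
  proof -
    have "Cinf_on (\<lambda>z. g c (chart_inv c z) $ i $ j) (snd c ` fst c)" using g c(1) by (simp add: hermitian_metric_def)
    then have "Ck_on 0 (\<lambda>z. g c (chart_inv c z) $ i $ j) (snd c ` fst c)" unfolding Cinf_on_def by blast
    then have "continuous_on (snd c ` fst c) (\<lambda>z. g c (chart_inv c z) $ i $ j)" by simp
    then have "(\<lambda>n. g c (chart_inv c (snd c (\<alpha> n 0))) $ i $ j) \<longlonglongrightarrow> g c (chart_inv c (snd c (\<beta> 0))) $ i $ j"
      by (rule continuous_on_tendsto_compose[OF _ sx]) (use c(2) ev in \<open>auto elim: eventually_mono\<close>)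
    then have "(\<lambda>n. g c (chart_inv c (snd c (\<alpha> n 0))) $ i $ j) \<longlonglongrightarrow> g c (\<beta> 0) $ i $ j" using c by simp
    then show ?thesis
      by (rule Lim_transform_eventually) (use ev c(1) in \<open>auto elim: eventually_mono\<close>)
  qed
  have "(\<lambda>n. metric_length g c (\<alpha> n 0) (velocity c (\<alpha> n) 0)) \<longlonglongrightarrow> metric_length g c (\<beta> 0) (velocity c \<beta> 0)"
    unfolding metric_length_def sesq_form_def
    by (intro tendsto_intros gl velocity_conv[OF c])
  then have "(\<lambda>n. metric_length g c (\<alpha> n 0) (velocity c (\<alpha> n) 0)) \<longlonglongrightarrow> modulus_of_uniformization A E F g (\<beta> 0)"
    by (simp add: modulus_limit[OF h g c])
  then show ?thesis
  proof (rule Lim_transform_eventually)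
    show "\<forall>\<^sub>F n in sequentially. metric_length g c (\<alpha> n 0) (velocity c (\<alpha> n) 0) = modulus_of_uniformization A E F g (\<alpha> n 0)"
      using ev
    proof eventually_elim
      case (elim n)
      obtain L' where "L' \<in> leafs" "uniformization_of A E F L' (\<alpha> n)" using unif by blast
      then show ?case using modulus_eq[OF h g, of L' "\<alpha> n" "\<alpha> n 0" c] c(1) elim by simp
    qed
  qed
qed

end

text \<open>Provides the relative compactness that \<open>NCP\<close> asks of the base points, in a
  space without a chosen metric.\<close>

lemma compact_insert_limit:
  fixes X :: "nat \<Rightarrow> 'b::topological_space"
  assumes "X \<longlonglongrightarrow> l" shows "compact (insert l (range X))"
proof (rule compactI)
  fix \<C> assume \<C>: "\<forall>t\<in>\<C>. open t" "insert l (range X) \<subseteq> \<Union>\<C>"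
  then obtain S where S: "S \<in> \<C>" "l \<in> S" "open S" by blast
  obtain N where N: "\<And>n. n \<ge> N \<Longrightarrow> X n \<in> S"
    using topological_tendstoD[OF assms S(3,2)] by (auto simp: eventually_sequentially)
  have "\<forall>n. \<exists>t\<in>\<C>. X n \<in> t" using \<C>(2) by blast
  then obtain t where t: "\<And>n. t n \<in> \<C>" "\<And>n. X n \<in> t n" by metis
  have "X n \<in> \<Union>(insert S (t ` {..<N}))" for n using N[of n] t(2)[of n] by (cases "n < N") auto
  then show "\<exists>\<C>'\<subseteq>\<C>. finite \<C>' \<and> insert l (range X) \<subseteq> \<Union>\<C>'"
    using S t(1) by (intro exI[of _ "insert S (t ` {..<N})"]) auto
qed

text \<open>\<open>NCP\<close> yields only a convergent subsequence. Applied to the subsequences of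
  a given sequence this is enough for continuity.\<close>

lemma (in foliated) modulus_subsequence:
  assumes h: "hyperbolic_foliation A E F" and g: "hermitian_metric A g"
    and ncp: "NCP A (uniformizations A E F)" and L: "L \<in> leafs" "p \<in> L"
    and nosep: "\<forall>q\<in>E. \<not> local_separatrix A L q"
    and X: "\<And>n. X n \<notin> E" "X \<longlonglongrightarrow> p"
  obtains r where "strict_mono (r :: nat \<Rightarrow> nat)"
    "(\<lambda>n. modulus_of_uniformization A E F g (X (r n))) \<longlonglongrightarrow> modulus_of_uniformization A E F g p"
proof -
  have "\<exists>a. \<exists>L'\<in>leafs. uniformization_of A E F L' a \<and> a 0 = X n" for n
    using centered_uniformization[OF h X(1)[of n]] by metis
  then obtain a where a: "\<And>n. \<exists>L'\<in>leafs. uniformization_of A E F L' (a n)" "\<And>n. a n 0 = X n" by metis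
  have "a n \<in> uniformizations A E F" for n
  proof -
    obtain L' where L': "L' \<in> leafs" "uniformization_of A E F L' (a n)" using a(1) by blast
    have "a n ` unit_disc \<subseteq> L'" using uniformization_image[OF L'(2,1)] by simp
    then show ?thesis using L' by (auto simp: uniformizations_def leaf_discs_def uniformization_of_def)
  qed
  moreover have "compact (closure ((\<lambda>\<alpha>. \<alpha> 0) ` range a))"
  proof -
    have im: "(\<lambda>\<alpha>. \<alpha> 0) ` range a = range X" by (auto simp: a(2) image_image)
    have comp: "compact (insert p (range X))" by (rule compact_insert_limit[OF X(2)])
    have "closure (range X) \<subseteq> insert p (range X)"
      using compact_imp_closed[OF comp] by (intro closure_minimal) auto
    then have "closure (range X) = insert p (range X) \<inter> closure (range X)" by blast
    then show ?thesis unfolding im using compact_Int_closed[OF comp closed_closure, of "range X"] by simp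
  qed
  ultimately have "normal_family A (range a)" using ncp unfolding NCP_def by blast
  then obtain r l where r: "strict_mono (r :: nat \<Rightarrow> nat)" "holomorphic_disc A l" "converges_locally_uniformly (a \<circ> r) l"
    unfolding normal_family_def by (metis rangeI)
  have l0: "l 0 = p"
  proof (rule LIMSEQ_unique)
    have Xr: "(\<lambda>n. X (r n)) \<longlonglongrightarrow> p" using LIMSEQ_subseq_LIMSEQ[OF X(2) r(1)] by (simp add: o_def)
    then show "(\<lambda>n. X (r n)) \<longlonglongrightarrow> p" .
    show "(\<lambda>n. X (r n)) \<longlonglongrightarrow> l 0"
    proof (rule topological_tendstoI)
      fix S assume "open S" "l 0 \<in> S"
      moreover have "continuous_on unit_disc l" using r(2) by (simp add: holomorphic_disc_def)
      ultimately obtain \<rho> where "\<rho> > 0" "\<forall>\<^sub>F n in sequentially. (a \<circ> r) n ` ball 0 \<rho> \<subseteq> S"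
        using converges_locally_uniformly_local[OF r(3), of 0 S] by (metis centre_in_ball zero_less_one)
      then show "\<forall>\<^sub>F n in sequentially. X (r n) \<in> S"
        by (auto elim!: eventually_mono simp: a(2)[symmetric])
    qed
  qed
  interpret uniformization_limit A E F "a \<circ> r" l L
    by unfold_locales (use a(1) r L l0 nosep in auto)
  show thesis
    using that[OF r(1)] modulus_conv[OF h g] by (simp add: a(2) l0)
qed

theorem proposition1p10:
  fixes A :: "('a::{t2_space, second_countable_topology}, 'n::finite) chart set"
    and E :: "'a set"
    and F :: "('a, 'n) foliation"
    and g :: "('a, 'n) metric_coeffs"
    and L :: "'a set"
    and p :: 'a
  assumes "complex_manifold A"
    and "shfc A E F"
    and "hyperbolic_foliation A E F"
    and "hermitian_metric A g"
    and "NCP A (uniformizations A E F)"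
    and "L \<in> leaves A E F"
    and "\<forall>q\<in>E. \<not> local_separatrix A L q"
    and "p \<in> L"
  shows "continuous (at p within - E) (modulus_of_uniformization A E F g)"
proof -
  interpret foliated A E F using assms(1,2) by unfold_locales
  let ?\<eta> = "modulus_of_uniformization A E F g"
  \<comment> \<open>The underlying space is first countable, so sequences decide. If the values do
    not converge, infinitely many bad indices form a subsequence, and a further one from
    \<open>modulus_subsequence\<close> gives the contradiction.\<close>
  have "(?\<eta> \<circ> X) \<longlonglongrightarrow> ?\<eta> p" if X: "\<forall>n. X n \<in> - E - {p}" "X \<longlonglongrightarrow> p" for X
  proof (rule ccontr)
    assume "\<not> (?\<eta> \<circ> X) \<longlonglongrightarrow> ?\<eta> p"
    then obtain e where e: "e > 0" "\<not> (\<forall>\<^sub>F n in sequentially. dist (?\<eta> (X n)) (?\<eta> p) < e)"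
      by (auto simp: tendsto_iff)
    then have "\<exists>\<^sub>F n in cofinite. \<not> dist (?\<eta> (X n)) (?\<eta> p) < e"
      by (simp add: not_eventually cofinite_eq_sequentially)
    then have "infinite {n. \<not> dist (?\<eta> (X n)) (?\<eta> p) < e}"
      by (simp only: frequently_cofinite not_False_eq_True)
    then obtain s :: "nat \<Rightarrow> nat" where s: "strict_mono s" "\<And>n. \<not> dist (?\<eta> (X (s n))) (?\<eta> p) < e"
      using infinite_enumerate by blast
    have "(\<lambda>n. X (s n)) \<longlonglongrightarrow> p" using LIMSEQ_subseq_LIMSEQ[OF X(2) s(1)] by (simp add: o_def)
    then obtain r where "strict_mono (r :: nat \<Rightarrow> nat)" "(\<lambda>n. ?\<eta> (X (s (r n)))) \<longlonglongrightarrow> ?\<eta> p"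
      using modulus_subsequence[OF assms(3-6,8,7), of "\<lambda>n. X (s n)"] X(1) by blast
    then have "\<forall>\<^sub>F n in sequentially. dist (?\<eta> (X (s (r n)))) (?\<eta> p) < e"
      using e(1) by (simp add: tendsto_iff)
    then show False using s(2) by (auto simp: eventually_sequentially)
  qed
  then show ?thesis unfolding continuous_within tendsto_at_iff_sequentially by blast
qed

end
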